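(* Let $N,D,N_t,N_r\ge1$ be integers with $ND\le N_t$, and let $\rho>0$, $T>0$; if $T<1$ assume $N\ge 2$. Consider the orthogonal random precoding scheme with $D$ precoder groups of $N$ precoding vectors each, used over $D$ time slots. Let $$\mathcal P^{(T)}_{MPG}=\mathbf P\Big\{\max_{1\le n\le N,\ 1\le d\le D}SINR_{n,d,1}>T\Big\},\qquad \mathcal P^{(T)}_{AS\&MPG}=\mathbf P\Big\{\max_{1\le n\le N,\ 1\le d\le D,\ 1\le r\le N_r}SINR_{n,d,r}>T\Big\}$$ be the downlink coverage probabilities for a single-antenna receiver and for an antenna-selection receiver with $N_r$ antennas, respectively. Then $$\mathcal P^{(T)}_{MPG}=\begin{cases}1-\left(1-\dfrac{N}{(T+1)^{N-1}}\,e^{-TN/\rho}\right)^{D}, & T\ge 1,\\[2mm] 1-\left[1-\left(\mathcal P^{(T)}_1+\displaystyle\sum_{k=2}^{m-1}\mathcal P^{(T)}_k+\mathcal P^{(T)}_m\right)\right]^{D}, & T<1,\end{cases}$$ $$\mathcal P^{(T)}_{AS\&MPG}=\begin{cases}1-\left(1-\dfrac{N}{(T+1)^{N-1}}\,e^{-TN/\rho}\right)^{N_rD}, & T\ge 1,\\[2mm] 1-\left[1-\left(\mathcal P^{(T)}_1+\displaystyle\sum_{k=2}^{m-1}\mathcal P^{(T)}_k+\mathcal P^{(T)}_m\right)\right]^{N_rD}, & T<1,\end{cases}$$ where $m=\lceil 1/T\rceil$ (the middle sum is empty if $m=2$) and $\mathcal P^{(T)}_1,\mathcal P^{(T)}_k,\mathcal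 P^{(T)}_m$ are the explicit quantities defined in the context.
   Context: Model. $H\in\mathbb C^{N_r\times N_t}$ has i.i.d. circularly symmetric complex Gaussian entries $\mathcal{CN}(0,1)$ and is the same over all $D$ time slots; $h_r^T$ denotes its $r$th row (the channel to the $r$th receive antenna). $\phi_{n,d}\in\mathbb C^{N_t\times1}$, $1\le n\le N$, $1\le d\le D$, are $ND$ mutually orthonormal (random) precoding vectors, independent of $H$; in slot $d$ the group $\phi_{1,d},\dots,\phi_{N,d}$ is used. $\rho>0$ is the average SNR. The signal-to-interference-plus-noise ratio of the $n$th beam in slot $d$ at antenna $r$ is $$SINR_{n,d,r}=\frac{|h_r^T\phi_{n,d}|^2}{\frac N\rho+\sum_{i\ne n,\,1\le i\le N}|h_r^T\phi_{i,d}|^2}.$$ Auxiliary quantities (for $0<T<1$, $N\ge2$, $m=\lceil1/T\rceil\ge 2$). Convention $0^0=1$ and $\binom{a}{b}=0$ for $b>a$. For $1\le k\le m-1$ set $b_k=\dfrac{TN}{\rho(1/k-T)}$. For an integer $p\ge1$ and an expression $g$ depending on the summation indices $i,l$, $$\xi_p(g)=\frac{N}{(N-2)!}\sum_{t=1}^{p}\binom{N-1}{t-1}(-1)^{t+1}\sum_{i=0}^{N-2}\binom{N-2}{i}(1-t)^i\,i!\sum_{l=0}^{i}g(i,l).$$ Then $$\mathcal P^{(T)}_1=\frac{N}{(N-2)!}\left(e^{-TN/\rho}C_1+C_2\right),$$ $$\mathcal P^{(T)}_k=\xi_k\!\left(e^{-TN/\rho}\frac{T^l}{l!}D_1-\frac{1}{(k-1)^l\,l!}D_2\right)+\xi_k\!\left(\frac{1}{k^l\,l!}E_1-\frac{1}{(k-1)^l\,l!}E_2\right),\quad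 2\le k\le m-1,$$ $$\mathcal P^{(T)}_m=\xi_m\!\left(e^{-TN/\rho}\frac{T^l}{l!}F_1-\frac{1}{(m-1)^l\,l!}F_2\right),$$ where $D_1,D_2,E_1,E_2$ depend on $k,i,l$ and $F_1,F_2$ on $m,i,l$: $$C_1=\frac{(N-2)!}{(T+1)^{N-1}}\Big(1-e^{-(T+1)b_1}\sum_{l=0}^{N-2}\frac{(T+1)^lb_1^l}{l!}\Big),\qquad C_2=\frac{(N-2)!}{2^{N-1}}e^{-2b_1}\sum_{l=0}^{N-2}\frac{2^lb_1^l}{l!},$$ $$D_1=\sum_{v=0}^{l}\binom lv\Big(\frac N\rho\Big)^{l-v}\frac{(N-i+v-2)!}{(T+1)^{N-i+v-1}}\sum_{u=0}^{N-i+v-2}\frac{(T+1)^u}{u!}\Big(e^{-(T+1)b_{k-1}}b_{k-1}^u-e^{-(T+1)b_k}b_k^u\Big),$$ $$D_2=\frac{(N-i+l-2)!}{(\frac{k}{k-1})^{N-i+l-1}}\Big[e^{-\frac{k}{k-1}b_{k-1}}\sum_{u=0}^{N-i+l-2}\Big(\frac{k}{k-1}\Big)^u\frac{b_{k-1}^u}{u!}-e^{-\frac{k}{k-1}b_k}\sum_{u=0}^{N-i+l-2}\Big(\frac{k}{k-1}\Big)^u\frac{b_k^u}{u!}\Big],$$ $$E_1=\frac{(N-i+l-2)!}{(\frac{k+1}{k})^{N-i+l-1}}e^{-\frac{k+1}{k}b_k}\sum_{u=0}^{N-i+l-2}\Big(\frac{k+1}{k}\Big)^u\frac{b_k^u}{u!},$$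 $$E_2=\frac{(N-i+l-2)!}{(\frac{k}{k-1})^{N-i+l-1}}e^{-\frac{k}{k-1}b_k}\sum_{u=0}^{N-i+l-2}\Big(\frac{k}{k-1}\Big)^u\frac{b_k^u}{u!},$$ $$F_1=\sum_{v=0}^{l}\binom lv\Big(\frac N\rho\Big)^{l-v}\frac{(N-i+v-2)!}{(T+1)^{N-i+v-1}}e^{-(T+1)b_{m-1}}\sum_{u=0}^{N-i+v-2}(T+1)^u\frac{b_{m-1}^u}{u!},$$ $$F_2=\frac{(N-i+l-2)!}{(\frac{m}{m-1})^{N-i+l-1}}e^{-\frac{m}{m-1}b_{m-1}}\sum_{u=0}^{N-i+l-2}\Big(\frac{m}{m-1}\Big)^u\frac{b_{m-1}^u}{u!}.$$ *)

theory Defs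
  imports "HOL-Probability.Probability"
begin

text \<open>Density of the circularly symmetric complex Gaussian law \<open>CN(0,1)\<close> with respect to Lebesgue
  measure on the complex plane: real and imaginary part are independent centred Gaussians of
  variance \<open>1/2\<close> each.\<close>

definition complex_normal_density :: "complex \<Rightarrow> real" where
  "complex_normal_density z = exp (- (cmod z)\<^sup>2) / pi"

lemma complex_normal_density_Re_Im:
  "complex_normal_density z =
     normal_density 0 (sqrt (1/2)) (Re z) * normal_density 0 (sqrt (1/2)) (Im z)"
  by (simp add: complex_normal_density_def normal_density_def cmod_power2 power_divide real_sqrt_divide
      flip: exp_add)

text \<open>The product \<open>h\<^sup>T \<phi>\<close>, without conjugation.\<close>

definition tprod :: "complex ^ 'n \<Rightarrow> complex ^ 'n \<Rightarrow> complex" where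
  "tprod h v = (\<Sum>j\<in>UNIV. h $ j * v $ j)"

text \<open>The Hermitian inner product. The library's \<open>\<bullet>\<close> on \<open>complex ^ 'n\<close> is only its real part.\<close>

definition cinner_vec :: "complex ^ 'n \<Rightarrow> complex ^ 'n \<Rightarrow> complex" where
  "cinner_vec u v = (\<Sum>j\<in>UNIV. cnj (u $ j) * v $ j)"

definition corthonormal_family :: "'i set \<Rightarrow> ('i \<Rightarrow> complex ^ 'n) \<Rightarrow> bool" where
  "corthonormal_family I v \<longleftrightarrow>
     (\<forall>i\<in>I. \<forall>j\<in>I. cinner_vec (v i) (v j) = (if i = j then 1 else 0))"

text \<open>\<open>sinr N \<rho> h \<phi> n\<close> is the SINR of beam \<open>n\<close> at an antenna with channel \<open>h\<close> in a slot whose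
  precoder group is \<open>\<phi> 1, \<dots>, \<phi> N\<close>.\<close>

definition sinr ::
  "nat \<Rightarrow> real \<Rightarrow> complex ^ 'n \<Rightarrow> (nat \<Rightarrow> complex ^ 'n) \<Rightarrow> nat \<Rightarrow> real" where
  "sinr N \<rho> h \<phi> n =
     (cmod (tprod h (\<phi> n)))\<^sup>2 /
     (real N / \<rho> + (\<Sum>i\<in>{1..N} - {n}. (cmod (tprod h (\<phi> i)))\<^sup>2))"

text \<open>The library's \<open>indep_var\<close> forces both random variables to have values in the same type; this
  is its characterisation \<open>indep_var_eq\<close>, with the two value types distinct.\<close>

definition indep_rvs ::
  "'w measure \<Rightarrow> 'a measure \<Rightarrow> ('w \<Rightarrow> 'a) \<Rightarrow> 'b measure \<Rightarrow> ('w \<Rightarrow> 'b) \<Rightarrow> bool" where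
  "indep_rvs M S X S' Y \<longleftrightarrow>
     X \<in> measurable M S \<and> Y \<in> measurable M S' \<and>
     prob_space.indep_set M
       (sigma_sets (space M) {X -` A \<inter> space M |A. A \<in> sets S})
       (sigma_sets (space M) {Y -` A \<inter> space M |A. A \<in> sets S'})"

lemma (in prob_space) indep_rvs_iff_indep_var:
  "indep_rvs M S X S' Y \<longleftrightarrow> indep_var S X S' Y"
  by (auto simp: indep_rvs_def indep_var_eq)

text \<open>Below, \<open>H r \<omega>\<close> is the channel row of receive antenna \<open>r\<close> and \<open>\<phi> n d \<omega>\<close> is the \<open>n\<close>-th
  precoding vector of slot \<open>d\<close>.\<close>

definition P_MPG ::
  "'w measure \<Rightarrow> nat \<Rightarrow> nat \<Rightarrow> real \<Rightarrow> (nat \<Rightarrow> 'w \<Rightarrow> complex ^ 'n) \<Rightarrow>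
   (nat \<Rightarrow> nat \<Rightarrow> 'w \<Rightarrow> complex ^ 'n) \<Rightarrow> real \<Rightarrow> real" where
  "P_MPG M N D \<rho> H \<phi> T =
     measure M {\<omega> \<in> space M.
       (MAX (n, d)\<in>{1..N} \<times> {1..D}. sinr N \<rho> (H 1 \<omega>) (\<lambda>i. \<phi> i d \<omega>) n) > T}"

definition P_AS_MPG ::
  "'w measure \<Rightarrow> nat \<Rightarrow> nat \<Rightarrow> nat \<Rightarrow> real \<Rightarrow> (nat \<Rightarrow> 'w \<Rightarrow> complex ^ 'n) \<Rightarrow>
   (nat \<Rightarrow> nat \<Rightarrow> 'w \<Rightarrow> complex ^ 'n) \<Rightarrow> real \<Rightarrow> real" where
  "P_AS_MPG M N D Nr \<rho> H \<phi> T =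
     measure M {\<omega> \<in> space M.
       (MAX (n, d, r)\<in>{1..N} \<times> {1..D} \<times> {1..Nr}.
          sinr N \<rho> (H r \<omega>) (\<lambda>i. \<phi> i d \<omega>) n) > T}"

text \<open>The closed form for \<open>T < 1\<close>. It is only used with \<open>N \<ge> 2\<close> and \<open>l \<le> i \<le> N - 2\<close>, where the
  truncated subtractions on naturals are exact; in \<open>bk N \<rho> T k\<close> one has \<open>1 \<le> k < 1/T\<close>.
  \<open>0 ^ 0 = 1\<close> and \<open>a choose b = 0\<close> for \<open>b > a\<close> hold in the library.\<close>

definition bk :: "nat \<Rightarrow> real \<Rightarrow> real \<Rightarrow> nat \<Rightarrow> real" where
  "bk N \<rho> T k = T * real N / (\<rho> * (1 / real k - T))"

definition xi :: "nat \<Rightarrow> nat \<Rightarrow> (nat \<Rightarrow> nat \<Rightarrow> real) \<Rightarrow> real" where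
  "xi N p g = real N / fact (N - 2) *
     (\<Sum>t = 1..p. real ((N - 1) choose (t - 1)) * (- 1) ^ (t + 1) *
       (\<Sum>i = 0..N - 2. real ((N - 2) choose i) * (1 - real t) ^ i * fact i *
         (\<Sum>l = 0..i. g i l)))"

definition C1 :: "nat \<Rightarrow> real \<Rightarrow> real \<Rightarrow> real" where
  "C1 N \<rho> T = fact (N - 2) / (T + 1) ^ (N - 1) *
     (1 - exp (- (T + 1) * bk N \<rho> T 1) *
        (\<Sum>l = 0..N - 2. (T + 1) ^ l * bk N \<rho> T 1 ^ l / fact l))"

definition C2 :: "nat \<Rightarrow> real \<Rightarrow> real \<Rightarrow> real" where
  "C2 N \<rho> T = fact (N - 2) / 2 ^ (N - 1) * exp (- 2 * bk N \<rho> T 1) *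
     (\<Sum>l = 0..N - 2. 2 ^ l * bk N \<rho> T 1 ^ l / fact l)"

definition D1 :: "nat \<Rightarrow> real \<Rightarrow> real \<Rightarrow> nat \<Rightarrow> nat \<Rightarrow> nat \<Rightarrow> real" where
  "D1 N \<rho> T k i l =
     (\<Sum>v = 0..l. real (l choose v) * (real N / \<rho>) ^ (l - v) *
       (fact (N - i + v - 2) / (T + 1) ^ (N - i + v - 1)) *
       (\<Sum>u = 0..N - i + v - 2. (T + 1) ^ u / fact u *
         (exp (- (T + 1) * bk N \<rho> T (k - 1)) * bk N \<rho> T (k - 1) ^ u
          - exp (- (T + 1) * bk N \<rho> T k) * bk N \<rho> T k ^ u)))"

definition D2 :: "nat \<Rightarrow> real \<Rightarrow> real \<Rightarrow> nat \<Rightarrow> nat \<Rightarrow> nat \<Rightarrow> real" where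
  "D2 N \<rho> T k i l =
     (let q = real k / (real k - 1) in
      fact (N - i + l - 2) / q ^ (N - i + l - 1) *
      (exp (- q * bk N \<rho> T (k - 1)) *
         (\<Sum>u = 0..N - i + l - 2. q ^ u * (bk N \<rho> T (k - 1) ^ u / fact u))
       - exp (- q * bk N \<rho> T k) *
         (\<Sum>u = 0..N - i + l - 2. q ^ u * (bk N \<rho> T k ^ u / fact u))))"

definition E1 :: "nat \<Rightarrow> real \<Rightarrow> real \<Rightarrow> nat \<Rightarrow> nat \<Rightarrow> nat \<Rightarrow> real" where
  "E1 N \<rho> T k i l =
     (let q = (real k + 1) / real k in
      fact (N - i + l - 2) / q ^ (N - i + l - 1) * exp (- q * bk N \<rho> T k) *
      (\<Sum>u = 0..N - i + l - 2. q ^ u * (bk N \<rho> T k ^ u / fact u)))"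

definition E2 :: "nat \<Rightarrow> real \<Rightarrow> real \<Rightarrow> nat \<Rightarrow> nat \<Rightarrow> nat \<Rightarrow> real" where
  "E2 N \<rho> T k i l =
     (let q = real k / (real k - 1) in
      fact (N - i + l - 2) / q ^ (N - i + l - 1) * exp (- q * bk N \<rho> T k) *
      (\<Sum>u = 0..N - i + l - 2. q ^ u * (bk N \<rho> T k ^ u / fact u)))"

definition F1 :: "nat \<Rightarrow> real \<Rightarrow> real \<Rightarrow> nat \<Rightarrow> nat \<Rightarrow> nat \<Rightarrow> real" where
  "F1 N \<rho> T m i l =
     (\<Sum>v = 0..l. real (l choose v) * (real N / \<rho>) ^ (l - v) *
       (fact (N - i + v - 2) / (T + 1) ^ (N - i + v - 1)) *
       exp (- (T + 1) * bk N \<rho> T (m - 1)) *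
       (\<Sum>u = 0..N - i + v - 2. (T + 1) ^ u * (bk N \<rho> T (m - 1) ^ u / fact u)))"

definition F2 :: "nat \<Rightarrow> real \<Rightarrow> real \<Rightarrow> nat \<Rightarrow> nat \<Rightarrow> nat \<Rightarrow> real" where
  "F2 N \<rho> T m i l =
     (let q = real m / (real m - 1) in
      fact (N - i + l - 2) / q ^ (N - i + l - 1) * exp (- q * bk N \<rho> T (m - 1)) *
      (\<Sum>u = 0..N - i + l - 2. q ^ u * (bk N \<rho> T (m - 1) ^ u / fact u)))"

definition P_first :: "nat \<Rightarrow> real \<Rightarrow> real \<Rightarrow> real" where
  "P_first N \<rho> T = real N / fact (N - 2) * (exp (- T * real N / \<rho>) * C1 N \<rho> T + C2 N \<rho> T)"

definition P_middle :: "nat \<Rightarrow> real \<Rightarrow> real \<Rightarrow> nat \<Rightarrow> real" where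
  "P_middle N \<rho> T k =
     xi N k (\<lambda>i l. exp (- T * real N / \<rho>) * (T ^ l / fact l) * D1 N \<rho> T k i l
                   - 1 / ((real k - 1) ^ l * fact l) * D2 N \<rho> T k i l)
   + xi N k (\<lambda>i l. 1 / (real k ^ l * fact l) * E1 N \<rho> T k i l
                   - 1 / ((real k - 1) ^ l * fact l) * E2 N \<rho> T k i l)"

definition P_last :: "nat \<Rightarrow> real \<Rightarrow> real \<Rightarrow> nat \<Rightarrow> real" where
  "P_last N \<rho> T m =
     xi N m (\<lambda>i l. exp (- T * real N / \<rho>) * (T ^ l / fact l) * F1 N \<rho> T m i l
                   - 1 / ((real m - 1) ^ l * fact l) * F2 N \<rho> T m i l)"

end

theory Submission
  imports Defs "HOL-Real_Asymp.Real_Asymp"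
begin

text \<open>For fixed orthonormal precoding vectors, the unitary invariance of the Gaussian law makes the
  numbers \<open>h\<^sub>r\<^sup>T \<phi>\<^bsub>n,d\<^esub>\<close> independent and \<open>CN(0,1)\<close>-distributed, so their squared moduli \<open>X\<^sub>n\<close> are independent
  standard exponential variables. Hence the probability of no coverage is a power of the probability
  for one antenna and one slot, and the randomness of the precoders is irrelevant.

  In one slot with \<open>c = N/\<rho>\<close>, coverage means that the largest variable \<open>x\<close> and the sum \<open>y\<close> of the others
  satisfy \<open>T (c + y) < x\<close>. If \<open>T \<ge> 1\<close>, this inequality forces \<open>x\<close> to be the maximum and the probability
  is elementary. If \<open>T < 1\<close>, the joint density of \<open>(x, y)\<close> is a combination of truncated powers
  \<open>(y - t x)\<^sub>+\<^bsup>N-2\<^esup>\<close>, which is a polynomial times \<open>e\<^bsup>-x-y\<^esup>\<close> on each cell \<open>(k - 1) x \<le> y < k x\<close>. The cells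
  with \<open>k \<le> m\<close> cover the region of integration, the line \<open>x = T (c + y)\<close> crosses \<open>y = k x\<close> at
  \<open>y = b\<^sub>k\<close>, and integrating over the \<open>k\<close>-th cell yields the \<open>k\<close>-th summand of the formula.\<close>

section \<open>Isometries and product measures\<close>

text \<open>The sum of \<open>n\<close> exponential variables, each cut off at \<open>x\<close>, has
  as density an \<open>n\<close>-fold convolution of \<open>exp (- s)\<close> on
  \<open>[0, x)\<close>. The exponentials multiply to \<open>exp (- y)\<close> however the sum is
  split, so up to scaling a density of a sum of uniform variables remains: an iterated finite
  difference of truncated powers. This is the source of the index \<open>t\<close> in the closed
  form. Of the other indices, \<open>i\<close> expands \<open>(y - (t - 1) x)^(N - 2)\<close>,
  \<open>l\<close> comes from integrating over \<open>x\<close> above a lower limit,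
  \<open>v\<close> expands \<open>(c + y)^l\<close> when that limit is \<open>T (c + y)\<close>, and
  \<open>u\<close> comes from integrating over \<open>y\<close>.

  The signs hide that the density is non-negative. Hence integrals are exchanged as non-negative
  integrals, and the signed expansion is integrated termwise, as a Bochner integral, only inside one
  cell. There \<open>x\<close> is the inner variable: at fixed height \<open>y\<close> the slice is
  an interval or a half-line with explicit ends, and \<open>b_k\<close> is the height at which its
  lower end changes from the line to the ray \<open>y = k x\<close>. In the last cell this change
  never happens, which is why its formula is shorter.\<close>

lemma distr_lborel_orthogonal_transformation:
  fixes F :: "'a::euclidean_space \<Rightarrow> 'a"
  assumes F: "orthogonal_transformation F"
  shows "distr lborel borel F = lborel"
proof (rule measure_eqI)
  show "sets (distr lborel borel F) = sets lborel" by simp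
next
  fix A assume "A \<in> sets (distr lborel borel F)"
  then have A[measurable]: "A \<in> sets borel" by simp
  have lin: "linear F" using F by (simp add: orthogonal_transformation_linear)
  then have Fm[measurable]: "F \<in> borel_measurable borel"
    by (intro borel_measurable_continuous_onI linear_continuous_on) (simp add: linear_conv_bounded_linear)
  have inv: "F (inv F y) = y" for y
    using orthogonal_transformation_surj[OF F] by (simp add: surj_f_inv_f)
  have shift: "(\<integral>\<^sup>+x. f (x + c) \<partial>lborel) = (\<integral>\<^sup>+x. f x \<partial>lborel)"
    if [measurable]: "f \<in> borel_measurable borel" for c :: 'a and f :: "'a \<Rightarrow> ennreal"
    by (subst lborel_distr_plus[of c, symmetric]) (simp add: nn_integral_distr add.commute)
  have [measurable]: "ball (0::'a) 1 \<in> sets borel" by simp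
  let ?b = "emeasure lborel (ball (0::'a) 1)"
  \<comment> \<open>No determinant is involved: the double integral of
    \<open>indicator (ball 0 1) y * indicator A (F x + y)\<close> is evaluated in both orders. This
    uses only translation invariance and the fact that the preimage of a unit ball under an isometry
    is a unit ball. The factor \<open>?b\<close> is positive and finite and cancels.\<close>
  have "emeasure (distr lborel borel F) A * ?b
      = (\<integral>\<^sup>+y. indicator (ball (0::'a) 1) y * (\<integral>\<^sup>+x. indicator A (F x) \<partial>lborel) \<partial>lborel)"
  proof -
    have "emeasure (distr lborel borel F) A = (\<integral>\<^sup>+x. indicator A (F x) \<partial>lborel)"
      using nn_integral_distr[of F lborel borel "indicator A"] by simp
    then show ?thesis
      by (subst nn_integral_multc) (simp_all add: mult.commute borel_measurable_indicator)
  qed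
  also have "\<dots> = (\<integral>\<^sup>+y. indicator (ball (0::'a) 1) y * (\<integral>\<^sup>+x. indicator A (F x + y) \<partial>lborel) \<partial>lborel)"
  proof (rule nn_integral_cong, rule arg_cong2[where f="(*)"], rule refl)
    fix y
    have "F (x + inv F y) = F x + y" for x
      using linear_add[OF lin] inv by simp
    then show "(\<integral>\<^sup>+x. indicator A (F x) \<partial>lborel) = (\<integral>\<^sup>+x. indicator A (F x + y) \<partial>lborel :: ennreal)"
      using shift[of "\<lambda>x. indicator A (F x)" "inv F y"] by simp
  qed
  also have "\<dots> = (\<integral>\<^sup>+y. (\<integral>\<^sup>+x. indicator (ball (0::'a) 1) y * indicator A (F x + y) \<partial>lborel) \<partial>lborel)"
    by (simp add: nn_integral_cmult)
  also have "\<dots> = (\<integral>\<^sup>+x. (\<integral>\<^sup>+y. indicator (ball (0::'a) 1) y * indicator A (F x + y) \<partial>lborel) \<partial>lborel)"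
    by (rule lborel_pair.Fubini') measurable
  also have "\<dots> = (\<integral>\<^sup>+x. (\<integral>\<^sup>+y. indicator (ball (0::'a) 1) (y - F x) * indicator A y \<partial>lborel) \<partial>lborel)"
  proof (rule nn_integral_cong)
    fix x
    show "(\<integral>\<^sup>+y. indicator (ball (0::'a) 1) y * indicator A (F x + y) \<partial>lborel)
        = (\<integral>\<^sup>+y. indicator (ball (0::'a) 1) (y - F x) * indicator A y \<partial>lborel :: ennreal)"
      using shift[of "\<lambda>y. indicator (ball (0::'a) 1) (y - F x) * indicator A y" "F x"] by (simp add: add.commute)
  qed
  also have "\<dots> = (\<integral>\<^sup>+y. (\<integral>\<^sup>+x. indicator (ball (0::'a) 1) (y - F x) * indicator A y \<partial>lborel) \<partial>lborel)"
    by (rule lborel_pair.Fubini') measurable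
  also have "\<dots> = (\<integral>\<^sup>+y. ?b * indicator A y \<partial>lborel)"
  proof (rule nn_integral_cong)
    fix y
    have "indicator (ball (0::'a) 1) (y - F x) = (indicator (ball (inv F y) 1) x :: ennreal)" for x
    proof -
      have "norm (y - F x) = norm (F (inv F y - x))"
        using linear_diff[OF lin] inv by simp
      also have "\<dots> = norm (inv F y - x)" by (rule orthogonal_transformation_norm[OF F])
      finally show ?thesis by (simp add: indicator_def dist_norm norm_minus_commute)
    qed
    then have "(\<integral>\<^sup>+x. indicator (ball (0::'a) 1) (y - F x) * indicator A y \<partial>lborel)
        = emeasure lborel (ball (inv F y) 1) * indicator A y"
      by (simp add: nn_integral_multc borel_measurable_indicator)
    then show "(\<integral>\<^sup>+x. indicator (ball (0::'a) 1) (y - F x) * indicator A y \<partial>lborel) = ?b * indicator A y"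
      by (simp add: emeasure_ball)
  qed
  also have "\<dots> = emeasure lborel A * ?b"
    by (subst nn_integral_cmult) (simp_all add: mult.commute)
  finally have eq: "emeasure (distr lborel borel F) A * ?b = emeasure lborel A * ?b" .
  have "?b \<noteq> 0" "?b \<noteq> \<top>"
    by (simp_all add: emeasure_ball unit_ball_vol_pos less_imp_neq[symmetric])
  with eq show "emeasure (distr lborel borel F) A = emeasure lborel A"
    by (metis ennreal_mult_cancel_left mult.commute)
qed

text \<open>Completing the vectors \<open>e a\<close> by an orthonormal basis of their orthogonal
  complement gives an isometry \<open>G\<close> with \<open>G a = e a\<close>. The witness is its
  inverse, which is also its adjoint, because \<open>F\<close> has to read off the coordinates of
  \<open>x\<close> along the \<open>e a\<close>.\<close>

lemma orthonormal_extend: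
  fixes e :: "'a::euclidean_space \<Rightarrow> 'a"
  assumes A: "A \<subseteq> Basis"
    and e: "\<And>a b. a \<in> A \<Longrightarrow> b \<in> A \<Longrightarrow> e a \<bullet> e b = (if a = b then 1 else 0)"
  shows "\<exists>F. orthogonal_transformation F \<and> (\<forall>a\<in>A. \<forall>x. F x \<bullet> a = x \<bullet> e a)"
proof -
  have finA: "finite A" using A finite_Basis by (rule finite_subset)
  have inj: "inj_on e A"
    by (rule inj_onI) (metis e zero_neq_one)
  have e0: "0 \<notin> e ` A"
    using e by force
  have orth: "pairwise orthogonal (e ` A)"
    using e by (auto simp: pairwise_def orthogonal_def)
  have dimA: "dim (e ` A) = card A"
    using pairwise_orthogonal_independent[OF orth e0] by (simp add: dim_eq_card_independent card_image inj)
  define W where "W = {y \<in> UNIV. \<forall>x \<in> e ` A. orthogonal x y}"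
  have subW: "subspace W"
    unfolding W_def by (auto simp: subspace_def orthogonal_def inner_add_right)
  have dimW: "dim W + card A = DIM('a)"
  proof -
    have "dim {y \<in> UNIV. \<forall>x \<in> span (e ` A). orthogonal x y} + dim (span (e ` A)) = dim (UNIV :: 'a set)"
      by (rule dim_subspace_orthogonal_to_vectors) auto
    moreover have "{y \<in> UNIV. \<forall>x \<in> span (e ` A). orthogonal x y} = W"
      unfolding W_def
      by (auto simp: orthogonal_commute span_base intro: orthogonal_to_span)
    ultimately show ?thesis using dimA by simp
  qed
  obtain B where B: "B \<subseteq> W" "pairwise orthogonal B" "\<And>x. x \<in> B \<Longrightarrow> norm x = 1"
    "independent B" "card B = dim W"
    using orthonormal_basis_subspace[OF subW] by metis
  have "card (Basis - A) = card B"
    using dimW B(5) A finA by (simp add: card_Diff_subset)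
  then obtain e' where e': "bij_betw e' (Basis - A) B"
    using finite_same_card_bij[of "Basis - A" B] B(4) independent_imp_finite by auto
  define E where "E = (\<lambda>b. if b \<in> A then e b else e' b)"
  have BW: "e a \<bullet> y = 0" "y \<bullet> e a = 0" if "a \<in> A" "y \<in> B" for a y
    using that B(1) by (auto simp: W_def orthogonal_def inner_commute)
  have e'B: "e' b \<in> B" if "b \<in> Basis" "b \<notin> A" for b
    using e' that by (auto simp: bij_betw_def)
  have e'e': "e' a \<bullet> e' b = (if a = b then 1 else 0)" if "a \<in> Basis - A" "b \<in> Basis - A" for a b
  proof (cases "a = b")
    case True
    then show ?thesis using B(3)[of "e' a"] e'B that by (simp add: dot_square_norm)
  next
    case False
    then have "e' a \<noteq> e' b" using e' that by (auto simp: bij_betw_def inj_on_def)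
    then show ?thesis using B(2) e'B that False by (auto simp: pairwise_def orthogonal_def)
  qed
  have E: "E a \<bullet> E b = (if a = b then 1 else 0)" if "a \<in> Basis" "b \<in> Basis" for a b
    using that e e'e' BW e'B unfolding E_def by (auto simp: )
  define G where "G = (\<lambda>x. \<Sum>b\<in>Basis. (x \<bullet> b) *\<^sub>R E b)"
  have Glin: "linear G"
    unfolding G_def by (intro linearI) (auto simp: inner_add_left scaleR_add_left sum.distrib scaleR_sum_right)
  have Gin: "G x \<bullet> G y = x \<bullet> y" for x y
  proof -
    have "G x \<bullet> G y = (\<Sum>a\<in>Basis. \<Sum>b\<in>Basis. (x \<bullet> a) * ((y \<bullet> b) * (E a \<bullet> E b)))"
      unfolding G_def by (subst inner_sum_left) (simp add: inner_sum_right sum_distrib_left mult.left_commute)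
    also have "\<dots> = (\<Sum>a\<in>Basis. \<Sum>b\<in>Basis. if b = a then (x \<bullet> a) * (y \<bullet> b) else 0)"
      by (intro sum.cong refl) (auto simp: E)
    also have "\<dots> = x \<bullet> y"
      by (simp add: euclidean_inner[of x y])
    finally show ?thesis .
  qed
  have Gorth: "orthogonal_transformation G"
    using Glin Gin by (simp add: orthogonal_transformation_def)
  show ?thesis
  proof (intro exI[of _ "inv G"] conjI ballI allI)
    show "orthogonal_transformation (inv G)" by (rule orthogonal_transformation_inv[OF Gorth])
    fix a x assume a: "a \<in> A"
    have "G a = (\<Sum>b\<in>Basis. if b = a then E b else 0)"
      unfolding G_def using a A by (intro sum.cong refl) (auto simp: inner_Basis)
    also have "\<dots> = e a" using a A by (auto simp: E_def)
    finally have Ga: "G a = e a" .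
    have "inv G x \<bullet> a = G (inv G x) \<bullet> G a" by (simp only: Gin)
    also have "\<dots> = x \<bullet> e a"
      using orthogonal_transformation_surj[OF Gorth] by (simp add: surj_f_inv_f Ga)
    finally show "inv G x \<bullet> a = x \<bullet> e a" .
  qed
qed

section \<open>Densities on product measures, and vectors as points of a product space\<close>

lemma (in product_sigma_finite) PiM_density:
  assumes I[simp]: "finite I" and f[measurable]: "\<And>i. i \<in> I \<Longrightarrow> f i \<in> borel_measurable (M i)"
    and D: "product_sigma_finite (\<lambda>i. density (M i) (f i))"
  shows "PiM I (\<lambda>i. density (M i) (f i)) = density (PiM I M) (\<lambda>x. \<Prod>i\<in>I. f i (x i))"
proof -
  interpret D: product_sigma_finite "\<lambda>i. density (M i) (f i)" by fact
  have "density (PiM I M) (\<lambda>x. \<Prod>i\<in>I. f i (x i)) = PiM I (\<lambda>i. density (M i) (f i))"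
  proof (rule D.PiM_eqI)
    show "sets (density (PiM I M) (\<lambda>x. \<Prod>i\<in>I. f i (x i))) = sets (PiM I (\<lambda>i. density (M i) (f i)))"
      by (simp cong: sets_PiM_cong)
    fix A assume "\<And>i. i \<in> I \<Longrightarrow> A i \<in> sets (density (M i) (f i))"
    then have A[measurable]: "\<And>i. i \<in> I \<Longrightarrow> A i \<in> sets (M i)" by simp
    have "emeasure (density (PiM I M) (\<lambda>x. \<Prod>i\<in>I. f i (x i))) (Pi\<^sub>E I A)
       = (\<integral>\<^sup>+x. (\<Prod>i\<in>I. f i (x i)) * indicator (Pi\<^sub>E I A) x \<partial>PiM I M)"
      by (rule emeasure_density) (auto intro!: sets_PiM_I_finite A)
    also have "\<dots> = (\<integral>\<^sup>+x. (\<Prod>i\<in>I. f i (x i) * indicator (A i) (x i)) \<partial>PiM I M)"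
    proof (rule nn_integral_cong)
      fix x assume "x \<in> space (PiM I M)"
      then have "x \<in> Pi\<^sub>E I A \<longleftrightarrow> (\<forall>i\<in>I. x i \<in> A i)"
        by (auto simp: space_PiM PiE_def)
      moreover have "(\<Prod>i\<in>I. indicator (A i) (x i)) = (if \<forall>i\<in>I. x i \<in> A i then 1 else 0 :: ennreal)"
        by (auto simp: indicator_def prod_zero_iff)
      ultimately show "(\<Prod>i\<in>I. f i (x i)) * indicator (Pi\<^sub>E I A) x = (\<Prod>i\<in>I. f i (x i) * indicator (A i) (x i))"
        by (simp add: prod.distrib indicator_def)
    qed
    also have "\<dots> = (\<Prod>i\<in>I. \<integral>\<^sup>+x. f i x * indicator (A i) x \<partial>M i)"
      by (rule product_nn_integral_prod) auto
    also have "\<dots> = (\<Prod>i\<in>I. emeasure (density (M i) (f i)) (A i))"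
      by (intro prod.cong refl) (simp add: emeasure_density)
    finally show "emeasure (density (PiM I M) (\<lambda>x. \<Prod>i\<in>I. f i (x i))) (Pi\<^sub>E I A)
       = (\<Prod>i\<in>I. emeasure (density (M i) (f i)) (A i))" .
  qed simp
  then show ?thesis ..
qed

lemma borel_measurable_vec_nth[measurable]:
  "(\<lambda>x::'a::euclidean_space ^ 'n. x $ i) \<in> borel_measurable borel"
  by (intro borel_measurable_continuous_onI continuous_intros)

lemma measurable_vec_lambda:
  "vec_lambda \<in> measurable (PiM UNIV (\<lambda>_. borel)) (borel :: ('a::euclidean_space ^ 'n) measure)"
proof (subst borel_measurable_euclidean_space, rule ballI)
  fix i :: "'a ^ 'n" assume "i \<in> Basis"
  then obtain j b where i: "i = axis j b" by (auto simp: Basis_vec_def)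
  show "(\<lambda>x. vec_lambda x \<bullet> i) \<in> borel_measurable (PiM UNIV (\<lambda>_. borel))"
    unfolding i inner_axis by (simp) measurable
qed

lemma box_vec: "box l u = {x :: 'a::euclidean_space ^ 'n. \<forall>i. x $ i \<in> box (l $ i) (u $ i)}"
  by (auto simp: box_def Basis_vec_def inner_axis)

text \<open>Lebesgue measure is determined by boxes, and a box of vectors is a product of boxes, one
  for each entry. This turns independent entries into a density on one Euclidean space, where
  isometries can act.\<close>

lemma distr_PiM_lborel_vec_lambda:
  "distr (PiM UNIV (\<lambda>_. lborel)) borel vec_lambda = (lborel :: ('a::euclidean_space ^ 'n) measure)"
proof (rule lborel_eqI[symmetric])
  interpret product_sigma_finite "\<lambda>_::'n. lborel :: 'a measure" ..
  have m[measurable]: "vec_lambda \<in> measurable (PiM UNIV (\<lambda>_. lborel)) (borel :: ('a ^ 'n) measure)"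
    using measurable_vec_lambda by (simp cong: measurable_cong_sets sets_PiM_cong)
  fix l u :: "'a ^ 'n" assume lu: "\<And>b. b \<in> Basis \<Longrightarrow> l \<bullet> b \<le> u \<bullet> b"
  have le: "l $ i \<bullet> b \<le> u $ i \<bullet> b" if "b \<in> Basis" for i b
    using lu[of "axis i b"] that by (simp add: inner_axis)
  have "vec_lambda -` box l u \<inter> space (PiM UNIV (\<lambda>_. lborel)) = (\<Pi>\<^sub>E i\<in>UNIV. box (l $ i) (u $ i))"
    by (auto simp: box_vec space_PiM PiE_def)
  then have "emeasure (distr (PiM UNIV (\<lambda>_. lborel)) borel vec_lambda) (box l u)
     = (\<Prod>i\<in>UNIV. emeasure lborel (box (l $ i) (u $ i)))"
    by (simp add: emeasure_distr emeasure_PiM)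
  also have "\<dots> = ennreal (\<Prod>i\<in>UNIV. \<Prod>b\<in>Basis. (u - l) $ i \<bullet> b)"
    using le by (subst prod_ennreal[symmetric]) (auto intro!: prod_nonneg prod.cong simp: emeasure_lborel_box inner_diff_left)
  also have "(\<Prod>i\<in>UNIV. \<Prod>b\<in>Basis. (u - l) $ i \<bullet> b) = (\<Prod>b\<in>Basis. (u - l) \<bullet> b)"
  proof -
    have B: "Basis = (\<lambda>(i, b). axis i b :: 'a ^ 'n) ` (UNIV \<times> Basis)"
      by (auto simp: Basis_vec_def)
    have "inj_on (\<lambda>(i, b). axis i b :: 'a ^ 'n) (UNIV \<times> Basis)"
      by (auto simp: inj_on_def axis_eq_axis dest: nonzero_Basis)
    then show ?thesis
      unfolding B
      by (subst prod.reindex) (simp_all add: prod.cartesian_product inner_axis case_prod_beta comp_def)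
  qed
  finally show "emeasure (distr (PiM UNIV (\<lambda>_. lborel)) borel vec_lambda) (box l u)
      = ennreal (\<Prod>b\<in>Basis. (u - l) \<bullet> b)" .
qed simp

section \<open>The complex Gaussian law\<close>

definition complex_gaussian :: "complex measure" where
  "complex_gaussian = density lborel (\<lambda>z. ennreal (complex_normal_density z))"

lemma borel_measurable_complex_normal_density[measurable]:
  "complex_normal_density \<in> borel_measurable borel"
  unfolding complex_normal_density_def[abs_def] by measurable

lemma sets_complex_gaussian[simp, measurable_cong]: "sets complex_gaussian = sets borel"
  by (simp add: complex_gaussian_def)

lemma space_complex_gaussian[simp]: "space complex_gaussian = UNIV"
  by (simp add: complex_gaussian_def)

lemma nn_integral_exp_minus_Ici:
  "(\<integral>\<^sup>+s. ennreal (exp (- s)) * indicator {a..} s \<partial>lborel) = ennreal (exp (- a))"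
proof -
  have "((\<lambda>s::real. - exp (- s)) \<longlongrightarrow> - 0) at_top"
    by (intro tendsto_minus filterlim_compose[OF exp_at_bot] filterlim_uminus_at_bot_at_top)
  then have "(\<integral>\<^sup>+s. ennreal (exp (- s)) * indicator {a..} s \<partial>lborel) = 0 - (- exp (- a))"
    by (intro nn_integral_FTC_atLeast) (auto intro!: derivative_eq_intros)
  then show ?thesis by simp
qed

lemma emeasure_complex_gaussian_norm_gt:
  assumes "0 \<le> a"
  shows "emeasure complex_gaussian {z. a < (cmod z)\<^sup>2} = ennreal (exp (- a))"
proof -
  have sq: "(cmod z)\<^sup>2 \<le> t \<longleftrightarrow> cmod z \<le> sqrt t" for z t
    by (metis abs_norm_cancel real_sqrt_abs real_sqrt_le_iff)
  \<comment> \<open>Layer-cake: \<open>exp (- |z|\<^sup>2)\<close> is the integral of \<open>exp (- s)\<close> over \<open>s \<ge> |z|\<^sup>2\<close>, which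
    reduces the computation to the area of an annulus.\<close>
  have "emeasure complex_gaussian {z. a < (cmod z)\<^sup>2}
      = (\<integral>\<^sup>+z. ennreal (exp (- (cmod z)\<^sup>2) / pi) * indicator {z. a < (cmod z)\<^sup>2} z \<partial>lborel)"
    unfolding complex_gaussian_def complex_normal_density_def
    by (subst emeasure_density) auto
  also have "\<dots> = (\<integral>\<^sup>+z. (\<integral>\<^sup>+s. ennreal (exp (- s) / pi) * indicator {z. a < (cmod z)\<^sup>2 \<and> (cmod z)\<^sup>2 \<le> s} z \<partial>lborel) \<partial>lborel)"
  proof (rule nn_integral_cong)
    fix z :: complex
    have "ennreal (exp (- (cmod z)\<^sup>2) / pi) * indicator {z. a < (cmod z)\<^sup>2} z =
      ennreal (1 / pi) * indicator {z. a < (cmod z)\<^sup>2} z * (\<integral>\<^sup>+s. ennreal (exp (- s)) * indicator {(cmod z)\<^sup>2..} s \<partial>lborel)"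
      unfolding nn_integral_exp_minus_Ici by (auto simp: indicator_def simp flip: ennreal_mult)
    also have "\<dots> = (\<integral>\<^sup>+s. ennreal (1 / pi) * indicator {z. a < (cmod z)\<^sup>2} z * (ennreal (exp (- s)) * indicator {(cmod z)\<^sup>2..} s) \<partial>lborel)"
      by (subst nn_integral_cmult) auto
    also have "\<dots> = (\<integral>\<^sup>+s. ennreal (exp (- s) / pi) * indicator {z. a < (cmod z)\<^sup>2 \<and> (cmod z)\<^sup>2 \<le> s} z \<partial>lborel)"
      by (intro nn_integral_cong) (auto simp: indicator_def simp flip: ennreal_mult)
    finally show "ennreal (exp (- (cmod z)\<^sup>2) / pi) * indicator {z. a < (cmod z)\<^sup>2} z = \<dots>" .
  qed
  also have "\<dots> = (\<integral>\<^sup>+s. (\<integral>\<^sup>+z. ennreal (exp (- s) / pi) * indicator {z. a < (cmod z)\<^sup>2 \<and> (cmod z)\<^sup>2 \<le> s} z \<partial>lborel) \<partial>lborel)"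
  proof (rule lborel_pair.Fubini')
    have "(\<lambda>(s, z). ennreal (exp (- s) / pi) * indicator {p. a < (cmod (fst p))\<^sup>2 \<and> (cmod (fst p))\<^sup>2 \<le> snd p} (z, s))
      \<in> borel_measurable (lborel \<Otimes>\<^sub>M lborel)"
      by measurable
    then show "(\<lambda>(s, z). ennreal (exp (- s) / pi) * indicator {z. a < (cmod z)\<^sup>2 \<and> (cmod z)\<^sup>2 \<le> s} z)
      \<in> borel_measurable (lborel \<Otimes>\<^sub>M lborel)"
      by (simp add: indicator_def)
  qed
  also have "\<dots> = (\<integral>\<^sup>+s. ennreal ((s - a) * exp (- s)) * indicator {a..} s \<partial>lborel)"
  proof (rule nn_integral_cong)
    fix s :: real
    have "emeasure lborel {z. a < (cmod z)\<^sup>2 \<and> (cmod z)\<^sup>2 \<le> s} = ennreal (pi * (s - a)) * indicator {a..} s"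
    proof (cases "a \<le> s")
      case True
      have "{z. a < (cmod z)\<^sup>2 \<and> (cmod z)\<^sup>2 \<le> s} = cball 0 (sqrt s) - cball 0 (sqrt a)"
        using assms True by (auto simp: sq not_le[symmetric])
      then have "emeasure lborel {z. a < (cmod z)\<^sup>2 \<and> (cmod z)\<^sup>2 \<le> s} = ennreal (pi * s) - ennreal (pi * a)"
        using assms True
        by (simp add: emeasure_Diff emeasure_cball unit_ball_vol_2 cball_subset_cball_iff)
      also have "\<dots> = ennreal (pi * (s - a))"
        using assms by (simp add: ennreal_minus right_diff_distrib)
      finally show ?thesis using True by simp
    next
      case False
      then have "{z. a < (cmod z)\<^sup>2 \<and> (cmod z)\<^sup>2 \<le> s} = {}" by auto
      with False show ?thesis by (simp del: Collect_empty_eq)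
    qed
    then have "(\<integral>\<^sup>+z. ennreal (exp (- s) / pi) * indicator {z. a < (cmod z)\<^sup>2 \<and> (cmod z)\<^sup>2 \<le> s} z \<partial>lborel)
      = ennreal (exp (- s) / pi) * (ennreal (pi * (s - a)) * indicator {a..} s)"
      by (subst nn_integral_cmult_indicator) auto
    also have "\<dots> = ennreal ((s - a) * exp (- s)) * indicator {a..} s"
      by (auto simp: indicator_def mult_ac simp flip: ennreal_mult)
    finally show "(\<integral>\<^sup>+z. ennreal (exp (- s) / pi) * indicator {z. a < (cmod z)\<^sup>2 \<and> (cmod z)\<^sup>2 \<le> s} z \<partial>lborel)
      = ennreal ((s - a) * exp (- s)) * indicator {a..} s" .
  qed
  also have "\<dots> = 0 - (- (a - a + 1) * exp (- a))"
  proof (rule nn_integral_FTC_atLeast[where F = "\<lambda>s. - (s - a + 1) * exp (- s)" and T = 0])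
    show "DERIV (\<lambda>s. - (s - a + 1) * exp (- s)) s :> (s - a) * exp (- s)" for s
      by (auto intro!: derivative_eq_intros simp: algebra_simps)
    show "((\<lambda>s::real. - (s - a + 1) * exp (- s)) \<longlongrightarrow> 0) at_top"
      by real_asymp
  qed auto
  finally show ?thesis by simp
qed

text \<open>The total mass is the tail formula at \<open>a = 0\<close>; the point that it leaves
  out, the origin, is null.\<close>

lemma prob_space_complex_gaussian: "prob_space complex_gaussian"
proof (rule prob_spaceI)
  have "emeasure complex_gaussian UNIV = emeasure complex_gaussian {z. 0 < (cmod z)\<^sup>2}"
  proof (rule emeasure_eq_AE)
    have "AE z in lborel. z \<noteq> (0::complex)" by (rule AE_lborel_singleton)
    then show "AE z in complex_gaussian. (z \<in> UNIV) = (z \<in> {z. 0 < (cmod z)\<^sup>2})"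
      unfolding complex_gaussian_def by (subst AE_density) (auto elim!: eventually_mono)
  qed simp_all
  then show "emeasure complex_gaussian (space complex_gaussian) = 1"
    using emeasure_complex_gaussian_norm_gt[of 0] by simp
qed

interpretation complex_gaussian: prob_space complex_gaussian
  by (rule prob_space_complex_gaussian)

abbreviation std_exponential :: "real measure" where
  "std_exponential \<equiv> density lborel (\<lambda>x. ennreal (exponential_density 1 x))"

lemma distr_complex_gaussian_norm_sq:
  "distr complex_gaussian borel (\<lambda>z. (cmod z)\<^sup>2) = std_exponential"
proof -
  have "emeasure complex_gaussian {z. (cmod z)\<^sup>2 \<le> a} = 1 - ennreal (exp (- a))" if a: "0 \<le> a" for a
  proof -
    have "{z. (cmod z)\<^sup>2 \<le> a} = space complex_gaussian - {z. a < (cmod z)\<^sup>2}"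
      by auto
    then show ?thesis
      using a by (simp only:, subst emeasure_compl)
        (simp_all add: emeasure_complex_gaussian_norm_gt complex_gaussian.emeasure_space_1[simplified])
  qed
  then have "distributed complex_gaussian lborel (\<lambda>z. (cmod z)\<^sup>2) (exponential_density 1)"
    by (intro exponential_distributedI) simp_all
  then show ?thesis
    by (simp add: distributed_def cong: distr_cong)
qed

text \<open>The joint density depends on \<open>h\<close> only through its norm.\<close>

lemma distr_complex_gaussian_vec:
  "distr (PiM UNIV (\<lambda>_. complex_gaussian)) borel vec_lambda =
     density lborel (\<lambda>h :: complex ^ 'n. ennreal (exp (- (norm h)\<^sup>2) / pi ^ CARD('n)))"
proof -
  interpret L: product_sigma_finite "\<lambda>_::'n. lborel :: complex measure" ..
  interpret G: product_prob_space "\<lambda>_::'n. complex_gaussian" ..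
  have [measurable]: "vec_lambda \<in> measurable (PiM UNIV (\<lambda>_. lborel)) (borel :: (complex ^ 'n) measure)"
    using measurable_vec_lambda by (simp cong: measurable_cong_sets sets_PiM_cong)
  have prod: "(\<Prod>i\<in>UNIV. ennreal (complex_normal_density (x $ i))) = ennreal (exp (- (norm x)\<^sup>2) / pi ^ CARD('n))"
    for x :: "complex ^ 'n"
  proof -
    have "(norm x)\<^sup>2 = (\<Sum>i\<in>UNIV. (cmod (x $ i))\<^sup>2)"
      by (simp add: norm_vec_def L2_set_def sum_nonneg)
    then show ?thesis
      by (subst prod_ennreal) (auto simp: complex_normal_density_def prod_dividef simp flip: exp_sum sum_negf)
  qed
  have "PiM UNIV (\<lambda>_. complex_gaussian) = density (PiM UNIV (\<lambda>_::'n. lborel)) (\<lambda>x. \<Prod>i\<in>UNIV. ennreal (complex_normal_density (x i)))"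
    unfolding complex_gaussian_def
    by (rule L.PiM_density) (auto intro: G.product_sigma_finite_axioms[unfolded complex_gaussian_def])
  also have "\<dots> = density (PiM UNIV (\<lambda>_::'n. lborel))
      ((\<lambda>h. ennreal (exp (- (norm h)\<^sup>2) / pi ^ CARD('n))) \<circ> vec_lambda)"
    by (simp add: prod[symmetric] comp_def)
  finally have "distr (PiM UNIV (\<lambda>_::'n. complex_gaussian)) borel vec_lambda =
     density (distr (PiM UNIV (\<lambda>_::'n. lborel)) borel vec_lambda) (\<lambda>h. ennreal (exp (- (norm h)\<^sup>2) / pi ^ CARD('n)))"
    by (simp only: comp_def, subst density_distr) simp_all
  then show ?thesis by (simp add: distr_PiM_lborel_vec_lambda)
qed

lemma tprod_as_inner:
  "tprod h v = Complex (h \<bullet> (\<chi> j. cnj (v $ j))) (h \<bullet> (\<chi> j. \<i> * cnj (v $ j)))"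
  by (simp add: complex_eq_iff tprod_def inner_vec_def inner_complex_def)

text \<open>Unitary invariance of the Gaussian law: extend the orthonormal family to an orthogonal
  transformation of the underlying real space.\<close>

lemma distr_tprod_orthonormal:
  fixes v :: "'i \<Rightarrow> complex ^ 'n"
  assumes J: "finite J" "card J \<le> CARD('n)" and v: "corthonormal_family J v"
  shows "distr (PiM UNIV (\<lambda>_. complex_gaussian)) (PiM J (\<lambda>_. borel))
      (\<lambda>h. \<lambda>k\<in>J. tprod (vec_lambda h) (v k)) = PiM J (\<lambda>_. complex_gaussian)"
proof -
  obtain \<sigma> :: "'i \<Rightarrow> 'n" where \<sigma>: "inj_on \<sigma> J"
    using J inj_on_iff_card_le[of J "UNIV :: 'n set"] by auto
  \<comment> \<open>\<open>\<sigma>\<close> reserves one coordinate for each vector of the family,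
    and \<open>A\<close> collects the two real basis vectors of each reserved coordinate.
    \<open>w (k, b)\<close> is chosen so that its real inner product with \<open>h\<close> is the
    \<open>b\<close>-component of \<open>tprod h (v k)\<close>; the conjugation compensates for
    \<open>tprod\<close> being bilinear.\<close>
  define A where "A = (\<lambda>(k, b). axis (\<sigma> k) b) ` (J \<times> (Basis :: complex set))"
  define w where "w = (\<lambda>(k, b). (\<chi> j. b * cnj (v k $ j)) :: complex ^ 'n)"
  have injA: "inj_on (\<lambda>(k, b). axis (\<sigma> k) b :: complex ^ 'n) (J \<times> Basis)"
    using \<sigma> by (auto simp: inj_on_def axis_eq_axis)
  define e where "e = w \<circ> inv_into (J \<times> Basis) (\<lambda>(k, b). axis (\<sigma> k) b)"
  have e: "e (axis (\<sigma> k) b) = w (k, b)" if "k \<in> J" "b \<in> Basis" for k b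
    using inv_into_f_f[OF injA, of "(k, b)"] that by (simp add: e_def)
  \<comment> \<open>Complex orthonormality yields real orthonormality of twice as many vectors,
    because \<open>Re (cnj c * b)\<close> is 1 for equal and 0 for distinct elements of
    \<open>{1, \<i>}\<close>.\<close>
  have w: "w (k, b) \<bullet> w (l, c) = (if k = l \<and> b = c then 1 else 0)"
    if "k \<in> J" "l \<in> J" "b \<in> Basis" "c \<in> Basis" for k l b c
  proof -
    have "(b * cnj x) \<bullet> (c * cnj y) = Re (cnj c * b * (cnj x * y))" for x y
      by (simp add: inner_complex_def algebra_simps)
    then have "w (k, b) \<bullet> w (l, c) = Re (cnj c * b * cinner_vec (v k) (v l))"
      by (simp add: w_def inner_vec_def cinner_vec_def sum_distrib_left)
    also have "\<dots> = (if k = l \<and> b = c then 1 else 0)"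
      using v that by (auto simp: corthonormal_family_def Basis_complex_def)
    finally show ?thesis .
  qed
  have "A \<subseteq> Basis" by (auto simp: A_def)
  moreover have "e a \<bullet> e b = (if a = b then 1 else 0)" if "a \<in> A" "b \<in> A" for a b
    using that \<sigma> by (auto simp: A_def e w axis_eq_axis inj_on_eq_iff)
  ultimately obtain F where F: "orthogonal_transformation F" "\<And>a x. a \<in> A \<Longrightarrow> F x \<bullet> a = x \<bullet> e a"
    using orthonormal_extend[of A e] by blast
  have Fk: "F h $ \<sigma> k = tprod h (v k)" if k: "k \<in> J" for h k
  proof -
    have "F h $ \<sigma> k \<bullet> b = h \<bullet> w (k, b)" if b: "b \<in> Basis" for b
    proof -
      have "axis (\<sigma> k) b \<in> A"
        unfolding A_def using k b by (intro image_eqI[of _ _ "(k, b)"]) auto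
      from F(2)[OF this, of h] show ?thesis using k b by (simp add: e inner_axis)
    qed
    from this[of 1] this[of \<i>] show ?thesis
      by (simp add: tprod_as_inner w_def Basis_complex_def complex_eq_iff)
  qed
  define \<Gamma> where "\<Gamma> = distr (PiM UNIV (\<lambda>_. complex_gaussian)) borel (vec_lambda :: _ \<Rightarrow> complex ^ 'n)"
  have m[measurable]: "vec_lambda \<in> measurable (PiM UNIV (\<lambda>_. complex_gaussian)) (borel :: (complex ^ 'n) measure)"
    using measurable_vec_lambda by (simp cong: measurable_cong_sets sets_PiM_cong)
  have [measurable]: "F \<in> borel_measurable borel"
    using F(1) by (intro borel_measurable_continuous_onI linear_continuous_on)
      (simp add: orthogonal_transformation_linear flip: linear_conv_bounded_linear)
  have inv: "distr \<Gamma> borel F = \<Gamma>"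
  proof -
    let ?g = "\<lambda>h :: complex ^ 'n. ennreal (exp (- (norm h)\<^sup>2) / pi ^ CARD('n))"
    have "distr \<Gamma> borel F = distr (density lborel (\<lambda>h. ?g (F h))) borel F"
      unfolding \<Gamma>_def distr_complex_gaussian_vec by (simp add: orthogonal_transformation_norm[OF F(1)])
    also have "\<dots> = density (distr lborel borel F) ?g"
      by (subst density_distr) simp_all
    also have "\<dots> = \<Gamma>"
      by (simp add: distr_lborel_orthogonal_transformation[OF F(1)] \<Gamma>_def distr_complex_gaussian_vec)
    finally show ?thesis .
  qed
  have [measurable_cong]: "sets \<Gamma> = sets borel" by (simp add: \<Gamma>_def)
  have "(\<lambda>h. tprod h (v k)) \<in> borel_measurable borel" for k
    unfolding tprod_def by measurable
  then have [measurable]: "(\<lambda>h. \<lambda>k\<in>J. tprod h (v k)) \<in> measurable borel (PiM J (\<lambda>_. borel))"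
    by (intro measurable_restrict) auto
  have [measurable]: "(\<lambda>h. \<lambda>k\<in>J. h $ \<sigma> k) \<in> measurable borel (PiM J (\<lambda>_. borel :: complex measure))"
    by (intro measurable_restrict borel_measurable_vec_nth)
  have "distr (PiM UNIV (\<lambda>_. complex_gaussian)) (PiM J (\<lambda>_. borel)) (\<lambda>h. \<lambda>k\<in>J. tprod (vec_lambda h) (v k))
    = distr \<Gamma> (PiM J (\<lambda>_. borel)) (\<lambda>h. \<lambda>k\<in>J. tprod h (v k))"
    unfolding \<Gamma>_def by (subst distr_distr) (simp_all add: comp_def)
  also have "\<dots> = distr \<Gamma> (PiM J (\<lambda>_. borel)) (\<lambda>h. \<lambda>k\<in>J. F h $ \<sigma> k)"
    by (intro distr_cong refl) (auto simp: Fk)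
  also have "\<dots> = distr (distr \<Gamma> borel F) (PiM J (\<lambda>_. borel)) (\<lambda>h. \<lambda>k\<in>J. h $ \<sigma> k)"
    by (subst distr_distr) (simp_all add: comp_def)
  also have "\<dots> = distr \<Gamma> (PiM J (\<lambda>_. borel)) (\<lambda>h. \<lambda>k\<in>J. h $ \<sigma> k)"
    by (simp only: inv)
  also have "\<dots> = distr (PiM UNIV (\<lambda>_. complex_gaussian)) (PiM J (\<lambda>_. borel)) (\<lambda>h. \<lambda>k\<in>J. h (\<sigma> k))"
    unfolding \<Gamma>_def by (subst distr_distr) (simp_all add: comp_def)
  also have "\<dots> = distr (PiM UNIV (\<lambda>_. complex_gaussian)) (PiM J (\<lambda>_. complex_gaussian)) (\<lambda>h. \<lambda>k\<in>J. h (\<sigma> k))"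
    by (intro distr_cong refl) (simp cong: sets_PiM_cong)
  also have "\<dots> = PiM J (\<lambda>_. complex_gaussian)"
    by (rule distr_PiM_reindex) (auto simp: \<sigma> prob_space_complex_gaussian)
  finally show ?thesis .
qed

section \<open>Reduction to one antenna and one slot\<close>

text \<open>The SINR condition with its positive denominator multiplied out, \<open>c\<close>
  standing for \<open>N / \<rho>\<close> and \<open>x i\<close> for the received power of beam
  \<open>i\<close>. In this form it can be evaluated under a product of exponential laws.\<close>

definition covered :: "nat \<Rightarrow> real \<Rightarrow> real \<Rightarrow> (nat \<Rightarrow> real) \<Rightarrow> bool" where
  "covered N c T x \<longleftrightarrow> (\<exists>n\<in>{1..N}. T * (c + (\<Sum>i\<in>{1..N} - {n}. x i)) < x n)"

definition outage :: "nat \<Rightarrow> real \<Rightarrow> real \<Rightarrow> real" where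
  "outage N c T = measure (PiM {1..N} (\<lambda>_. std_exponential))
     {x \<in> space (PiM {1..N} (\<lambda>_. borel)). \<not> covered N c T x}"

lemma prob_space_std_exponential: "prob_space std_exponential"
  by (rule prob_space_exponential_density) simp

lemma sets_covered[measurable]:
  "Measurable.pred (PiM {1..N} (\<lambda>_. borel)) (covered N c T)"
  unfolding covered_def by measurable

lemma covered_cong:
  "(\<And>i. i \<in> {1..N} \<Longrightarrow> x i = y i) \<Longrightarrow> covered N c T x \<longleftrightarrow> covered N c T y"
  unfolding covered_def by (intro bex_cong arg_cong2[where f="(<)"] arg_cong2[where f="(*)"] arg_cong2[where f="(+)"] sum.cong) auto

text \<open>Selecting the coordinates of slot \<open>d\<close> is a reindexing of the product along
  the injection sending \<open>i\<close> to \<open>(i, d)\<close>, and squared moduli are then taken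
  coordinatewise.\<close>

lemma distr_gaussian_group:
  fixes J :: "(nat \<times> nat) set"
  assumes "finite J" "{1..N} \<times> {d} \<subseteq> J"
  shows "distr (PiM J (\<lambda>_. complex_gaussian)) (PiM {1..N} (\<lambda>_. borel)) (\<lambda>z. \<lambda>i\<in>{1..N}. (cmod (z (i, d)))\<^sup>2)
     = PiM {1..N} (\<lambda>_. std_exponential)"
proof -
  have m[measurable]: "(\<lambda>z. \<lambda>i\<in>{1..N}. z (i, d)) \<in> measurable (PiM J (\<lambda>_. complex_gaussian)) (PiM {1..N} (\<lambda>_. complex_gaussian))"
    using assms by (intro measurable_restrict measurable_component_singleton) auto
  have m'[measurable]: "compose {1..N} (\<lambda>z. (cmod z)\<^sup>2) \<in> measurable (PiM {1..N} (\<lambda>_. complex_gaussian)) (PiM {1..N} (\<lambda>_. borel))"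
    unfolding compose_def by (intro measurable_restrict) measurable
  have "distr (PiM J (\<lambda>_. complex_gaussian)) (PiM {1..N} (\<lambda>_. borel)) (\<lambda>z. \<lambda>i\<in>{1..N}. (cmod (z (i, d)))\<^sup>2)
    = distr (distr (PiM J (\<lambda>_. complex_gaussian)) (PiM {1..N} (\<lambda>_. complex_gaussian)) (\<lambda>z. \<lambda>i\<in>{1..N}. z (i, d)))
        (PiM {1..N} (\<lambda>_. borel)) (compose {1..N} (\<lambda>z. (cmod z)\<^sup>2))"
    by (subst distr_distr[OF m' m]) (auto simp: compose_def comp_def intro!: distr_cong)
  also have "\<dots> = distr (PiM {1..N} (\<lambda>_. complex_gaussian)) (PiM {1..N} (\<lambda>_. borel)) (compose {1..N} (\<lambda>z. (cmod z)\<^sup>2))"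
    using assms by (subst distr_PiM_reindex[where f = "\<lambda>i. (i, d)"]) (auto simp: prob_space_complex_gaussian inj_on_def)
  also have "\<dots> = distr (PiM {1..N} (\<lambda>_. complex_gaussian)) (PiM {1..N} (\<lambda>_. std_exponential)) (compose {1..N} (\<lambda>z. (cmod z)\<^sup>2))"
    by (intro distr_cong refl) (simp cong: sets_PiM_cong)
  also have "\<dots> = PiM {1..N} (\<lambda>_. distr complex_gaussian std_exponential (\<lambda>z. (cmod z)\<^sup>2))"
    by (rule distr_PiM_finite_prob_space') (auto simp: prob_space_complex_gaussian prob_space_std_exponential)
  also have "distr complex_gaussian std_exponential (\<lambda>z. (cmod z)\<^sup>2) = std_exponential"
    unfolding distr_complex_gaussian_norm_sq[symmetric] by (intro distr_cong refl) simp
  finally show ?thesis .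
qed

text \<open>The slots read disjoint sets of coordinates of one Gaussian product, so their outage
  events are independent, and each has the same probability.\<close>

lemma measure_outage_all_slots:
  assumes N: "N \<ge> 1" and D: "D \<ge> 1" and J: "J = {1..N} \<times> {1..D}"
  shows "measure (PiM J (\<lambda>_. complex_gaussian))
     {z \<in> space (PiM J (\<lambda>_. borel)). \<forall>d\<in>{1..D}. \<not> covered N c T (\<lambda>i. (cmod (z (i, d)))\<^sup>2)} = outage N c T ^ D"
proof -
  let ?P = "PiM J (\<lambda>_. complex_gaussian)"
  interpret P: prob_space ?P
    by (intro prob_space_PiM prob_space_complex_gaussian)
  define K where "K = (\<lambda>d. {1..N} \<times> {d :: nat})"
  define Y where "Y = (\<lambda>d (z :: nat \<times> nat \<Rightarrow> complex). \<lambda>i\<in>{1..N}. (cmod (z (i, d)))\<^sup>2)"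
  define A where "A = {x \<in> space (PiM {1..N} (\<lambda>_. borel)). \<not> covered N c T x}"
  have A: "A \<in> sets (PiM {1..N} (\<lambda>_. borel))"
    unfolding A_def by measurable
  have Ym[measurable]: "Y d \<in> measurable ?P (PiM {1..N} (\<lambda>_. borel))" if "d \<in> {1..D}" for d
    unfolding Y_def using that by (intro measurable_restrict) (auto simp: J intro!: measurable_component_singleton measurable_compose[OF measurable_component_singleton])
  have "P.indep_vars (\<lambda>_. PiM {1..N} (\<lambda>_. borel)) Y {1..D}"
  proof -
    have Jne: "J \<noteq> {}" using N D by (auto simp: J)
    have "P.indep_vars (\<lambda>_. borel) (\<lambda>k z. z k) J"
    proof (subst P.indep_vars_iff_distr_eq_PiM'[OF Jne])
      show "(\<lambda>z. z k) \<in> measurable ?P borel" if "k \<in> J" for k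
        using measurable_component_singleton[OF that, of "\<lambda>_. complex_gaussian"]
        by (simp only: measurable_cong_sets[OF refl sets_complex_gaussian])
      have "distr ?P (PiM J (\<lambda>_. borel)) (\<lambda>x. \<lambda>i\<in>J. x i) = distr ?P ?P (\<lambda>x. x)"
        by (intro distr_cong) (auto simp: space_PiM cong: sets_PiM_cong)
      also have "\<dots> = PiM J (\<lambda>i. distr ?P borel (\<lambda>z. z i))"
        unfolding distr_id2[OF refl]
      proof (intro PiM_cong refl)
        fix i assume "i \<in> J"
        then have "distr ?P complex_gaussian (\<lambda>z. z i) = complex_gaussian"
          by (intro distr_PiM_component prob_space_complex_gaussian)
        then show "complex_gaussian = distr ?P borel (\<lambda>z. z i)"
          by (simp cong: distr_cong)
      qed
      finally show "distr ?P (PiM J (\<lambda>_. borel)) (\<lambda>x. \<lambda>i\<in>J. x i) = PiM J (\<lambda>i. distr ?P borel (\<lambda>z. z i))" .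
    qed
    then have "P.indep_vars (\<lambda>d. PiM (K d) (\<lambda>_. borel)) (\<lambda>d z. restrict (\<lambda>k. z k) (K d)) {1..D}"
      by (rule P.indep_vars_restrict) (auto simp: K_def J disjoint_family_on_def)
    then have "P.indep_vars (\<lambda>_. PiM {1..N} (\<lambda>_. borel)) (\<lambda>d z. Y d (restrict (\<lambda>k. z k) (K d))) {1..D}"
    proof (rule P.indep_vars_compose2)
      fix d
      show "Y d \<in> measurable (PiM (K d) (\<lambda>_. borel)) (PiM {1..N} (\<lambda>_. borel))"
        unfolding Y_def K_def
        by (intro measurable_restrict borel_measurable_power
            measurable_compose[OF _ borel_measurable_norm] measurable_component_singleton) auto
    qed
    moreover have "Y d (restrict (\<lambda>k. z k) (K d)) = Y d z" for d z
      by (auto simp: Y_def K_def)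
    ultimately show ?thesis by simp
  qed
  then have "P.prob (\<Inter>d\<in>{1..D}. Y d -` A \<inter> space ?P) = (\<Prod>d\<in>{1..D}. P.prob (Y d -` A \<inter> space ?P))"
    using D A by (intro P.indep_varsD) auto
  also have "(\<Inter>d\<in>{1..D}. Y d -` A \<inter> space ?P) =
      {z \<in> space (PiM J (\<lambda>_. borel)). \<forall>d\<in>{1..D}. \<not> covered N c T (\<lambda>i. (cmod (z (i, d)))\<^sup>2)}"
  proof -
    have "Y d z \<in> A \<longleftrightarrow> \<not> covered N c T (\<lambda>i. (cmod (z (i, d)))\<^sup>2)" for d z
      using covered_cong[of N "Y d z" "\<lambda>i. (cmod (z (i, d)))\<^sup>2" c T] by (auto simp: A_def Y_def space_PiM)
    then show ?thesis
      using D by (auto simp: space_PiM)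
  qed
  also have "(\<Prod>d\<in>{1..D}. P.prob (Y d -` A \<inter> space ?P)) = (\<Prod>d\<in>{1..D}. outage N c T)"
  proof (intro prod.cong refl)
    fix d assume d: "d \<in> {1..D}"
    have "P.prob (Y d -` A \<inter> space ?P) = measure (distr ?P (PiM {1..N} (\<lambda>_. borel)) (Y d)) A"
      by (subst measure_distr[OF Ym[OF d] A]) simp
    also have "distr ?P (PiM {1..N} (\<lambda>_. borel)) (Y d) = PiM {1..N} (\<lambda>_. std_exponential)"
      unfolding Y_def using d by (intro distr_gaussian_group) (auto simp: J)
    finally show "P.prob (Y d -` A \<inter> space ?P) = outage N c T"
      by (simp add: outage_def A_def)
  qed
  finally show ?thesis by simp
qed

lemma sinr_gt_iff:
  assumes "N \<ge> 1" "\<rho> > 0"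
  shows "T < sinr N \<rho> h v n \<longleftrightarrow>
    T * (real N / \<rho> + (\<Sum>i\<in>{1..N} - {n}. (cmod (tprod h (v i)))\<^sup>2)) < (cmod (tprod h (v n)))\<^sup>2"
proof -
  have "0 < real N / \<rho> + (\<Sum>i\<in>{1..N} - {n}. (cmod (tprod h (v i)))\<^sup>2)"
    using assms by (intro add_pos_nonneg sum_nonneg) auto
  then show ?thesis by (simp add: sinr_def pos_less_divide_eq)
qed

text \<open>Serves to freeze the precoders: once the joint law is a product, an event about channel
  and precoders can be integrated over its sections.\<close>

lemma pair_measure_distr_indep_rvs:
  assumes "prob_space M" and ind: "indep_rvs M S X S' Y"
  shows "distr M S X \<Otimes>\<^sub>M distr M S' Y = distr M (S \<Otimes>\<^sub>M S') (\<lambda>\<omega>. (X \<omega>, Y \<omega>))"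
proof -
  interpret prob_space M by fact
  have [measurable]: "X \<in> measurable M S" "Y \<in> measurable M S'"
    and iset: "indep_set (sigma_sets (space M) {X -` A \<inter> space M |A. A \<in> sets S})
       (sigma_sets (space M) {Y -` A \<inter> space M |A. A \<in> sets S'})"
    using ind by (auto simp: indep_rvs_def)
  interpret X: prob_space "distr M S X" by (rule prob_space_distr) measurable
  interpret Y: prob_space "distr M S' Y" by (rule prob_space_distr) measurable
  show ?thesis
  proof (rule pair_measure_eqI)
    show "sets (distr M S X \<Otimes>\<^sub>M distr M S' Y) = sets (distr M (S \<Otimes>\<^sub>M S') (\<lambda>\<omega>. (X \<omega>, Y \<omega>)))"
      by (simp cong: sets_pair_measure_cong)
    fix A B assume "A \<in> sets (distr M S X)" "B \<in> sets (distr M S' Y)"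
    then have A[measurable]: "A \<in> sets S" and B[measurable]: "B \<in> sets S'" by auto
    have "prob ((X -` A \<inter> space M) \<inter> (Y -` B \<inter> space M)) = prob (X -` A \<inter> space M) * prob (Y -` B \<inter> space M)"
      by (rule indep_setD[OF iset]) (use A B in \<open>auto intro!: sigma_sets.Basic\<close>)
    moreover have "(\<lambda>\<omega>. (X \<omega>, Y \<omega>)) -` (A \<times> B) \<inter> space M = (X -` A \<inter> space M) \<inter> (Y -` B \<inter> space M)"
      by auto
    ultimately show "emeasure (distr M S X) A * emeasure (distr M S' Y) B
        = emeasure (distr M (S \<Otimes>\<^sub>M S') (\<lambda>\<omega>. (X \<omega>, Y \<omega>))) (A \<times> B)"
      by (simp add: emeasure_distr emeasure_eq_measure ennreal_mult')
  qed unfold_locales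
qed

locale orthogonal_precoding = prob_space M
  for M :: "'w measure" +
  fixes N D Nr :: nat and H :: "nat \<Rightarrow> 'w \<Rightarrow> complex ^ 'nt" and \<phi> :: "nat \<Rightarrow> nat \<Rightarrow> 'w \<Rightarrow> complex ^ 'nt"
  assumes N: "N \<ge> 1" and D: "D \<ge> 1" and ND: "N * D \<le> CARD('nt)"
    and H_distributed: "\<And>r j. r \<in> {1..Nr} \<Longrightarrow>
      distributed M lborel (\<lambda>\<omega>. H r \<omega> $ j) (\<lambda>z. ennreal (complex_normal_density z))"
    and H_indep: "indep_vars (\<lambda>_. borel) (\<lambda>(r, j) \<omega>. H r \<omega> $ j) ({1..Nr} \<times> UNIV)"
    and \<phi>_orthonormal: "AE \<omega> in M. corthonormal_family ({1..N} \<times> {1..D}) (\<lambda>(n, d). \<phi> n d \<omega>)"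
    and H_\<phi>_indep:
      "indep_rvs M
         (PiM {1..Nr} (\<lambda>_. borel)) (\<lambda>\<omega>. \<lambda>r\<in>{1..Nr}. H r \<omega>)
         (PiM ({1..N} \<times> {1..D}) (\<lambda>_. borel)) (\<lambda>\<omega>. \<lambda>(n, d)\<in>{1..N} \<times> {1..D}. \<phi> n d \<omega>)"
begin

lemma measurable_H_component[measurable]:
  "r \<in> {1..Nr} \<Longrightarrow> (\<lambda>\<omega>. H r \<omega> $ j) \<in> borel_measurable M"
  using H_distributed[of r j] by (auto simp: distributed_def)

lemma distr_H:
  assumes r: "r \<in> {1..Nr}"
  shows "distr M (PiM UNIV (\<lambda>_. borel)) (\<lambda>\<omega>. vec_nth (H r \<omega>)) = PiM UNIV (\<lambda>_. complex_gaussian)"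
proof -
  let ?I = "{1..Nr} \<times> (UNIV :: 'nt set)" and ?X = "\<lambda>(r, j) \<omega>. H r \<omega> $ j"
  have X: "?X i \<in> borel_measurable M" "distr M borel (?X i) = complex_gaussian" if "i \<in> ?I" for i
    using H_distributed[of "fst i" "snd i"] that
    by (auto simp: distributed_def complex_gaussian_def case_prod_beta cong: distr_cong)
  have "distr M (PiM ?I (\<lambda>_. borel)) (\<lambda>\<omega>. \<lambda>i\<in>?I. ?X i \<omega>) = PiM ?I (\<lambda>i. distr M borel (?X i))"
    using r H_indep by (subst (asm) indep_vars_iff_distr_eq_PiM') (use X in auto)
  also have "\<dots> = PiM ?I (\<lambda>_. complex_gaussian)"
    by (intro PiM_cong refl X)
  finally have law: "distr M (PiM ?I (\<lambda>_. borel)) (\<lambda>\<omega>. \<lambda>i\<in>?I. ?X i \<omega>) = PiM ?I (\<lambda>_. complex_gaussian)" .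
  have "distr M (PiM UNIV (\<lambda>_. borel)) (\<lambda>\<omega>. vec_nth (H r \<omega>)) =
      distr M (PiM UNIV (\<lambda>_. borel)) ((\<lambda>h. \<lambda>j\<in>UNIV. h (r, j)) \<circ> (\<lambda>\<omega>. \<lambda>i\<in>?I. ?X i \<omega>))"
    using r by (intro distr_cong) (auto simp: fun_eq_iff)
  also have "\<dots> = distr (distr M (PiM ?I (\<lambda>_. borel)) (\<lambda>\<omega>. \<lambda>i\<in>?I. ?X i \<omega>)) (PiM UNIV (\<lambda>_. borel)) (\<lambda>h. \<lambda>j\<in>UNIV. h (r, j))"
    by (rule distr_distr[symmetric])
      (use X r in \<open>auto intro!: measurable_restrict measurable_component_singleton simp del: restrict_UNIV\<close>)
  also have "\<dots> = distr (PiM ?I (\<lambda>_. complex_gaussian)) (PiM UNIV (\<lambda>_. complex_gaussian)) (\<lambda>h. \<lambda>j\<in>UNIV. h (r, j))"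
    unfolding law by (intro distr_cong refl) (simp cong: sets_PiM_cong)
  also have "\<dots> = PiM UNIV (\<lambda>_. complex_gaussian)"
    using r by (intro distr_PiM_reindex) (auto simp: prob_space_complex_gaussian inj_on_def)
  finally show ?thesis .
qed

lemma measurable_H[measurable]:
  "r \<in> {1..Nr} \<Longrightarrow> (\<lambda>\<omega>. vec_nth (H r \<omega>)) \<in> measurable M (PiM UNIV (\<lambda>_. borel))"
  by (subst restrict_UNIV[symmetric]) (intro measurable_restrict measurable_H_component)

text \<open>\<open>R\<close> is the set of antennas in use, later \<open>{1}\<close> or all of
  \<open>{1..Nr}\<close>. Independence of the rows contributes the factor \<open>card R\<close> to
  the exponent, independence of the slots the factor \<open>D\<close>.\<close>

lemma prob_outage_fixed_precoders:
  assumes R: "R \<subseteq> {1..Nr}" "R \<noteq> {}"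
    and v: "corthonormal_family ({1..N} \<times> {1..D}) v"
  shows "prob {\<omega> \<in> space M. \<forall>r\<in>R. \<forall>d\<in>{1..D}. \<not> covered N c T (\<lambda>i. (cmod (tprod (H r \<omega>) (v (i, d))))\<^sup>2)}
    = outage N c T ^ (card R * D)"
proof -
  define J where "J = {1..N} \<times> {1..D}"
  define B where "B = {z \<in> space (PiM J (\<lambda>_. borel)). \<forall>d\<in>{1..D}. \<not> covered N c T (\<lambda>i. (cmod (z (i, d)))\<^sup>2)}"
  define f where "f = (\<lambda>h. \<lambda>k\<in>J. tprod (vec_lambda h :: complex ^ 'nt) (v k))"
  define A where "A = f -` B \<inter> space (PiM UNIV (\<lambda>_. borel))"
  have finJ: "finite J" by (simp add: J_def)
  have B[measurable]: "B \<in> sets (PiM J (\<lambda>_. borel))"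
    unfolding B_def covered_def J_def by measurable
  have f[measurable]: "f \<in> measurable (PiM UNIV (\<lambda>_. borel)) (PiM J (\<lambda>_. borel))"
    unfolding f_def tprod_def by (intro measurable_restrict) simp
  have A[measurable]: "A \<in> sets (PiM UNIV (\<lambda>_. borel))"
    unfolding A_def by measurable
  have finR: "finite R" using R(1) by (rule finite_subset) simp
  have "indep_vars (\<lambda>r. PiM ({r} \<times> UNIV) (\<lambda>_. borel)) (\<lambda>r \<omega>. restrict (\<lambda>i. (case i of (r, j) \<Rightarrow> \<lambda>\<omega>. H r \<omega> $ j) \<omega>) ({r} \<times> UNIV)) R"
    by (rule indep_vars_restrict[OF H_indep]) (use R in \<open>auto simp: disjoint_family_on_def\<close>)
  then have "indep_vars (\<lambda>r. PiM UNIV (\<lambda>_. borel)) (\<lambda>r \<omega>. (\<lambda>h j. h (r, j)) (restrict (\<lambda>i. (case i of (r, j) \<Rightarrow> \<lambda>\<omega>. H r \<omega> $ j) \<omega>) ({r} \<times> UNIV))) R"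
  proof (rule indep_vars_compose2)
    fix r
    have "(\<lambda>h. \<lambda>j\<in>UNIV. h (r, j)) \<in> measurable (PiM ({r} \<times> UNIV) (\<lambda>_. borel)) (PiM UNIV (\<lambda>_. borel))"
      by (intro measurable_restrict measurable_component_singleton) auto
    then show "(\<lambda>h j. h (r, j)) \<in> measurable (PiM ({r} \<times> UNIV) (\<lambda>_. borel)) (PiM UNIV (\<lambda>_. borel))"
      by (simp only: restrict_UNIV)
  qed
  then have "indep_vars (\<lambda>r. PiM UNIV (\<lambda>_. borel)) (\<lambda>r \<omega>. vec_nth (H r \<omega>)) R"
    by (simp cong: indep_vars_cong)
  then have "prob (\<Inter>r\<in>R. (\<lambda>\<omega>. vec_nth (H r \<omega>)) -` A \<inter> space M) = (\<Prod>r\<in>R. prob ((\<lambda>\<omega>. vec_nth (H r \<omega>)) -` A \<inter> space M))"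
    using R finR A by (intro indep_varsD_finite) auto
  also have "(\<Inter>r\<in>R. (\<lambda>\<omega>. vec_nth (H r \<omega>)) -` A \<inter> space M) =
    {\<omega> \<in> space M. \<forall>r\<in>R. \<forall>d\<in>{1..D}. \<not> covered N c T (\<lambda>i. (cmod (tprod (H r \<omega>) (v (i, d))))\<^sup>2)}"
  proof -
    have "vec_nth (H r \<omega>) \<in> A \<longleftrightarrow> (\<forall>d\<in>{1..D}. \<not> covered N c T (\<lambda>i. (cmod (tprod (H r \<omega>) (v (i, d))))\<^sup>2))" for r \<omega>
    proof -
      have "covered N c T (\<lambda>i. (cmod (f (vec_nth (H r \<omega>)) (i, d)))\<^sup>2) \<longleftrightarrow> covered N c T (\<lambda>i. (cmod (tprod (H r \<omega>) (v (i, d))))\<^sup>2)"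
        if "d \<in> {1..D}" for d
        using that by (intro covered_cong) (auto simp: f_def J_def)
      moreover have "f h \<in> space (PiM J (\<lambda>_. borel))" "h \<in> space (PiM UNIV (\<lambda>_. borel))" for h
        by (simp_all add: f_def space_PiM)
      ultimately show ?thesis
        unfolding A_def B_def by auto
    qed
    then show ?thesis using R by auto
  qed
  also have "(\<Prod>r\<in>R. prob ((\<lambda>\<omega>. vec_nth (H r \<omega>)) -` A \<inter> space M)) = (\<Prod>r\<in>R. outage N c T ^ D)"
  proof (intro prod.cong refl)
    fix r assume "r \<in> R"
    then have r: "r \<in> {1..Nr}" using R by auto
    have "prob ((\<lambda>\<omega>. vec_nth (H r \<omega>)) -` A \<inter> space M) = measure (PiM UNIV (\<lambda>_. complex_gaussian)) A"
      unfolding distr_H[OF r, symmetric] using r by (subst measure_distr) auto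
    also have "\<dots> = measure (distr (PiM UNIV (\<lambda>_. complex_gaussian)) (PiM J (\<lambda>_. borel)) f) B"
      by (subst measure_distr) (auto simp: A_def space_PiM cong: measurable_cong_sets sets_PiM_cong)
    also have "distr (PiM UNIV (\<lambda>_. complex_gaussian)) (PiM J (\<lambda>_. borel)) f = PiM J (\<lambda>_. complex_gaussian)"
      unfolding f_def using v ND by (intro distr_tprod_orthonormal finJ) (auto simp: J_def)
    also have "measure (PiM J (\<lambda>_. complex_gaussian)) B = outage N c T ^ D"
      unfolding B_def by (rule measure_outage_all_slots[OF N D J_def])
    finally show "prob ((\<lambda>\<omega>. vec_nth (H r \<omega>)) -` A \<inter> space M) = outage N c T ^ D" .
  qed
  finally show ?thesis by (simp flip: power_mult add: mult.commute)
qed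

text \<open>The event is moved to the value spaces and integrated over its sections with the
  precoders frozen. Almost every section has the probability computed for fixed precoders, which is
  constant, so the integral is that constant. Measurability is part of the claim because the
  complement is taken afterwards.\<close>

lemma prob_outage:
  assumes R: "R \<subseteq> {1..Nr}" "R \<noteq> {}"
  shows "{\<omega> \<in> space M. \<forall>r\<in>R. \<forall>d\<in>{1..D}. \<not> covered N c T (\<lambda>i. (cmod (tprod (H r \<omega>) (\<phi> i d \<omega>)))\<^sup>2)} \<in> events"
      (is "?E \<in> events")
    and "prob {\<omega> \<in> space M. \<forall>r\<in>R. \<forall>d\<in>{1..D}. \<not> covered N c T (\<lambda>i. (cmod (tprod (H r \<omega>) (\<phi> i d \<omega>)))\<^sup>2)}
      = outage N c T ^ (card R * D)" (is "prob ?E = ?q")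
proof -
  define J where "J = {1..N} \<times> {1..D}"
  let ?S = "PiM {1..Nr} (\<lambda>_. borel :: (complex ^ 'nt) measure)" and ?S' = "PiM J (\<lambda>_. borel :: (complex ^ 'nt) measure)"
  define X where "X = (\<lambda>\<omega>. \<lambda>r\<in>{1..Nr}. H r \<omega>)"
  define Y where "Y = (\<lambda>\<omega>. \<lambda>(n, d)\<in>J. \<phi> n d \<omega>)"
  have ind: "indep_rvs M ?S X ?S' Y"
    using H_\<phi>_indep by (simp add: X_def Y_def J_def)
  then have X[measurable]: "X \<in> measurable M ?S" and Y[measurable]: "Y \<in> measurable M ?S'"
    by (auto simp: indep_rvs_def)
  define B where "B = {p \<in> space (?S \<Otimes>\<^sub>M ?S'). \<forall>r\<in>R. \<forall>d\<in>{1..D}. \<not> covered N c T (\<lambda>i. (cmod (tprod (fst p r) (snd p (i, d))))\<^sup>2)}"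
  have finR: "finite R" using R(1) by (rule finite_subset) simp
  have B[measurable]: "B \<in> sets (?S \<Otimes>\<^sub>M ?S')"
  proof -
    have t: "(\<lambda>p. tprod (fst p r) (snd p (i, d))) \<in> borel_measurable (?S \<Otimes>\<^sub>M ?S')"
      if "r \<in> R" "d \<in> {1..D}" "i \<in> {1..N}" for r d i
    proof -
      have "r \<in> {1..Nr}" "(i, d) \<in> J" using that R by (auto simp: J_def)
      then have [measurable]: "(\<lambda>p. fst p r) \<in> borel_measurable (?S \<Otimes>\<^sub>M ?S')" "(\<lambda>p. snd p (i, d)) \<in> borel_measurable (?S \<Otimes>\<^sub>M ?S')"
        by (auto intro!: measurable_compose[OF measurable_fst] measurable_compose[OF measurable_snd])
      show ?thesis
        unfolding tprod_def
        by (intro borel_measurable_sum borel_measurable_times measurable_compose[OF _ borel_measurable_vec_nth]) measurable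
    qed
    have "Measurable.pred (?S \<Otimes>\<^sub>M ?S') (\<lambda>p. \<forall>r\<in>R. \<forall>d\<in>{1..D}. \<not> covered N c T (\<lambda>i. (cmod (tprod (fst p r) (snd p (i, d))))\<^sup>2))"
      unfolding covered_def
      by (intro pred_intros_finite finR finite_atLeastAtMost pred_intros_logic borel_measurable_pred_less
          borel_measurable_times borel_measurable_add borel_measurable_sum borel_measurable_power
          borel_measurable_const measurable_compose[OF t borel_measurable_norm]) auto
    then show ?thesis unfolding B_def by (rule predE)
  qed
  interpret X: prob_space "distr M ?S X" by (rule prob_space_distr) measurable
  interpret Y: prob_space "distr M ?S' Y" by (rule prob_space_distr) measurable
  interpret pair_sigma_finite "distr M ?S X" "distr M ?S' Y" ..
  have Bd: "B \<in> sets (distr M ?S X \<Otimes>\<^sub>M distr M ?S' Y)"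
    using B by (simp cong: sets_pair_measure_cong del: One_nat_def)
  have E: "?E = (\<lambda>\<omega>. (X \<omega>, Y \<omega>)) -` B \<inter> space M"
  proof -
    have "(\<forall>r\<in>R. \<forall>d\<in>{1..D}. \<not> covered N c T (\<lambda>i. (cmod (tprod (X \<omega> r) (Y \<omega> (i, d))))\<^sup>2)) \<longleftrightarrow>
        (\<forall>r\<in>R. \<forall>d\<in>{1..D}. \<not> covered N c T (\<lambda>i. (cmod (tprod (H r \<omega>) (\<phi> i d \<omega>)))\<^sup>2))" for \<omega>
      using R by (intro ball_cong refl arg_cong[where f=Not] covered_cong) (auto simp: X_def Y_def J_def)
    then show ?thesis
      using measurable_space[OF X] measurable_space[OF Y] by (auto simp: B_def space_pair_measure)
  qed
  show "?E \<in> events"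
    unfolding E by measurable
  have "emeasure M ?E = emeasure M ((\<lambda>\<omega>. (X \<omega>, Y \<omega>)) -` B \<inter> space M)"
    by (simp only: E)
  also have "\<dots> = emeasure (distr M ?S X \<Otimes>\<^sub>M distr M ?S' Y) B"
    by (subst pair_measure_distr_indep_rvs[OF prob_space_axioms ind], subst emeasure_distr[OF measurable_Pair[OF X Y] B]) simp
  also have "\<dots> = (\<integral>\<^sup>+y. emeasure (distr M ?S X) ((\<lambda>x. (x, y)) -` B) \<partial>distr M ?S' Y)"
    by (rule emeasure_pair_measure_alt2) (rule Bd)
  also have "\<dots> = (\<integral>\<^sup>+\<omega>. emeasure (distr M ?S X) ((\<lambda>x. (x, Y \<omega>)) -` B) \<partial>M)"
    by (rule nn_integral_distr) (use Y measurable_emeasure_Pair2[OF Bd] in \<open>auto simp del: One_nat_def\<close>)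
  also have "\<dots> = (\<integral>\<^sup>+\<omega>. ennreal ?q \<partial>M)"
  proof (rule nn_integral_cong_AE)
    have const: "emeasure (distr M ?S X) ((\<lambda>x. (x, Y \<omega>)) -` B) = ennreal ?q"
      if \<omega>: "\<omega> \<in> space M" and o: "corthonormal_family ({1..N} \<times> {1..D}) (\<lambda>(n, d). \<phi> n d \<omega>)" for \<omega>
    proof -
      have "emeasure (distr M ?S X) ((\<lambda>x. (x, Y \<omega>)) -` B) = emeasure M (X -` ((\<lambda>x. (x, Y \<omega>)) -` B) \<inter> space M)"
        by (rule emeasure_distr) (rule X, rule sets_Pair2[OF B])
      also have "X -` ((\<lambda>x. (x, Y \<omega>)) -` B) \<inter> space M =
        {\<omega>' \<in> space M. \<forall>r\<in>R. \<forall>d\<in>{1..D}. \<not> covered N c T (\<lambda>i. (cmod (tprod (H r \<omega>') (case (i, d) of (n, d) \<Rightarrow> \<phi> n d \<omega>)))\<^sup>2)}"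
      proof -
        have "(\<forall>r\<in>R. \<forall>d\<in>{1..D}. \<not> covered N c T (\<lambda>i. (cmod (tprod (X \<omega>' r) (Y \<omega> (i, d))))\<^sup>2)) \<longleftrightarrow>
            (\<forall>r\<in>R. \<forall>d\<in>{1..D}. \<not> covered N c T (\<lambda>i. (cmod (tprod (H r \<omega>') (\<phi> i d \<omega>)))\<^sup>2))" for \<omega>'
          using R by (intro ball_cong refl arg_cong[where f=Not] covered_cong) (auto simp: X_def Y_def J_def)
        then show ?thesis
          using measurable_space[OF X] measurable_space[OF Y] \<omega> by (auto simp: B_def space_pair_measure)
      qed
      also have "emeasure M \<dots> = ennreal ?q"
        unfolding emeasure_eq_measure by (simp only: prob_outage_fixed_precoders[OF R o])
      finally show ?thesis .
    qed
    from AE_space \<phi>_orthonormal show "AE \<omega> in M. emeasure (distr M ?S X) ((\<lambda>x. (x, Y \<omega>)) -` B) = ennreal ?q"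
      by eventually_elim (rule const)
  qed
  also have "\<dots> = ennreal ?q" by (simp add: emeasure_space_1)
  finally show "prob ?E = ?q"
    unfolding emeasure_eq_measure by (subst (asm) ennreal_inj) (auto simp: outage_def)
qed

lemma prob_max_sinr:
  assumes R: "R \<subseteq> {1..Nr}" "R \<noteq> {}" and \<rho>: "\<rho> > 0"
  shows "prob {\<omega> \<in> space M. \<exists>r\<in>R. \<exists>d\<in>{1..D}. \<exists>n\<in>{1..N}. T < sinr N \<rho> (H r \<omega>) (\<lambda>i. \<phi> i d \<omega>) n}
    = 1 - outage N (real N / \<rho>) T ^ (card R * D)"
proof -
  let ?E = "{\<omega> \<in> space M. \<forall>r\<in>R. \<forall>d\<in>{1..D}. \<not> covered N (real N / \<rho>) T (\<lambda>i. (cmod (tprod (H r \<omega>) (\<phi> i d \<omega>)))\<^sup>2)}"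
  have "{\<omega> \<in> space M. \<exists>r\<in>R. \<exists>d\<in>{1..D}. \<exists>n\<in>{1..N}. T < sinr N \<rho> (H r \<omega>) (\<lambda>i. \<phi> i d \<omega>) n} = space M - ?E"
    unfolding sinr_gt_iff[OF N \<rho>] covered_def by auto
  then show ?thesis
    using prob_compl[OF prob_outage(1)[OF R]] by (simp only: prob_outage(2)[OF R])
qed

end

section \<open>Coverage by the strongest of several exponential variables\<close>

interpretation std_exponential: product_sigma_finite "\<lambda>_::nat. std_exponential"
  by (intro product_sigma_finite.intro prob_space_imp_sigma_finite prob_space_std_exponential)

lemma nn_integral_std_exponential:
  assumes [measurable]: "f \<in> borel_measurable borel"
  shows "(\<integral>\<^sup>+x. f x \<partial>std_exponential) = (\<integral>\<^sup>+x. ennreal (exp (- x)) * indicator {0..} x * f x \<partial>lborel)"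
  by (subst nn_integral_density)
    (auto simp: exponential_density_def indicator_def not_less intro!: nn_integral_cong)

lemma AE_std_exponential_nonneg: "AE x in std_exponential. 0 \<le> x"
  by (subst AE_density) (auto simp: exponential_density_def intro!: AE_I2)

text \<open>The predicate \<open>s\<close> marks the indices at which a tie with \<open>x\<close> is
  excluded. It can stay abstract in the integrals below, since for fixed \<open>x\<close> it affects
  a null set only.\<close>

definition strongest :: "(nat \<Rightarrow> bool) \<Rightarrow> nat set \<Rightarrow> real \<Rightarrow> (nat \<Rightarrow> real) \<Rightarrow> bool" where
  "strongest s I x w \<longleftrightarrow> (\<forall>i\<in>I. w i \<le> x \<and> (s i \<longrightarrow> w i < x))"

lemma measurable_strongest[measurable (raw)]:
  assumes "finite I" "f \<in> borel_measurable M" "\<And>i. i \<in> I \<Longrightarrow> (\<lambda>p. g p i) \<in> borel_measurable M"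
  shows "Measurable.pred M (\<lambda>p. strongest s I (f p) (g p))"
  unfolding strongest_def using assms by (intro pred_intros_finite pred_intros_logic) auto

text \<open>Ties between beams are broken by the index, so that the events that beam \<open>n\<close> is the strongest
  one and is covered are pairwise disjoint.\<close>

lemma emeasure_covered:
  assumes T: "T > 0"
  shows "emeasure (PiM {1..N} (\<lambda>_. std_exponential)) {x \<in> space (PiM {1..N} (\<lambda>_. borel)). covered N c T x}
    = (\<Sum>n\<in>{1..N}. \<integral>\<^sup>+x. (\<integral>\<^sup>+w. indicator {w. strongest (\<lambda>i. i < n) ({1..N} - {n}) x w \<and> T * (c + (\<Sum>i\<in>{1..N} - {n}. w i)) < x} w
        \<partial>PiM ({1..N} - {n}) (\<lambda>_. std_exponential)) \<partial>std_exponential)"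
proof -
  let ?\<mu> = "PiM {1..N} (\<lambda>_. std_exponential)"
  define P where "P = (\<lambda>n (x :: nat \<Rightarrow> real). strongest (\<lambda>i. i < n) ({1..N} - {n}) (x n) x \<and> T * (c + (\<Sum>i\<in>{1..N} - {n}. x i)) < x n)"
  define A where "A = (\<lambda>n. {x \<in> space ?\<mu>. P n x})"
  have A[measurable]: "A n \<in> sets ?\<mu>" if "n \<in> {1..N}" for n
  proof -
    have [measurable]: "(\<lambda>x. x i) \<in> borel_measurable ?\<mu>" if "i \<in> {1..N}" for i
      using measurable_component_singleton[OF that, of "\<lambda>_. std_exponential"] by simp
    have "Measurable.pred ?\<mu> (P n)"
      unfolding P_def using that by measurable
    then show ?thesis unfolding A_def by (rule predE)
  qed
  have "{x \<in> space (PiM {1..N} (\<lambda>_. borel)). covered N c T x} = (\<Union>n\<in>{1..N}. A n)"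
  proof -
    have "covered N c T x \<longleftrightarrow> (\<exists>n\<in>{1..N}. P n x)" for x
    proof
      assume "covered N c T x"
      then obtain n where n: "n \<in> {1..N}" "T * (c + (\<Sum>i\<in>{1..N} - {n}. x i)) < x n"
        by (auto simp: covered_def)
      define mx where "mx = Max (x ` {1..N})"
      have mx: "x i \<le> mx" if "i \<in> {1..N}" for i
        using that by (simp add: mx_def)
      have "mx \<in> x ` {1..N}" unfolding mx_def using n by (intro Max_in) auto
      then have ex: "\<exists>i. i \<in> {1..N} \<and> x i = mx" by auto
      \<comment> \<open>The smallest index among the maximisers, in accordance with the strictness
        demanded for \<open>i < k\<close>.\<close>
      define k where "k = (LEAST i. i \<in> {1..N} \<and> x i = mx)"
      have k: "k \<in> {1..N}" "x k = mx"
        using LeastI_ex[OF ex] by (auto simp: k_def)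
      have "x i < mx" if "i \<in> {1..N}" "i < k" for i
        using not_less_Least[of i "\<lambda>i. i \<in> {1..N} \<and> x i = mx"] that mx[of i] by (auto simp: k_def)
      then have "strongest (\<lambda>i. i < k) ({1..N} - {k}) (x k) x"
        using mx k by (auto simp: strongest_def)
      \<comment> \<open>The total power is fixed, so passing from the covered beam \<open>n\<close>
        to the strongest beam \<open>k\<close> raises the signal and lowers the interference by the
        same amount.\<close>
      moreover have "T * (c + (\<Sum>i\<in>{1..N} - {k}. x i)) < x k"
      proof -
        have s: "(\<Sum>i\<in>{1..N} - {j}. x i) = (\<Sum>i\<in>{1..N}. x i) - x j" if "j \<in> {1..N}" for j
          using that by (subst sum_diff1) auto
        have "(\<Sum>i\<in>{1..N} - {k}. x i) \<le> (\<Sum>i\<in>{1..N} - {n}. x i)"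
          unfolding s[OF k(1)] s[OF n(1)] using mx[OF n(1)] k by simp
        then have "T * (c + (\<Sum>i\<in>{1..N} - {k}. x i)) \<le> T * (c + (\<Sum>i\<in>{1..N} - {n}. x i))"
          using T by (intro mult_left_mono) auto
        also have "\<dots> < x n" by (rule n(2))
        also have "\<dots> \<le> x k" using mx[OF n(1)] k by simp
        finally show ?thesis .
      qed
      ultimately show "\<exists>n\<in>{1..N}. P n x" using k by (auto simp: P_def)
    next
      assume "\<exists>n\<in>{1..N}. P n x"
      then show "covered N c T x" by (auto simp: P_def covered_def)
    qed
    then show ?thesis by (auto simp: A_def space_PiM)
  qed
  also have "emeasure ?\<mu> (\<Union>n\<in>{1..N}. A n) = (\<Sum>n\<in>{1..N}. emeasure ?\<mu> (A n))"
  proof (rule sum_emeasure[symmetric])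
    show "disjoint_family_on A {1..N}"
    proof (unfold disjoint_family_on_def, safe)
      fix n k x assume nk: "n \<in> {1..N}" "k \<in> {1..N}" "n \<noteq> k" and x: "x \<in> A n" "x \<in> A k"
      then have "x k \<le> x n" "k < n \<longrightarrow> x k < x n" "x n \<le> x k" "n < k \<longrightarrow> x n < x k"
        by (auto simp: A_def P_def strongest_def)
      with nk show "x \<in> {}" by auto
    qed
  qed (use A in auto)
  also have "\<dots> = (\<Sum>n\<in>{1..N}. \<integral>\<^sup>+x. (\<integral>\<^sup>+w. indicator {w. strongest (\<lambda>i. i < n) ({1..N} - {n}) x w \<and> T * (c + (\<Sum>i\<in>{1..N} - {n}. w i)) < x} w
        \<partial>PiM ({1..N} - {n}) (\<lambda>_. std_exponential)) \<partial>std_exponential)"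
  proof (intro sum.cong refl)
    fix n assume n: "n \<in> {1..N}"
    have ins: "insert n ({1..N} - {n}) = {1..N}" using n by auto
    have "emeasure ?\<mu> (A n) = (\<integral>\<^sup>+x. indicator (A n) x \<partial>?\<mu>)"
      using A[OF n] by simp
    also have "\<dots> = (\<integral>\<^sup>+x. (\<integral>\<^sup>+w. indicator (A n) (w(n := x)) \<partial>PiM ({1..N} - {n}) (\<lambda>_. std_exponential)) \<partial>std_exponential)"
      using std_exponential.product_nn_integral_insert_rev[of "{1..N} - {n}" n "indicator (A n)"] A[OF n]
      by (simp add: ins insert_absorb[OF n] del: One_nat_def)
    also have "\<dots> = (\<integral>\<^sup>+x. (\<integral>\<^sup>+w. indicator {w. strongest (\<lambda>i. i < n) ({1..N} - {n}) x w \<and> T * (c + (\<Sum>i\<in>{1..N} - {n}. w i)) < x} w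
        \<partial>PiM ({1..N} - {n}) (\<lambda>_. std_exponential)) \<partial>std_exponential)"
    proof (intro nn_integral_cong)
      fix x :: real and w :: "nat \<Rightarrow> real" assume w: "w \<in> space (PiM ({1..N} - {n}) (\<lambda>_. std_exponential))"
      then have "w(n := x) \<in> space ?\<mu>"
        using n by (auto simp: space_PiM PiE_def extensional_def)
      moreover have "(\<Sum>i\<in>{1..N} - {n}. (w(n := x)) i) = (\<Sum>i\<in>{1..N} - {n}. w i)"
        by (intro sum.cong) auto
      ultimately show "indicator (A n) (w(n := x)) = (indicator {w. strongest (\<lambda>i. i < n) ({1..N} - {n}) x w \<and> T * (c + (\<Sum>i\<in>{1..N} - {n}. w i)) < x} w :: ennreal)"
        by (auto simp: A_def P_def strongest_def indicator_def)
    qed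
    finally show "emeasure ?\<mu> (A n) = \<dots>" .
  qed
  finally show ?thesis .
qed

section \<open>Thresholds of at least one\<close>

lemma emeasure_std_exponential_gt:
  assumes "0 \<le> a"
  shows "emeasure std_exponential {a<..} = ennreal (exp (- a))"
proof -
  have "emeasure std_exponential {a<..} = (\<integral>\<^sup>+x. ennreal (exp (- x)) * indicator {0..} x * indicator {a<..} x \<partial>lborel)"
    by (subst nn_integral_std_exponential[symmetric]) auto
  also have "\<dots> = (\<integral>\<^sup>+x. ennreal (exp (- x)) * indicator {a..} x \<partial>lborel)"
    using assms AE_lborel_singleton[of a]
    by (intro nn_integral_cong_AE) (auto elim!: eventually_mono simp: indicator_def)
  finally show ?thesis by (simp add: nn_integral_exp_minus_Ici)
qed

lemma nn_integral_std_exponential_exp: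
  assumes "0 \<le> T"
  shows "(\<integral>\<^sup>+w. ennreal (exp (- (T * w))) \<partial>std_exponential) = ennreal (1 / (T + 1))"
proof -
  define q where "q = T + 1"
  have q: "q > 0" using assms by (simp add: q_def)
  have "(\<integral>\<^sup>+w. ennreal (exp (- (T * w))) \<partial>std_exponential)
      = (\<integral>\<^sup>+x. ennreal (exp (- (q * x))) * indicator {0..} x \<partial>lborel)"
    unfolding q_def by (subst nn_integral_std_exponential)
      (auto intro!: nn_integral_cong simp: indicator_def algebra_simps simp flip: ennreal_mult exp_add)
  also have "\<dots> = 0 - (- exp (- (q * 0)) / q)"
  proof (rule nn_integral_FTC_atLeast[where F = "\<lambda>x. - exp (- (q * x)) / q" and T = 0])
    show "DERIV (\<lambda>x. - exp (- (q * x)) / q) x :> exp (- (q * x))" for x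
      using q by (auto intro!: derivative_eq_intros)
    have "((\<lambda>x. - exp (- (q * x)) / q) \<longlongrightarrow> - 0 / q) at_top"
      using q
      by (intro tendsto_intros filterlim_compose[OF exp_at_bot] filterlim_compose[OF filterlim_uminus_at_bot_at_top]
          filterlim_tendsto_pos_mult_at_top[OF tendsto_const] filterlim_ident) auto
    then show "((\<lambda>x. - exp (- (q * x)) / q) \<longlongrightarrow> 0) at_top" by simp
  qed auto
  finally show ?thesis by (simp add: q_def)
qed

text \<open>The interferers are integrated last: for given \<open>w\<close> the variable
  \<open>x\<close> contributes the tail \<open>exp (- T * (c + sum))\<close>, which factorises into
  Laplace transforms \<open>1 / (T + 1)\<close>, one for each element of \<open>I\<close>. The
  condition \<open>strongest\<close> is automatic because
  \<open>T * (c + sum) \<ge> c + sum > w i\<close> for non-negative \<open>w\<close>.\<close>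

lemma nn_integral_strongest_high_threshold:
  assumes I: "finite I" and T: "T \<ge> 1" and c: "c > 0"
  shows "(\<integral>\<^sup>+x. (\<integral>\<^sup>+w. indicator {w. strongest s I x w \<and> T * (c + (\<Sum>i\<in>I. w i)) < x} w
        \<partial>PiM I (\<lambda>_. std_exponential)) \<partial>std_exponential) = ennreal (exp (- T * c) / (T + 1) ^ card I)"
proof -
  let ?\<mu> = "PiM I (\<lambda>_. std_exponential)"
  interpret \<mu>: prob_space ?\<mu> by (intro prob_space_PiM prob_space_std_exponential)
  interpret E: prob_space std_exponential by (rule prob_space_std_exponential)
  interpret pair_sigma_finite ?\<mu> std_exponential ..
  have [measurable]: "(\<lambda>w. w i) \<in> borel_measurable ?\<mu>" if "i \<in> I" for i
    using measurable_component_singleton[OF that, of "\<lambda>_. std_exponential"] by simp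
  have "(\<integral>\<^sup>+x. (\<integral>\<^sup>+w. indicator {w. strongest s I x w \<and> T * (c + (\<Sum>i\<in>I. w i)) < x} w \<partial>?\<mu>) \<partial>std_exponential)
     = (\<integral>\<^sup>+w. (\<integral>\<^sup>+x. indicator {w. strongest s I x w \<and> T * (c + (\<Sum>i\<in>I. w i)) < x} w \<partial>std_exponential) \<partial>?\<mu>)"
  proof (rule Fubini')
    have "Measurable.pred (?\<mu> \<Otimes>\<^sub>M std_exponential) (\<lambda>p. strongest s I (snd p) (fst p) \<and> T * (c + (\<Sum>i\<in>I. (fst p) i)) < snd p)"
      using I by measurable
    then have "(\<lambda>p. indicator {p. strongest s I (snd p) (fst p) \<and> T * (c + (\<Sum>i\<in>I. (fst p) i)) < snd p} p :: ennreal)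
      \<in> borel_measurable (?\<mu> \<Otimes>\<^sub>M std_exponential)"
      by measurable
    then show "(\<lambda>(w, x). indicator {w. strongest s I x w \<and> T * (c + (\<Sum>i\<in>I. w i)) < x} w :: ennreal)
      \<in> borel_measurable (?\<mu> \<Otimes>\<^sub>M std_exponential)"
      by (simp add: indicator_def case_prod_beta)
  qed
  also have "\<dots> = (\<integral>\<^sup>+w. ennreal (exp (- T * c)) * (\<Prod>i\<in>I. ennreal (exp (- (T * w i)))) \<partial>?\<mu>)"
  proof (rule nn_integral_cong_AE)
    have "AE w in ?\<mu>. \<forall>i\<in>I. 0 \<le> w i"
      by (intro AE_finite_allI I AE_PiM_component prob_space_std_exponential AE_std_exponential_nonneg)
    then show "AE w in ?\<mu>. (\<integral>\<^sup>+x. indicator {w. strongest s I x w \<and> T * (c + (\<Sum>i\<in>I. w i)) < x} w \<partial>std_exponential)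
        = ennreal (exp (- T * c)) * (\<Prod>i\<in>I. ennreal (exp (- (T * w i))))"
    proof eventually_elim
      case (elim w)
      have "w i < x" if "i \<in> I" "T * (c + (\<Sum>i\<in>I. w i)) < x" for i x
      proof -
        have "w i \<le> (\<Sum>i\<in>I. w i)"
          using I that elim by (intro member_le_sum) auto
        also have "\<dots> < c + (\<Sum>i\<in>I. w i)" using c by simp
        also have "\<dots> \<le> T * (c + (\<Sum>i\<in>I. w i))"
          using T c elim mult_right_mono[of 1 T "c + (\<Sum>i\<in>I. w i)"] by (simp add: sum_nonneg add_nonneg_nonneg)
        finally show ?thesis using that by simp
      qed
      then have "(\<integral>\<^sup>+x. indicator {w. strongest s I x w \<and> T * (c + (\<Sum>i\<in>I. w i)) < x} w \<partial>std_exponential)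
          = (\<integral>\<^sup>+x. indicator {T * (c + (\<Sum>i\<in>I. w i))<..} x \<partial>std_exponential)"
        by (intro nn_integral_cong) (auto simp: indicator_def strongest_def intro: less_imp_le)
      also have "\<dots> = ennreal (exp (- (T * (c + (\<Sum>i\<in>I. w i)))))"
        using T c elim by (simp add: emeasure_std_exponential_gt sum_nonneg)
      also have "\<dots> = ennreal (exp (- T * c)) * (\<Prod>i\<in>I. ennreal (exp (- (T * w i))))"
        using I by (simp add: prod_ennreal exp_sum[symmetric] sum_negf sum_distrib_left[symmetric] algebra_simps
            flip: ennreal_mult exp_add)
      finally show ?case .
    qed
  qed
  also have "\<dots> = ennreal (exp (- T * c)) * (\<Prod>i\<in>I. \<integral>\<^sup>+w. ennreal (exp (- (T * w))) \<partial>std_exponential)"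
    using I by (subst nn_integral_cmult, measurable, subst std_exponential.product_nn_integral_prod) auto
  also have "\<dots> = ennreal (exp (- T * c) / (T + 1) ^ card I)"
    using T by (simp add: nn_integral_std_exponential_exp ennreal_power power_one_over flip: ennreal_mult)
  finally show ?thesis .
qed

section \<open>Sums of truncated exponential variables\<close>

definition pospow :: "nat \<Rightarrow> real \<Rightarrow> real" where
  "pospow k z = (if 0 \<le> z then z ^ k else 0)"

lemma borel_measurable_pospow[measurable]: "pospow k \<in> borel_measurable borel"
  unfolding pospow_def[abs_def] by measurable

text \<open>Integrating a truncated power over a window of length \<open>x\<close> gives a
  difference of the next truncated power. The three cases locate the kink \<open>s = a\<close>
  before, inside or beyond the window.\<close>

lemma has_bochner_integral_pospow:
  assumes x: "x > 0" and n: "n \<ge> 1"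
  shows "has_bochner_integral lborel (\<lambda>s. indicator {0..<x} s * pospow (n - 1) (a - s))
    ((pospow n a - pospow n (a - x)) / n)"
proof -
  consider "a < 0" | "0 \<le> a" "a < x" | "x \<le> a" by linarith
  then show ?thesis
  proof cases
    case 1
    then have "(\<lambda>s. indicator {0..<x} s * pospow (n - 1) (a - s)) = (\<lambda>_. 0)"
      by (auto simp: fun_eq_iff indicator_def pospow_def)
    moreover have "pospow n a = 0" "pospow n (a - x) = 0" using 1 x by (auto simp: pospow_def)
    ultimately show ?thesis by (simp add: has_bochner_integral_zero)
  next
    case 2
    have "has_bochner_integral lborel (\<lambda>s. (a - s) ^ (n - 1) * indicator {0..a} s) (- ((a - a) ^ n) / n - (- ((a - 0) ^ n) / n))"
      by (rule has_bochner_integral_FTC_Icc_real[where F = "\<lambda>s. - ((a - s) ^ n) / n"])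
        (use 2 n in \<open>auto intro!: derivative_eq_intros\<close>)
    moreover have "(\<lambda>s. (a - s) ^ (n - 1) * indicator {0..a} s) = (\<lambda>s. indicator {0..<x} s * pospow (n - 1) (a - s))"
      using 2 by (auto simp: fun_eq_iff indicator_def pospow_def)
    moreover have "- ((a - a) ^ n) / n - (- ((a - 0) ^ n) / n) = (pospow n a - pospow n (a - x)) / n"
      using 2 n by (auto simp: pospow_def)
    ultimately show ?thesis by simp
  next
    case 3
    have "has_bochner_integral lborel (\<lambda>s. (a - s) ^ (n - 1) * indicator {0..x} s) (- ((a - x) ^ n) / n - (- ((a - 0) ^ n) / n))"
      by (rule has_bochner_integral_FTC_Icc_real[where F = "\<lambda>s. - ((a - s) ^ n) / n"])
        (use 3 n x in \<open>auto intro!: derivative_eq_intros\<close>)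
    moreover have "- ((a - x) ^ n) / n - (- ((a - 0) ^ n) / n) = (pospow n a - pospow n (a - x)) / n"
      using 3 x by (auto simp: pospow_def diff_divide_distrib)
    moreover have "has_bochner_integral lborel (\<lambda>s. (a - s) ^ (n - 1) * indicator {0..x} s) v \<longleftrightarrow>
        has_bochner_integral lborel (\<lambda>s. indicator {0..<x} s * pospow (n - 1) (a - s)) v" for v
    proof (rule has_bochner_integral_cong_AE)
      show "AE s in lborel. (a - s) ^ (n - 1) * indicator {0..x} s = indicator {0..<x} s * pospow (n - 1) (a - s)"
        using AE_lborel_singleton[of x] 3 by (auto elim!: eventually_mono simp: indicator_def pospow_def)
    qed measurable
    ultimately show ?thesis by simp
  qed
qed

text \<open>For \<open>n\<close> independent standard exponential variables, \<open>trunc_sum_density n x\<close> is the density of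
  the restriction of the law of their sum to the event that all of them are below \<open>x\<close>.\<close>

definition trunc_sum_density :: "nat \<Rightarrow> real \<Rightarrow> real \<Rightarrow> real" where
  "trunc_sum_density n x y = exp (- y) / fact (n - 1) *
     (\<Sum>t\<le>n. (- 1) ^ t * real (n choose t) * pospow (n - 1) (y - real t * x))"

lemma borel_measurable_trunc_sum_density[measurable]:
  "(\<lambda>p. trunc_sum_density n (fst p) (snd p)) \<in> borel_measurable (borel \<Otimes>\<^sub>M borel)"
  unfolding trunc_sum_density_def by measurable

lemma borel_measurable_trunc_sum_density'[measurable (raw)]:
  assumes "f \<in> borel_measurable M" "g \<in> borel_measurable M"
  shows "(\<lambda>p. trunc_sum_density n (f p) (g p)) \<in> borel_measurable M"
  using measurable_compose[OF measurable_Pair[OF assms] borel_measurable_trunc_sum_density] by simp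

text \<open>Pascal's rule: the \<open>n\<close>-th finite difference of first differences is the
  \<open>(n + 1)\<close>-st finite difference.\<close>

lemma sum_alternating_binomial_diff:
  fixes a :: "nat \<Rightarrow> real"
  shows "(\<Sum>t\<le>n. (- 1) ^ t * real (n choose t) * (a t - a (Suc t))) =
    (\<Sum>t\<le>Suc n. (- 1) ^ t * real (Suc n choose t) * a t)"
proof -
  have "(\<Sum>t\<le>Suc n. (- 1) ^ t * real (Suc n choose t) * a t)
    = a 0 + (\<Sum>t\<le>n. (- 1) ^ Suc t * real (Suc n choose Suc t) * a (Suc t))"
    by (subst sum.atMost_Suc_shift) simp
  also have "\<dots> = a 0 + (\<Sum>t\<le>n. (- 1) ^ Suc t * real (n choose Suc t) * a (Suc t))
      + (\<Sum>t\<le>n. (- 1) ^ Suc t * real (n choose t) * a (Suc t))"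
    by (simp add: sum.distrib[symmetric] algebra_simps)
  also have "a 0 + (\<Sum>t\<le>n. (- 1) ^ Suc t * real (n choose Suc t) * a (Suc t)) = (\<Sum>t\<le>Suc n. (- 1) ^ t * real (n choose t) * a t)"
    by (subst sum.atMost_Suc_shift) simp
  also have "\<dots> = (\<Sum>t\<le>n. (- 1) ^ t * real (n choose t) * a t)" by simp
  finally show ?thesis
    by (simp add: sum.distrib[symmetric] right_diff_distrib sum_subtractf sum_negf)
qed

text \<open>Convolution with one more truncated variable. The factor
  \<open>exp (- s) * exp (- (z - s)) = exp (- z)\<close> leaves the integral, every truncated power
  becomes a difference, and the differences recombine by Pascal's rule.\<close>

lemma has_bochner_integral_trunc_sum_density:
  assumes x: "x > 0" and n: "n \<ge> 1"
  shows "has_bochner_integral lborel (\<lambda>s. indicator {0..<x} s * (exp (- s) * trunc_sum_density n x (z - s)))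
    (trunc_sum_density (Suc n) x z)"
proof -
  let ?C = "\<lambda>t. (- 1) ^ t * real (n choose t)"
  have "has_bochner_integral lborel (\<lambda>s. exp (- z) / fact (n - 1) *
      (\<Sum>t\<le>n. ?C t * (indicator {0..<x} s * pospow (n - 1) ((z - real t * x) - s))))
     (exp (- z) / fact (n - 1) * (\<Sum>t\<le>n. ?C t * ((pospow n (z - real t * x) - pospow n (z - real t * x - x)) / n)))"
    by (intro has_bochner_integral_mult_right has_bochner_integral_sum has_bochner_integral_pospow x n)
  also have "(\<lambda>s. exp (- z) / fact (n - 1) * (\<Sum>t\<le>n. ?C t * (indicator {0..<x} s * pospow (n - 1) ((z - real t * x) - s))))
     = (\<lambda>s. indicator {0..<x} s * (exp (- s) * trunc_sum_density n x (z - s)))"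
  proof
    fix s
    have "exp (- s) * exp (- (z - s)) = exp (- z)" by (simp flip: exp_add)
    moreover have "z - s - real t * x = z - real t * x - s" for t by simp
    ultimately show "exp (- z) / fact (n - 1) * (\<Sum>t\<le>n. ?C t * (indicator {0..<x} s * pospow (n - 1) ((z - real t * x) - s)))
      = indicator {0..<x} s * (exp (- s) * trunc_sum_density n x (z - s))"
      unfolding trunc_sum_density_def by (auto simp: indicator_def cancel_ab_semigroup_add_class.diff_right_commute[of z s] simp flip: mult.assoc)
  qed
  also have "exp (- z) / fact (n - 1) * (\<Sum>t\<le>n. ?C t * ((pospow n (z - real t * x) - pospow n (z - real t * x - x)) / n))
      = trunc_sum_density (Suc n) x z"
  proof -
    have "(\<Sum>t\<le>n. ?C t * ((pospow n (z - real t * x) - pospow n (z - real t * x - x)) / n))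
      = (\<Sum>t\<le>n. ?C t * (pospow n (z - real t * x) - pospow n (z - real (Suc t) * x))) / n"
      by (simp add: sum_divide_distrib algebra_simps)
    also have "(\<Sum>t\<le>n. ?C t * (pospow n (z - real t * x) - pospow n (z - real (Suc t) * x)))
      = (\<Sum>t\<le>Suc n. (- 1) ^ t * real (Suc n choose t) * pospow n (z - real t * x))"
      by (rule sum_alternating_binomial_diff)
    finally have *: "(\<Sum>t\<le>n. ?C t * ((pospow n (z - real t * x) - pospow n (z - real t * x - x)) / n))
      = (\<Sum>t\<le>Suc n. (- 1) ^ t * real (Suc n choose t) * pospow n (z - real t * x)) / n" .
    have "fact n = real n * fact (n - 1)" using n by (simp add: fact_reduce)
    then show ?thesis unfolding * trunc_sum_density_def by simp
  qed
  finally show ?thesis .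
qed

text \<open>The base of the recursion depends on \<open>pospow 0 0 = 1\<close>:
  \<open>pospow 0\<close> is the indicator of the half-line including 0, so its difference is the
  indicator of the half-open interval.\<close>

lemma trunc_sum_density_1:
  assumes "x > 0"
  shows "trunc_sum_density 1 x y = indicator {0..<x} y * exp (- y)"
  using assms by (auto simp: trunc_sum_density_def pospow_def indicator_def)

text \<open>The alternating sum does not reveal its sign; writing it as a convolution of
  non-negative functions does.\<close>

lemma trunc_sum_density_nonneg:
  assumes x: "x > 0" and n: "n \<ge> 1"
  shows "0 \<le> trunc_sum_density n x y"
  using n
proof (induction n arbitrary: y rule: nat_induct_at_least)
  case base
  then show ?case using x by (simp add: trunc_sum_density_1 del: One_nat_def)
next
  case (Suc n)
  show ?case
    unfolding has_bochner_integral_integral_eq[OF has_bochner_integral_trunc_sum_density[OF x Suc(1)], symmetric]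
    by (intro integral_nonneg_AE AE_I2) (simp add: Suc.IH)
qed

text \<open>Here the tie-breaking flag \<open>b\<close> disappears, because the point
  \<open>y = x\<close> is null.\<close>

lemma nn_integral_truncated:
  fixes f :: "real \<Rightarrow> ennreal"
  assumes [measurable]: "f \<in> borel_measurable borel"
  shows "(\<integral>\<^sup>+y. indicator {y. y \<le> x \<and> (b \<longrightarrow> y < x)} y * f y \<partial>std_exponential)
    = (\<integral>\<^sup>+y. ennreal (indicator {0..<x} y * exp (- y)) * f y \<partial>lborel)"
proof -
  have "(\<integral>\<^sup>+y. indicator {y. y \<le> x \<and> (b \<longrightarrow> y < x)} y * f y \<partial>std_exponential)
    = (\<integral>\<^sup>+y. ennreal (exp (- y)) * indicator {0..} y * (indicator {y. y \<le> x \<and> (b \<longrightarrow> y < x)} y * f y) \<partial>lborel)"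
    by (rule nn_integral_std_exponential) measurable
  also have "\<dots> = (\<integral>\<^sup>+y. ennreal (indicator {0..<x} y * exp (- y)) * f y \<partial>lborel)"
    using AE_lborel_singleton[of x] by (intro nn_integral_cong_AE) (auto elim!: eventually_mono simp: indicator_def)
  finally show ?thesis .
qed

text \<open>Induction on the set of interferers: one variable is split off and absorbed into the
  test function, and the convolution recursion then rebuilds the density. The test function
  \<open>f\<close> must be arbitrary, since the induction hypothesis is applied to the averaged
  function \<open>h\<close>.\<close>

lemma nn_integral_strongest:
  fixes f :: "real \<Rightarrow> ennreal"
  assumes "finite I" "I \<noteq> {}" and x: "x > 0" and f: "f \<in> borel_measurable borel"
  shows "(\<integral>\<^sup>+w. indicator {w. strongest s I x w} w * f (\<Sum>i\<in>I. w i) \<partial>PiM I (\<lambda>_. std_exponential))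
    = (\<integral>\<^sup>+y. f y * ennreal (trunc_sum_density (card I) x y) \<partial>lborel)"
  using assms(1,2) f
proof (induction I arbitrary: f rule: finite_ne_induct)
  case (singleton i)
  note [measurable] = singleton
  have "(\<integral>\<^sup>+w. indicator {w. strongest s {i} x w} w * f (\<Sum>i\<in>{i}. w i) \<partial>PiM {i} (\<lambda>_. std_exponential))
    = (\<integral>\<^sup>+w. (\<lambda>y. indicator {y. y \<le> x \<and> (s i \<longrightarrow> y < x)} y * f y) (w i) \<partial>PiM {i} (\<lambda>_. std_exponential))"
    by (intro nn_integral_cong) (auto simp: strongest_def indicator_def)
  also have "\<dots> = (\<integral>\<^sup>+y. indicator {y. y \<le> x \<and> (s i \<longrightarrow> y < x)} y * f y \<partial>std_exponential)"
    by (rule std_exponential.product_nn_integral_singleton) measurable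
  also have "\<dots> = (\<integral>\<^sup>+y. ennreal (indicator {0..<x} y * exp (- y)) * f y \<partial>lborel)"
    by (rule nn_integral_truncated) (rule singleton)
  finally show ?case
    by (simp add: trunc_sum_density_1[OF x, unfolded One_nat_def] mult.commute)
next
  case (insert i I)
  note [measurable] = insert.prems
  let ?n = "card I"
  have n: "?n \<ge> 1" using insert by (simp add: Suc_leI card_gt_0_iff)
  have mc: "(\<lambda>w. w j) \<in> borel_measurable (PiM (insert i I) (\<lambda>_. std_exponential))" if "j \<in> insert i I" for j
    using measurable_component_singleton[OF that, of "\<lambda>_. std_exponential"] by simp
  define h where "h = (\<lambda>z. \<integral>\<^sup>+s. ennreal (indicator {0..<x} s * exp (- s)) * f (s + z) \<partial>lborel)"
  have h[measurable]: "h \<in> borel_measurable borel"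
    unfolding h_def by measurable
  have meas: "(\<lambda>w. indicator {w. strongest s (insert i I) x w} w * f (\<Sum>j\<in>insert i I. w j))
      \<in> borel_measurable (PiM (insert i I) (\<lambda>_. std_exponential))"
  proof -
    note [measurable] = mc
    have "Measurable.pred (PiM (insert i I) (\<lambda>_. std_exponential)) (strongest s (insert i I) x)"
      using insert by (intro measurable_strongest[where g = "\<lambda>w. w", simplified]) auto
    then have "(\<lambda>w. indicator {w. strongest s (insert i I) x w} w :: ennreal) \<in> borel_measurable (PiM (insert i I) (\<lambda>_. std_exponential))"
      by measurable
    moreover have "(\<lambda>w. f (\<Sum>j\<in>insert i I. w j)) \<in> borel_measurable (PiM (insert i I) (\<lambda>_. std_exponential))"
      by measurable
    ultimately show ?thesis by (rule borel_measurable_times_ennreal)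
  qed
  have "(\<integral>\<^sup>+w. indicator {w. strongest s (insert i I) x w} w * f (\<Sum>j\<in>insert i I. w j) \<partial>PiM (insert i I) (\<lambda>_. std_exponential))
    = (\<integral>\<^sup>+w. (\<integral>\<^sup>+y. indicator {w. strongest s (insert i I) x w} (w(i := y)) * f (\<Sum>j\<in>insert i I. (w(i := y)) j)
        \<partial>std_exponential) \<partial>PiM I (\<lambda>_. std_exponential))"
    by (rule std_exponential.product_nn_integral_insert[OF insert(1,3) meas])
  also have "\<dots> = (\<integral>\<^sup>+w. indicator {w. strongest s I x w} w * h (\<Sum>j\<in>I. w j) \<partial>PiM I (\<lambda>_. std_exponential))"
  proof (rule nn_integral_cong)
    fix w
    have "(\<integral>\<^sup>+y. indicator {w. strongest s (insert i I) x w} (w(i := y)) * f (\<Sum>j\<in>insert i I. (w(i := y)) j) \<partial>std_exponential)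
      = (\<integral>\<^sup>+y. indicator {w. strongest s I x w} w * (indicator {y. y \<le> x \<and> (s i \<longrightarrow> y < x)} y * f (y + (\<Sum>j\<in>I. w j))) \<partial>std_exponential)"
    proof (rule nn_integral_cong)
      fix y
      have "(\<Sum>j\<in>insert i I. (w(i := y)) j) = y + (\<Sum>j\<in>I. w j)"
        using insert(1,3) by (auto simp: intro!: sum.cong)
      moreover have "strongest s (insert i I) x (w(i := y)) \<longleftrightarrow> strongest s I x w \<and> y \<le> x \<and> (s i \<longrightarrow> y < x)"
        using insert(3) by (auto simp: strongest_def)
      ultimately show "indicator {w. strongest s (insert i I) x w} (w(i := y)) * f (\<Sum>j\<in>insert i I. (w(i := y)) j)
        = indicator {w. strongest s I x w} w * (indicator {y. y \<le> x \<and> (s i \<longrightarrow> y < x)} y * f (y + (\<Sum>j\<in>I. w j)))"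
        by (auto simp: indicator_def)
    qed
    also have "\<dots> = indicator {w. strongest s I x w} w * (\<integral>\<^sup>+y. indicator {y. y \<le> x \<and> (s i \<longrightarrow> y < x)} y * f (y + (\<Sum>j\<in>I. w j)) \<partial>std_exponential)"
      by (rule nn_integral_cmult) measurable
    also have "(\<integral>\<^sup>+y. indicator {y. y \<le> x \<and> (s i \<longrightarrow> y < x)} y * f (y + (\<Sum>j\<in>I. w j)) \<partial>std_exponential) = h (\<Sum>j\<in>I. w j)"
      unfolding h_def by (rule nn_integral_truncated) measurable
    finally show "(\<integral>\<^sup>+y. indicator {w. strongest s (insert i I) x w} (w(i := y)) * f (\<Sum>j\<in>insert i I. (w(i := y)) j) \<partial>std_exponential)
      = indicator {w. strongest s I x w} w * h (\<Sum>j\<in>I. w j)" .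
  qed
  also have "\<dots> = (\<integral>\<^sup>+z. h z * ennreal (trunc_sum_density ?n x z) \<partial>lborel)"
    by (rule insert.IH) (rule h)
  also have "\<dots> = (\<integral>\<^sup>+z. (\<integral>\<^sup>+s. ennreal (indicator {0..<x} s * exp (- s)) * f (s + z) * ennreal (trunc_sum_density ?n x z) \<partial>lborel) \<partial>lborel)"
    unfolding h_def by (intro nn_integral_cong nn_integral_multc[symmetric]) measurable
  also have "\<dots> = (\<integral>\<^sup>+s. (\<integral>\<^sup>+z. ennreal (indicator {0..<x} s * exp (- s)) * f (s + z) * ennreal (trunc_sum_density ?n x z) \<partial>lborel) \<partial>lborel)"
    by (rule lborel_pair.Fubini') measurable
  \<comment> \<open>Shifting \<open>z\<close> by \<open>s\<close> moves the translation from
    \<open>f\<close> to the density, so that after the next exchange the inner integral over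
    \<open>s\<close> is the convolution of the recursion.\<close>
  also have "\<dots> = (\<integral>\<^sup>+s. (\<integral>\<^sup>+z. ennreal (indicator {0..<x} s * exp (- s)) * f z * ennreal (trunc_sum_density ?n x (z - s)) \<partial>lborel) \<partial>lborel)"
  proof (rule nn_integral_cong)
    fix s :: real
    show "(\<integral>\<^sup>+z. ennreal (indicator {0..<x} s * exp (- s)) * f (s + z) * ennreal (trunc_sum_density ?n x z) \<partial>lborel)
      = (\<integral>\<^sup>+z. ennreal (indicator {0..<x} s * exp (- s)) * f z * ennreal (trunc_sum_density ?n x (z - s)) \<partial>lborel)"
      by (subst (2) lborel_distr_plus[of s, symmetric]) (simp add: nn_integral_distr)
  qed
  also have "\<dots> = (\<integral>\<^sup>+z. (\<integral>\<^sup>+s. ennreal (indicator {0..<x} s * exp (- s)) * f z * ennreal (trunc_sum_density ?n x (z - s)) \<partial>lborel) \<partial>lborel)"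
    by (rule lborel_pair.Fubini') measurable
  also have "\<dots> = (\<integral>\<^sup>+z. f z * ennreal (trunc_sum_density (card (insert i I)) x z) \<partial>lborel)"
  proof (rule nn_integral_cong)
    fix z
    have "(\<integral>\<^sup>+s. ennreal (indicator {0..<x} s * exp (- s)) * f z * ennreal (trunc_sum_density ?n x (z - s)) \<partial>lborel)
      = (\<integral>\<^sup>+s. f z * ennreal (indicator {0..<x} s * (exp (- s) * trunc_sum_density ?n x (z - s))) \<partial>lborel)"
      by (intro nn_integral_cong) (simp add: ennreal_mult'' trunc_sum_density_nonneg[OF x n] mult_ac)
    also have "\<dots> = f z * (\<integral>\<^sup>+s. ennreal (indicator {0..<x} s * (exp (- s) * trunc_sum_density ?n x (z - s))) \<partial>lborel)"
      by (rule nn_integral_cmult) measurable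
    also have "(\<integral>\<^sup>+s. ennreal (indicator {0..<x} s * (exp (- s) * trunc_sum_density ?n x (z - s))) \<partial>lborel)
      = ennreal (trunc_sum_density (Suc ?n) x z)"
      using has_bochner_integral_trunc_sum_density[OF x n, of z]
      by (subst nn_integral_eq_integral) (auto simp: has_bochner_integral_iff trunc_sum_density_nonneg[OF x n])
    finally show "(\<integral>\<^sup>+s. ennreal (indicator {0..<x} s * exp (- s)) * f z * ennreal (trunc_sum_density ?n x (z - s)) \<partial>lborel)
      = f z * ennreal (trunc_sum_density (card (insert i I)) x z)"
      using insert(1,3) by simp
  qed
  finally show ?case .
qed

section \<open>Integration over the cells\<close>

text \<open>The upper incomplete gamma integral of \<open>x ^ n * exp (- q * x)\<close> over
  \<open>x > b\<close> in closed form. Its factors are arranged as in the terms of the final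
  formula, so that these can be matched by little more than unfolding.\<close>

definition gamma_tail :: "nat \<Rightarrow> real \<Rightarrow> real \<Rightarrow> real" where
  "gamma_tail n q b = fact n / q ^ (n + 1) * exp (- q * b) * (\<Sum>u = 0..n. q ^ u * (b ^ u / fact u))"

text \<open>Integration by parts for the tail integral; it reduces the computation of the derivative
  to an induction on \<open>n\<close>.\<close>

lemma gamma_tail_Suc:
  assumes "q > 0"
  shows "gamma_tail (Suc n) q b = b ^ Suc n * exp (- q * b) / q + real (Suc n) / q * gamma_tail n q b"
proof -
  define f :: real where "f = fact n"
  define s where "s = real (Suc n)"
  define S where "S = (\<Sum>u = 0..n. q ^ u * (b ^ u / fact u))"
  have nz: "q \<noteq> 0" "f \<noteq> 0" "s \<noteq> 0" using assms by (simp_all add: f_def s_def)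
  have fs: "fact (Suc n) = s * f" by (simp add: f_def s_def)
  have "gamma_tail (Suc n) q b
      = s * f / q ^ (Suc n + 1) * exp (- q * b) * (S + q ^ Suc n * (b ^ Suc n / (s * f)))"
    unfolding gamma_tail_def fs[symmetric] S_def by (simp only: sum.atLeast0_atMost_Suc)
  also have "\<dots> = b ^ Suc n * exp (- q * b) / q + s / q * (f / q ^ (n + 1) * exp (- q * b) * S)"
    using nz by (simp add: field_simps)
  finally show ?thesis by (simp add: gamma_tail_def f_def s_def S_def)
qed

lemma DERIV_gamma_tail:
  assumes q: "q > 0"
  shows "DERIV (gamma_tail n q) x :> - (x ^ n * exp (- q * x))"
proof (induction n)
  case 0
  show ?case
    unfolding gamma_tail_def using q by (auto intro!: derivative_eq_intros)
next
  case (Suc n)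
  have e: "gamma_tail (Suc n) q = (\<lambda>b. b ^ Suc n * exp (- q * b) / q + real (Suc n) / q * gamma_tail n q b)"
    using gamma_tail_Suc[OF q] by auto
  have p: "DERIV (\<lambda>b. b ^ Suc n) x :> real (Suc n) * x ^ n"
    using DERIV_pow[of "Suc n" x] by simp
  have x: "DERIV (\<lambda>b. exp (- q * b)) x :> exp (- q * x) * - q"
    by (auto intro!: derivative_eq_intros)
  show ?case
    unfolding e
    by (rule DERIV_cong[OF DERIV_add[OF DERIV_cdivide[OF DERIV_mult[OF p x]] DERIV_cmult[OF Suc.IH]]])
      (use q in \<open>simp add: field_simps\<close>)
qed

lemma tendsto_gamma_tail:
  assumes q: "q > 0"
  shows "(gamma_tail n q \<longlongrightarrow> 0) at_top"
proof -
  have lim: "((\<lambda>x. x ^ u * exp (- q * x)) \<longlongrightarrow> 0) at_top" for u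
  proof -
    have "((\<lambda>x. (q * x) ^ u / exp (q * x)) \<longlongrightarrow> 0) at_top"
      by (intro filterlim_compose[OF tendsto_power_div_exp_0] filterlim_tendsto_pos_mult_at_top[OF tendsto_const q filterlim_ident])
    then have "((\<lambda>x. 1 / q ^ u * ((q * x) ^ u / exp (q * x))) \<longlongrightarrow> 1 / q ^ u * 0) at_top"
      by (intro tendsto_mult tendsto_const)
    moreover have "1 / q ^ u * ((q * x) ^ u / exp (q * x)) = x ^ u * exp (- q * x)" for x
      using q by (simp add: power_mult_distrib exp_minus field_simps)
    ultimately show ?thesis by simp
  qed
  have "((\<lambda>x. \<Sum>u = 0..n. fact n / q ^ (n + 1) * q ^ u / fact u * (x ^ u * exp (- q * x))) \<longlongrightarrow> 
      (\<Sum>u = 0..n. fact n / q ^ (n + 1) * q ^ u / fact u * 0)) at_top"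
    by (intro tendsto_sum tendsto_mult tendsto_const lim)
  moreover have "(\<lambda>x. \<Sum>u = 0..n. fact n / q ^ (n + 1) * q ^ u / fact u * (x ^ u * exp (- q * x))) = gamma_tail n q"
    by (auto simp: gamma_tail_def sum_distrib_left fun_eq_iff intro!: sum.cong)
  ultimately show ?thesis by simp
qed

lemma has_bochner_integral_gamma_tail:
  assumes q: "q > 0" and b: "b \<ge> 0"
  shows "has_bochner_integral lborel (\<lambda>x. indicator {b<..} x * (x ^ n * exp (- q * x))) (gamma_tail n q b)"
proof (rule has_bochner_integral_nn_integral)
  have "(\<integral>\<^sup>+x. ennreal (indicator {b<..} x * (x ^ n * exp (- q * x))) \<partial>lborel)
    = (\<integral>\<^sup>+x. ennreal (x ^ n * exp (- q * x)) * indicator {b..} x \<partial>lborel)"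
    using AE_lborel_singleton[of b] by (intro nn_integral_cong_AE) (auto elim!: eventually_mono simp: indicator_def)
  also have "\<dots> = 0 - (- gamma_tail n q b)"
  proof (rule nn_integral_FTC_atLeast[where F = "\<lambda>x. - gamma_tail n q x" and T = 0])
    show "DERIV (\<lambda>x. - gamma_tail n q x) x :> x ^ n * exp (- q * x)" for x
      by (rule DERIV_cong[OF DERIV_minus[OF DERIV_gamma_tail[OF q]]]) simp
    show "((\<lambda>x. - gamma_tail n q x) \<longlongrightarrow> 0) at_top"
      using tendsto_minus[OF tendsto_gamma_tail[OF q]] by simp
  qed (use b in auto)
  finally show "(\<integral>\<^sup>+x. ennreal (indicator {b<..} x * (x ^ n * exp (- q * x))) \<partial>lborel) = ennreal (gamma_tail n q b)"
    by simp
  show "0 \<le> gamma_tail n q b"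
    unfolding gamma_tail_def using q b by (intro mult_nonneg_nonneg sum_nonneg divide_nonneg_nonneg) auto
qed (use b in \<open>auto simp: indicator_def\<close>)

lemma has_bochner_integral_xi:
  assumes "\<And>i l. i \<le> N - 2 \<Longrightarrow> l \<le> i \<Longrightarrow> has_bochner_integral M (f i l) (g i l)"
  shows "has_bochner_integral M (\<lambda>y. xi N k (\<lambda>i l. f i l y)) (xi N k g)"
  unfolding xi_def by (intro has_bochner_integral_mult_right has_bochner_integral_sum assms) auto

lemma xi_cong:
  assumes "\<And>i l. i \<le> N - 2 \<Longrightarrow> l \<le> i \<Longrightarrow> f i l = g i l"
  shows "xi N k f = xi N k g"
  unfolding xi_def using assms by (intro arg_cong2[where f="(*)"] refl sum.cong) auto

lemma xi_diff: "xi N k (\<lambda>i l. f i l - g i l) = xi N k f - xi N k g"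
  unfolding xi_def by (simp only: sum_subtractf right_diff_distrib)

lemma xi_mult_left: "xi N k (\<lambda>i l. a * f i l) = a * xi N k f"
  unfolding xi_def by (simp only: sum_distrib_left[symmetric] mult.left_commute[of _ a])

text \<open>Only \<open>t = 1\<close> occurs, and the factor \<open>(1 - t) ^ i\<close> then kills
  every \<open>i > 0\<close>, while \<open>0 ^ 0 = 1\<close> keeps \<open>i = l = 0\<close>.\<close>

lemma xi_1:
  assumes "N \<ge> 2"
  shows "xi N 1 g = real N / fact (N - 2) * g 0 0"
proof -
  have "(\<Sum>i = 0..N - 2. real ((N - 2) choose i) * (1 - real 1) ^ i * fact i * (\<Sum>l = 0..i. g i l))
      = (\<Sum>i = 0..N - 2. if i = 0 then g 0 0 else 0)"
    by (intro sum.cong refl) (auto simp: power_0_left)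
  then show ?thesis by (simp add: xi_def)
qed

text \<open>\<open>beam_density N k\<close> is the joint density of the largest of \<open>N\<close> exponential variables and of the
  sum of the others on the cell \<open>(k - 1) x \<le> y < k x\<close>, where the truncated powers in
  \<open>trunc_sum_density\<close> are polynomial.\<close>

definition beam_density :: "nat \<Rightarrow> nat \<Rightarrow> real \<Rightarrow> real \<Rightarrow> real" where
  "beam_density N k x y = real N / fact (N - 2) *
     (\<Sum>t = 1..k. real ((N - 1) choose (t - 1)) * (- 1) ^ (t + 1) *
       (\<Sum>i = 0..N - 2. real ((N - 2) choose i) * (1 - real t) ^ i * (y ^ (N - 2 - i) * exp (- y) * (x ^ i * exp (- x)))))"

text \<open>The integral of \<open>beam_density\<close> over \<open>x > \<alpha>\<close>. The factor
  \<open>fact i\<close> and the sum over \<open>l\<close> in \<open>xi\<close> are those of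
  \<open>gamma_tail i 1 \<alpha>\<close>.\<close>

definition beam_tail :: "nat \<Rightarrow> nat \<Rightarrow> real \<Rightarrow> real \<Rightarrow> real" where
  "beam_tail N k y \<alpha> = xi N k (\<lambda>i l. y ^ (N - 2 - i) * exp (- y) * (exp (- \<alpha>) * \<alpha> ^ l / fact l))"

lemma has_bochner_integral_beam_tail:
  assumes \<alpha>: "\<alpha> \<ge> 0"
  shows "has_bochner_integral lborel (\<lambda>x. indicator {\<alpha><..} x * beam_density N k x y) (beam_tail N k y \<alpha>)"
proof -
  have "has_bochner_integral lborel (\<lambda>x. real N / fact (N - 2) *
     (\<Sum>t = 1..k. real ((N - 1) choose (t - 1)) * (- 1) ^ (t + 1) *
       (\<Sum>i = 0..N - 2. real ((N - 2) choose i) * (1 - real t) ^ i * (y ^ (N - 2 - i) * exp (- y) * (indicator {\<alpha><..} x * (x ^ i * exp (- 1 * x)))))))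
    (real N / fact (N - 2) *
     (\<Sum>t = 1..k. real ((N - 1) choose (t - 1)) * (- 1) ^ (t + 1) *
       (\<Sum>i = 0..N - 2. real ((N - 2) choose i) * (1 - real t) ^ i * (y ^ (N - 2 - i) * exp (- y) * gamma_tail i 1 \<alpha>))))"
    by (intro has_bochner_integral_mult_right has_bochner_integral_sum has_bochner_integral_gamma_tail \<alpha>) auto
  also have "(\<lambda>x. real N / fact (N - 2) *
     (\<Sum>t = 1..k. real ((N - 1) choose (t - 1)) * (- 1) ^ (t + 1) *
       (\<Sum>i = 0..N - 2. real ((N - 2) choose i) * (1 - real t) ^ i * (y ^ (N - 2 - i) * exp (- y) * (indicator {\<alpha><..} x * (x ^ i * exp (- 1 * x)))))))
     = (\<lambda>x. indicator {\<alpha><..} x * beam_density N k x y)"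
    by (auto simp: fun_eq_iff beam_density_def indicator_def)
  also have "(real N / fact (N - 2) *
     (\<Sum>t = 1..k. real ((N - 1) choose (t - 1)) * (- 1) ^ (t + 1) *
       (\<Sum>i = 0..N - 2. real ((N - 2) choose i) * (1 - real t) ^ i * (y ^ (N - 2 - i) * exp (- y) * gamma_tail i 1 \<alpha>))))
    = beam_tail N k y \<alpha>"
  proof -
    have "a * (y ^ (N - 2 - i) * exp (- y) * gamma_tail i 1 \<alpha>) = a * fact i *
        (\<Sum>l = 0..i. y ^ (N - 2 - i) * exp (- y) * (exp (- \<alpha>) * \<alpha> ^ l / fact l))" for a i
    proof -
      have "(\<Sum>l = 0..i. y ^ (N - 2 - i) * exp (- y) * (exp (- \<alpha>) * \<alpha> ^ l / fact l))
        = y ^ (N - 2 - i) * exp (- y) * exp (- \<alpha>) * (\<Sum>l = 0..i. \<alpha> ^ l / fact l)"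
        by (simp add: sum_distrib_left mult.assoc)
      then show ?thesis by (simp add: gamma_tail_def)
    qed
    then show ?thesis unfolding beam_tail_def xi_def by (simp only:)
  qed
  finally show ?thesis .
qed

lemma has_bochner_integral_beam_strip:
  assumes "0 \<le> \<alpha>" "\<alpha> \<le> \<beta>"
  shows "has_bochner_integral lborel (\<lambda>x. indicator {\<alpha><..\<beta>} x * beam_density N k x y)
    (beam_tail N k y \<alpha> - beam_tail N k y \<beta>)"
proof -
  have "(\<lambda>x. indicator {\<alpha><..\<beta>} x * beam_density N k x y) =
      (\<lambda>x. indicator {\<alpha><..} x * beam_density N k x y - indicator {\<beta><..} x * beam_density N k x y)"
    using assms by (auto simp: fun_eq_iff indicator_def)
  then show ?thesis
    using assms by (auto intro!: has_bochner_integral_diff has_bochner_integral_beam_tail)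
qed

text \<open>Arises from integrating \<open>beam_tail\<close> over \<open>y > b\<close> with its
  lower limit on the line \<open>x = T * (c + y)\<close>: the sum over \<open>v\<close> expands
  \<open>(c + y) ^ l\<close>, and \<open>T + 1\<close> adds the decay rates along the line.
  \<open>D1\<close> is a difference of two values of it, \<open>F1\<close> a single value.\<close>

definition threshold_tail :: "nat \<Rightarrow> real \<Rightarrow> real \<Rightarrow> nat \<Rightarrow> nat \<Rightarrow> real \<Rightarrow> real" where
  "threshold_tail N c T i l b =
     (\<Sum>v = 0..l. real (l choose v) * c ^ (l - v) * gamma_tail (N - i + v - 2) (T + 1) b)"

lemma has_bochner_integral_threshold_tail:
  assumes N: "N \<ge> 2" and T: "T > 0" and b: "b \<ge> 0"
  shows "has_bochner_integral lborel (\<lambda>y. indicator {b<..} y * beam_tail N k y (T * (c + y)))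
    (xi N k (\<lambda>i l. exp (- T * c) * (T ^ l / fact l) * threshold_tail N c T i l b))"
proof -
  have "has_bochner_integral lborel (\<lambda>y. xi N k (\<lambda>i l. exp (- T * c) * (T ^ l / fact l) *
      (\<Sum>v = 0..l. real (l choose v) * c ^ (l - v) * (indicator {b<..} y * (y ^ (N - i + v - 2) * exp (- (T + 1) * y))))))
    (xi N k (\<lambda>i l. exp (- T * c) * (T ^ l / fact l) * threshold_tail N c T i l b))"
    unfolding threshold_tail_def using T b
    by (intro has_bochner_integral_xi has_bochner_integral_mult_right has_bochner_integral_sum has_bochner_integral_gamma_tail) auto
  also have "(\<lambda>y. xi N k (\<lambda>i l. exp (- T * c) * (T ^ l / fact l) *
      (\<Sum>v = 0..l. real (l choose v) * c ^ (l - v) * (indicator {b<..} y * (y ^ (N - i + v - 2) * exp (- (T + 1) * y))))))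
    = (\<lambda>y. indicator {b<..} y * beam_tail N k y (T * (c + y)))"
  proof
    fix y
    have "exp (- T * c) * (T ^ l / fact l) *
        (\<Sum>v = 0..l. real (l choose v) * c ^ (l - v) * (indicator {b<..} y * (y ^ (N - i + v - 2) * exp (- (T + 1) * y))))
      = indicator {b<..} y * (y ^ (N - 2 - i) * exp (- y) * (exp (- (T * (c + y))) * (T * (c + y)) ^ l / fact l))"
      if i: "i \<le> N - 2" for i l
    proof -
      have "(y + c) ^ l = (\<Sum>v\<le>l. real (l choose v) * y ^ v * c ^ (l - v))"
        by (rule binomial_ring)
      then have bin: "(c + y) ^ l = (\<Sum>v = 0..l. real (l choose v) * y ^ v * c ^ (l - v))"
        by (simp add: add.commute atMost_atLeast0)
      \<comment> \<open>The bound \<open>i \<le> N - 2\<close> is what makes the truncated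
        subtractions exact here.\<close>
      have pw: "y ^ (N - i + v - 2) = y ^ (N - 2 - i) * y ^ v" for v
      proof -
        have "N - i + v - 2 = (N - 2 - i) + v" using i N by auto
        then show ?thesis by (simp add: power_add)
      qed
      have ex: "exp (- y) * exp (- (T * (c + y))) = exp (- T * c) * exp (- (T + 1) * y)"
        by (simp add: algebra_simps flip: exp_add)
      have "exp (- T * c) * (T ^ l / fact l) *
        (\<Sum>v = 0..l. real (l choose v) * c ^ (l - v) * (indicator {b<..} y * (y ^ (N - i + v - 2) * exp (- (T + 1) * y))))
        = indicator {b<..} y * y ^ (N - 2 - i) * (exp (- T * c) * exp (- (T + 1) * y)) * (T ^ l / fact l) *
          (\<Sum>v = 0..l. real (l choose v) * y ^ v * c ^ (l - v))"
        unfolding pw sum_distrib_left by (intro sum.cong refl) (simp add: mult_ac)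
      also have "\<dots> = indicator {b<..} y * (y ^ (N - 2 - i) * exp (- y) * (exp (- (T * (c + y))) * (T * (c + y)) ^ l / fact l))"
        unfolding bin[symmetric] ex[symmetric] by (simp add: power_mult_distrib mult_ac)
      finally show ?thesis .
    qed
    then show "xi N k (\<lambda>i l. exp (- T * c) * (T ^ l / fact l) *
      (\<Sum>v = 0..l. real (l choose v) * c ^ (l - v) * (indicator {b<..} y * (y ^ (N - i + v - 2) * exp (- (T + 1) * y)))))
      = indicator {b<..} y * beam_tail N k y (T * (c + y))"
      unfolding beam_tail_def xi_mult_left[symmetric] by (intro xi_cong) auto
  qed
  finally show ?thesis .
qed

text \<open>With the lower limit on the ray \<open>y = j * x\<close> the decay rates add up to
  \<open>1 + 1 / j\<close>. For \<open>j = k - 1\<close> this is the \<open>q = k / (k - 1)\<close>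
  of \<open>D2\<close> and \<open>E2\<close>, for \<open>j = k\<close> that of
  \<open>E1\<close>.\<close>

lemma has_bochner_integral_ray_tail:
  assumes N: "N \<ge> 2" and j: "j > 0" and b: "b \<ge> 0"
  shows "has_bochner_integral lborel (\<lambda>y. indicator {b<..} y * beam_tail N k y (y / j))
    (xi N k (\<lambda>i l. 1 / (j ^ l * fact l) * gamma_tail (N - i + l - 2) ((j + 1) / j) b))"
proof -
  have "has_bochner_integral lborel (\<lambda>y. xi N k (\<lambda>i l. 1 / (j ^ l * fact l) *
      (indicator {b<..} y * (y ^ (N - i + l - 2) * exp (- ((j + 1) / j) * y)))))
    (xi N k (\<lambda>i l. 1 / (j ^ l * fact l) * gamma_tail (N - i + l - 2) ((j + 1) / j) b))"
    using j b
    by (intro has_bochner_integral_xi has_bochner_integral_mult_right has_bochner_integral_gamma_tail) auto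
  also have "(\<lambda>y. xi N k (\<lambda>i l. 1 / (j ^ l * fact l) *
      (indicator {b<..} y * (y ^ (N - i + l - 2) * exp (- ((j + 1) / j) * y)))))
    = (\<lambda>y. indicator {b<..} y * beam_tail N k y (y / j))"
  proof
    fix y
    have "1 / (j ^ l * fact l) * (indicator {b<..} y * (y ^ (N - i + l - 2) * exp (- ((j + 1) / j) * y)))
      = indicator {b<..} y * (y ^ (N - 2 - i) * exp (- y) * (exp (- (y / j)) * (y / j) ^ l / fact l))"
      if i: "i \<le> N - 2" for i l
    proof -
      have "N - i + l - 2 = (N - 2 - i) + l" using i N by auto
      moreover have "- ((j + 1) / j) * y = - y + - (y / j)"
        using j by (simp add: field_simps)
      ultimately show ?thesis
        by (simp only: exp_add power_add) (simp add: power_divide)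
    qed
    then show "xi N k (\<lambda>i l. 1 / (j ^ l * fact l) *
      (indicator {b<..} y * (y ^ (N - i + l - 2) * exp (- ((j + 1) / j) * y))))
      = indicator {b<..} y * beam_tail N k y (y / j)"
      unfolding beam_tail_def xi_mult_left[symmetric] by (intro xi_cong) auto
  qed
  finally show ?thesis .
qed

section \<open>Decomposition of the coverage region into cells\<close>

definition cell :: "real \<Rightarrow> real \<Rightarrow> nat \<Rightarrow> (real \<times> real) set" where
  "cell c T k = {(x, y). 0 < x \<and> T * (c + y) < x \<and> (real k - 1) * x \<le> y \<and> y < real k * x}"

text \<open>The kink of the truncated power with index \<open>t\<close> lies on the ray
  \<open>y = t * x\<close>, so in the \<open>k\<close>-th cell exactly the indices
  \<open>t < k\<close> are active. \<open>k\<close> may exceed \<open>N\<close>: the binomial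
  coefficients of the surplus indices vanish. The sum is then shifted by one and the powers are
  expanded.\<close>

lemma beam_density_eq_trunc_sum_density:
  assumes N: "N \<ge> 2" and k: "k \<ge> 1" and x: "x > 0" and y: "(real k - 1) * x \<le> y" "y < real k * x"
  shows "real N * exp (- x) * trunc_sum_density (N - 1) x y = beam_density N k x y"
proof -
  have "(\<Sum>t\<le>N - 1. (- 1) ^ t * real ((N - 1) choose t) * pospow (N - 2) (y - real t * x))
    = (\<Sum>t<k. (- 1) ^ t * real ((N - 1) choose t) * (y - real t * x) ^ (N - 2))"
  proof (rule sum.mono_neutral_cong)
    show "(- 1) ^ t * real ((N - 1) choose t) * (y - real t * x) ^ (N - 2) = 0" if "t \<in> {..<k} - {..N - 1}" for t
      using that by (simp add: binomial_eq_0)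
    show "(- 1) ^ t * real ((N - 1) choose t) * pospow (N - 2) (y - real t * x) = 0" if "t \<in> {..N - 1} - {..<k}" for t
    proof -
      have "real k * x \<le> real t * x" using that x by (intro mult_right_mono) auto
      then show ?thesis using y by (simp add: pospow_def)
    qed
    show "(- 1) ^ t * real ((N - 1) choose t) * pospow (N - 2) (y - real t * x)
        = (- 1) ^ t * real ((N - 1) choose t) * (y - real t * x) ^ (N - 2)" if "t \<in> {..N - 1} \<inter> {..<k}" for t
    proof -
      have "real t * x \<le> (real k - 1) * x" using that x by (intro mult_right_mono) auto
      then show ?thesis using y by (simp add: pospow_def)
    qed
  qed auto
  also have "\<dots> = (\<Sum>t = 1..k. real ((N - 1) choose (t - 1)) * (- 1) ^ (t + 1) * (y - real (t - 1) * x) ^ (N - 2))"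
    by (simp add: sum.atLeast1_atMost_eq mult_ac)
  also have "\<dots> = (\<Sum>t = 1..k. real ((N - 1) choose (t - 1)) * (- 1) ^ (t + 1) *
      (\<Sum>i = 0..N - 2. real ((N - 2) choose i) * (1 - real t) ^ i * (y ^ (N - 2 - i) * x ^ i)))"
  proof (intro sum.cong refl arg_cong2[where f="(*)"])
    fix t assume t: "t \<in> {1..k}"
    have "y - real (t - 1) * x = (1 - real t) * x + y"
      using t by (simp add: of_nat_diff algebra_simps)
    then show "(y - real (t - 1) * x) ^ (N - 2) = (\<Sum>i = 0..N - 2. real ((N - 2) choose i) * (1 - real t) ^ i * (y ^ (N - 2 - i) * x ^ i))"
      by (simp only: binomial_ring power_mult_distrib atMost_atLeast0 mult_ac)
  qed
  finally have *: "(\<Sum>t\<le>N - 1. (- 1) ^ t * real ((N - 1) choose t) * pospow (N - 2) (y - real t * x)) = \<dots>" .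
  have N2: "N - 1 - 1 = N - 2" by simp
  show ?thesis
    unfolding trunc_sum_density_def N2 * beam_density_def by (simp add: sum_distrib_left mult_ac)
qed

text \<open>For \<open>y \<ge> 0\<close> under coverage exactly one half-open cell contains the
  point, the one with \<open>k = \<lfloor>y / x\<rfloor> + 1\<close>. It is among the first
  \<open>m\<close> because \<open>T * y < T * (c + y) < x\<close> gives
  \<open>y / x < 1 / T\<close>. For \<open>y < 0\<close> both sides vanish.\<close>

lemma sum_cells:
  assumes N: "N \<ge> 2" and T: "T > 0" and c: "c > 0" and m: "1 / T \<le> real m" and x: "x > 0"
  shows "indicator {y. T * (c + y) < x} y * ennreal (real N * exp (- x) * trunc_sum_density (N - 1) x y)
    = (\<Sum>k\<in>{1..m}. indicator (cell c T k) (x, y) * ennreal (beam_density N k x y))"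
proof -
  consider "y < 0" | "\<not> T * (c + y) < x" | "0 \<le> y" "T * (c + y) < x" by linarith
  then show ?thesis
  proof cases
    case 1
    have "y - real t * x < 0" for t
    proof -
      have "0 \<le> real t * x" using x by simp
      then show ?thesis using 1 by linarith
    qed
    then have "pospow j (y - real t * x) = 0" for t j
      unfolding pospow_def by (intro if_not_P) (simp only: not_le)
    then have "trunc_sum_density (N - 1) x y = 0"
      by (simp add: trunc_sum_density_def)
    moreover have "indicator (cell c T k) (x, y) = (0 :: ennreal)" if "k \<in> {1..m}" for k
    proof -
      have "0 \<le> (real k - 1) * x" using x that by simp
      then show ?thesis using 1 by (auto simp: cell_def)
    qed
    ultimately show ?thesis by simp
  next
    case 2
    then show ?thesis by (simp add: cell_def)
  next
    case 3
    define r where "r = y / x"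
    have r: "0 \<le> r" "y = r * x" using 3 x by (auto simp: r_def)
    define k0 where "k0 = nat \<lfloor>r\<rfloor> + 1"
    have "T * y < x" using 3 T c by (auto simp: algebra_simps intro: le_less_trans[rotated])
    then have "r < 1 / T" using x T by (simp add: r_def field_simps)
    then have "r < real m" using m by simp
    then have k0: "k0 \<in> {1..m}" using r unfolding k0_def by (auto simp: floor_less_iff nat_less_iff Suc_le_eq)
    have "real k0 = real_of_int \<lfloor>r\<rfloor> + 1" using r by (simp add: k0_def)
    then have rk: "real k0 - 1 \<le> r" "r < real k0" by linarith+
    have cell: "(x, y) \<in> cell c T k \<longleftrightarrow> k = k0" if "k \<in> {1..m}" for k
    proof -
      have "(x, y) \<in> cell c T k \<longleftrightarrow> real k - 1 \<le> r \<and> r < real k"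
        unfolding cell_def using 3 x by (simp add: r(2))
      also have "\<dots> \<longleftrightarrow> k = k0"
        using rk by linarith
      finally show ?thesis .
    qed
    have "(\<Sum>k\<in>{1..m}. indicator (cell c T k) (x, y) * ennreal (beam_density N k x y))
      = (\<Sum>k\<in>{1..m}. if k = k0 then ennreal (beam_density N k x y) else 0)"
      using cell by (intro sum.cong refl) (auto simp: indicator_def)
    also have "\<dots> = ennreal (beam_density N k0 x y)" using k0 by simp
    also have "beam_density N k0 x y = real N * exp (- x) * trunc_sum_density (N - 1) x y"
      using rk x k0 by (intro beam_density_eq_trunc_sum_density[symmetric] N) (auto simp: r(2))
    finally show ?thesis using 3 by simp
  qed
qed

lemma borel_measurable_beam_density[measurable (raw)]:
  assumes "f \<in> borel_measurable M" "g \<in> borel_measurable M"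
  shows "(\<lambda>p. beam_density N k (f p) (g p)) \<in> borel_measurable M"
  unfolding beam_density_def using assms by measurable

lemma sets_cell[measurable]: "cell c T k \<in> sets (borel \<Otimes>\<^sub>M borel)"
proof -
  have "{p \<in> space (borel \<Otimes>\<^sub>M borel). 0 < fst p \<and> T * (c + snd p) < fst p \<and> (real k - 1) * fst p \<le> snd p \<and> snd p < real k * fst p}
      \<in> sets (borel \<Otimes>\<^sub>M borel)"
    by measurable
  moreover have "{p \<in> space (borel \<Otimes>\<^sub>M borel). 0 < fst p \<and> T * (c + snd p) < fst p \<and> (real k - 1) * fst p \<le> snd p \<and> snd p < real k * fst p}
      = cell c T k"
    by (auto simp: cell_def space_pair_measure)
  ultimately show ?thesis by simp
qed

definition cell_mass :: "nat \<Rightarrow> real \<Rightarrow> real \<Rightarrow> nat \<Rightarrow> ennreal" where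
  "cell_mass N c T k = (\<integral>\<^sup>+y. (\<integral>\<^sup>+x. indicator (cell c T k) (x, y) * ennreal (beam_density N k x y) \<partial>lborel) \<partial>lborel)"

lemma emeasure_covered_low_threshold:
  assumes N: "N \<ge> 2" and T: "T > 0" and c: "c > 0" and m: "1 / T \<le> real m"
  shows "emeasure (PiM {1..N} (\<lambda>_. std_exponential)) {x \<in> space (PiM {1..N} (\<lambda>_. borel)). covered N c T x}
    = (\<Sum>k\<in>{1..m}. cell_mass N c T k)"
proof -
  let ?Q = "\<lambda>x. \<integral>\<^sup>+y. indicator {y. T * (c + y) < x} y * ennreal (trunc_sum_density (N - 1) x y) \<partial>lborel"
  have [measurable]: "{p. T * (c + snd p) < fst p} \<in> sets (borel \<Otimes>\<^sub>M (borel :: real measure))"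
  proof -
    have "{p \<in> space (borel \<Otimes>\<^sub>M (borel :: real measure)). T * (c + snd p) < fst p} \<in> sets (borel \<Otimes>\<^sub>M borel)"
      by measurable
    then show ?thesis by (simp add: space_pair_measure)
  qed
  have ind: "indicator {y. T * (c + y) < x} y = (indicator {p. T * (c + snd p) < fst p} (x, y) :: ennreal)" for x y
    by (simp add: indicator_def)
  have Q[measurable]: "?Q \<in> borel_measurable borel"
    unfolding ind by measurable
  have "(\<integral>\<^sup>+x. (\<integral>\<^sup>+w. indicator {w. strongest (\<lambda>i. i < n) ({1..N} - {n}) x w \<and> T * (c + (\<Sum>i\<in>{1..N} - {n}. w i)) < x} w
        \<partial>PiM ({1..N} - {n}) (\<lambda>_. std_exponential)) \<partial>std_exponential)
    = (\<integral>\<^sup>+x. ?Q x \<partial>std_exponential)" if n: "n \<in> {1..N}" for n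
  proof (rule nn_integral_cong_AE)
    have "AE x in std_exponential. x \<noteq> 0 \<and> 0 \<le> x"
      using AE_lborel_singleton[of "0::real"] by (subst AE_density) (auto simp: exponential_density_def elim!: eventually_mono)
    then show "AE x in std_exponential. (\<integral>\<^sup>+w. indicator {w. strongest (\<lambda>i. i < n) ({1..N} - {n}) x w \<and> T * (c + (\<Sum>i\<in>{1..N} - {n}. w i)) < x} w
        \<partial>PiM ({1..N} - {n}) (\<lambda>_. std_exponential)) = ?Q x"
    proof eventually_elim
      case (elim x)
      then have x: "x > 0" by simp
      have card: "card ({1..N} - {n}) = N - 1" using n by simp
      then have ne: "{1..N} - {n} \<noteq> {}" using N by (metis One_nat_def Suc_1 card.empty diff_is_0_eq not_less_eq_eq)
      have "(\<integral>\<^sup>+w. indicator {w. strongest (\<lambda>i. i < n) ({1..N} - {n}) x w \<and> T * (c + (\<Sum>i\<in>{1..N} - {n}. w i)) < x} w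
          \<partial>PiM ({1..N} - {n}) (\<lambda>_. std_exponential))
        = (\<integral>\<^sup>+w. indicator {w. strongest (\<lambda>i. i < n) ({1..N} - {n}) x w} w * indicator {y. T * (c + y) < x} (\<Sum>i\<in>{1..N} - {n}. w i)
          \<partial>PiM ({1..N} - {n}) (\<lambda>_. std_exponential))"
        by (intro nn_integral_cong) (auto simp: indicator_def)
      also have "\<dots> = ?Q x"
        by (subst nn_integral_strongest[OF _ ne x]) (auto simp: card simp del: One_nat_def)
      finally show ?case .
    qed
  qed
  \<comment> \<open>With the tie-breaking integrated away, the summand no longer depends on
    \<open>n\<close>; this is the factor \<open>N\<close> of the beam density.\<close>
  then have "emeasure (PiM {1..N} (\<lambda>_. std_exponential)) {x \<in> space (PiM {1..N} (\<lambda>_. borel)). covered N c T x}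
    = ennreal (real N) * (\<integral>\<^sup>+x. ?Q x \<partial>std_exponential)"
    unfolding emeasure_covered[OF T] by (simp del: One_nat_def) (simp add: ennreal_of_nat_eq_real_of_nat)
  also have "(\<integral>\<^sup>+x. ?Q x \<partial>std_exponential) = (\<integral>\<^sup>+x. ennreal (exp (- x)) * indicator {0..} x * ?Q x \<partial>lborel)"
    by (rule nn_integral_std_exponential[OF Q])
  also have "ennreal (real N) * \<dots> = (\<integral>\<^sup>+x. ennreal (real N) * (ennreal (exp (- x)) * indicator {0..} x * ?Q x) \<partial>lborel)"
    by (rule nn_integral_cmult[symmetric]) measurable
  also have "\<dots> = (\<integral>\<^sup>+x. (\<integral>\<^sup>+y. (\<Sum>k\<in>{1..m}. indicator (cell c T k) (x, y) * ennreal (beam_density N k x y)) \<partial>lborel) \<partial>lborel)"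
  proof (rule nn_integral_cong_AE)
    show "AE x in lborel. ennreal (real N) * (ennreal (exp (- x)) * indicator {0..} x * ?Q x)
      = (\<integral>\<^sup>+y. (\<Sum>k\<in>{1..m}. indicator (cell c T k) (x, y) * ennreal (beam_density N k x y)) \<partial>lborel)"
      using AE_lborel_singleton[of "0::real"]
    proof eventually_elim
      case (elim x)
      show ?case
      proof (cases "x > 0")
        case True
        have "ennreal (real N) * (ennreal (exp (- x)) * indicator {0..} x * ?Q x) = ennreal (real N * exp (- x)) * ?Q x"
          using True by (simp add: ennreal_mult mult.assoc)
        also have "\<dots> = (\<integral>\<^sup>+y. ennreal (real N * exp (- x)) * (indicator {y. T * (c + y) < x} y * ennreal (trunc_sum_density (N - 1) x y)) \<partial>lborel)"
          by (rule nn_integral_cmult[symmetric]) measurable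
        also have "\<dots> = (\<integral>\<^sup>+y. (\<Sum>k\<in>{1..m}. indicator (cell c T k) (x, y) * ennreal (beam_density N k x y)) \<partial>lborel)"
        proof (rule nn_integral_cong)
          fix y
          have "ennreal (real N * exp (- x)) * (indicator {y. T * (c + y) < x} y * ennreal (trunc_sum_density (N - 1) x y))
            = indicator {y. T * (c + y) < x} y * ennreal (real N * exp (- x) * trunc_sum_density (N - 1) x y)"
            by (simp add: ennreal_mult' mult_ac)
          also have "\<dots> = (\<Sum>k\<in>{1..m}. indicator (cell c T k) (x, y) * ennreal (beam_density N k x y))"
            by (rule sum_cells[OF N T c m True])
          finally show "ennreal (real N * exp (- x)) * (indicator {y. T * (c + y) < x} y * ennreal (trunc_sum_density (N - 1) x y)) = \<dots>" .
        qed
        finally show ?thesis .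
      next
        case False
        then show ?thesis using elim by (simp add: cell_def)
      qed
    qed
  qed
  also have "\<dots> = (\<integral>\<^sup>+y. (\<integral>\<^sup>+x. (\<Sum>k\<in>{1..m}. indicator (cell c T k) (x, y) * ennreal (beam_density N k x y)) \<partial>lborel) \<partial>lborel)"
    by (rule lborel_pair.Fubini') measurable
  also have "\<dots> = (\<Sum>k\<in>{1..m}. cell_mass N c T k)"
    unfolding cell_mass_def by (subst nn_integral_sum[symmetric], measurable)+
  finally show ?thesis .
qed

text \<open>Converts iterated Bochner integrals with known values into the mass of a cell. The sign
  of the integrand is taken from \<open>trunc_sum_density\<close>, since the expansion does not show
  it. The conclusion \<open>0 \<le> W\<close> is what later allows the closed forms to be added
  under \<open>ennreal\<close>.\<close>

lemma cell_mass_eq: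
  assumes N: "N \<ge> 2" and k: "k \<ge> 1"
    and inner: "AE y in lborel. has_bochner_integral lborel (\<lambda>x. indicator (cell c T k) (x, y) * beam_density N k x y) (F y)"
    and outer: "has_bochner_integral lborel F W"
  shows "cell_mass N c T k = ennreal W" "0 \<le> W"
proof -
  have nonneg: "0 \<le> indicator (cell c T k) (x, y) * beam_density N k x y" for x y
  proof (cases "(x, y) \<in> cell c T k")
    case True
    then have "beam_density N k x y = real N * exp (- x) * trunc_sum_density (N - 1) x y"
      by (intro beam_density_eq_trunc_sum_density[symmetric] N k) (auto simp: cell_def)
    moreover have "0 \<le> trunc_sum_density (N - 1) x y"
      using True N by (intro trunc_sum_density_nonneg) (auto simp: cell_def)
    ultimately show ?thesis by simp
  qed simp
  have F: "AE y in lborel. 0 \<le> F y"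
    using inner
  proof eventually_elim
    case (elim y)
    show ?case
      unfolding has_bochner_integral_integral_eq[OF elim, symmetric] by (intro integral_nonneg_AE AE_I2 nonneg)
  qed
  have "cell_mass N c T k = (\<integral>\<^sup>+y. ennreal (F y) \<partial>lborel)"
    unfolding cell_mass_def
  proof (rule nn_integral_cong_AE)
    show "AE y in lborel. (\<integral>\<^sup>+x. indicator (cell c T k) (x, y) * ennreal (beam_density N k x y) \<partial>lborel) = ennreal (F y)"
      using inner
    proof eventually_elim
      case (elim y)
      have "(\<integral>\<^sup>+x. indicator (cell c T k) (x, y) * ennreal (beam_density N k x y) \<partial>lborel)
        = (\<integral>\<^sup>+x. ennreal (indicator (cell c T k) (x, y) * beam_density N k x y) \<partial>lborel)"
        by (intro nn_integral_cong) (simp add: indicator_def)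
      also have "\<dots> = ennreal (F y)"
        using elim nonneg by (subst nn_integral_eq_integral) (auto simp: has_bochner_integral_iff)
      finally show ?case .
    qed
  qed
  also have "\<dots> = ennreal W"
    using outer F by (subst nn_integral_eq_integral) (auto simp: has_bochner_integral_iff)
  finally show "cell_mass N c T k = ennreal W" .
  show "0 \<le> W"
    unfolding has_bochner_integral_integral_eq[OF outer, symmetric] by (rule integral_nonneg_AE[OF F])
qed

section \<open>Masses of the first, middle and last cells\<close>

lemma bk_pos:
  assumes "N \<ge> 1" "\<rho> > 0" "T > 0" "k \<ge> 1" "real k * T < 1"
  shows "0 < bk N \<rho> T k"
proof -
  have "0 < 1 / real k - T" using assms by (simp add: field_simps)
  then show ?thesis using assms by (simp add: bk_def)
qed

text \<open>As functions of the height \<open>y\<close>, the abscissa \<open>y / k\<close> of the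
  ray grows faster than that of the line, because \<open>1 / k > T\<close>. So the ray overtakes the
  line exactly once, at height \<open>bk N \<rho> T k\<close>.\<close>

lemma le_bk_iff:
  assumes "\<rho> > 0" "k \<ge> 1" "real k * T < 1"
  shows "y \<le> bk N \<rho> T k \<longleftrightarrow> y / real k \<le> T * (real N / \<rho> + y)"
proof -
  have p: "0 < 1 / real k - T" using assms by (simp add: field_simps)
  have "bk N \<rho> T k = T * (real N / \<rho>) / (1 / real k - T)"
    using assms p by (simp add: bk_def field_simps)
  then have "y \<le> bk N \<rho> T k \<longleftrightarrow> y * (1 / real k - T) \<le> T * (real N / \<rho>)"
    by (simp only: pos_le_divide_eq[OF p])
  also have "\<dots> \<longleftrightarrow> y / real k \<le> T * (real N / \<rho> + y)"
    by (simp add: algebra_simps)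
  finally show ?thesis .
qed

lemma cell_mass_first:
  assumes N: "N \<ge> 2" and \<rho>: "\<rho> > 0" and T: "T > 0" "T < 1"
  shows "cell_mass N (real N / \<rho>) T 1 = ennreal (P_first N \<rho> T)" "0 \<le> P_first N \<rho> T"
proof -
  let ?c = "real N / \<rho>"
  let ?b = "bk N \<rho> T 1"
  have c: "?c > 0" using N \<rho> by simp
  have b: "?b > 0" using N \<rho> T by (intro bk_pos) auto
  have b_iff: "y \<le> ?b \<longleftrightarrow> y \<le> T * (?c + y)" for y
    using le_bk_iff[of \<rho> 1 T y N] \<rho> T by simp
  \<comment> \<open>The slice starts at \<open>T * (?c + y)\<close> for heights up to
    \<open>?b\<close> and at \<open>y\<close> above. The bounded range of heights is written as a
    difference of two half-lines, because the closed forms available are tails.\<close>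
  let ?F = "\<lambda>y. indicator {0<..} y * beam_tail N 1 y (T * (?c + y)) - indicator {?b<..} y * beam_tail N 1 y (T * (?c + y))
     + indicator {?b<..} y * beam_tail N 1 y (y / 1)"
  let ?W = "xi N 1 (\<lambda>i l. exp (- T * ?c) * (T ^ l / fact l) * threshold_tail N ?c T i l 0)
    - xi N 1 (\<lambda>i l. exp (- T * ?c) * (T ^ l / fact l) * threshold_tail N ?c T i l ?b)
    + xi N 1 (\<lambda>i l. 1 / (1 ^ l * fact l) * gamma_tail (N - i + l - 2) ((1 + 1) / 1) ?b)"
  have outer: "has_bochner_integral lborel ?F ?W"
    using b by (intro has_bochner_integral_add has_bochner_integral_diff has_bochner_integral_threshold_tail
        has_bochner_integral_ray_tail N T) auto
  \<comment> \<open>The height \<open>y = 0\<close> has to be excepted: its slice of the cell is not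
    empty, but \<open>{0<..}\<close> omits it.\<close>
  have inner: "AE y in lborel. has_bochner_integral lborel (\<lambda>x. indicator (cell ?c T 1) (x, y) * beam_density N 1 x y) (?F y)"
    using AE_lborel_singleton[of "0::real"]
  proof eventually_elim
    case (elim y)
    consider "y < 0" | "0 < y" "y \<le> ?b" | "?b < y" using elim by linarith
    then show ?case
    proof cases
      case 1
      then show ?thesis using b by (auto simp: cell_def intro!: has_bochner_integral_zero)
    next
      case 2
      have "(\<lambda>x. indicator (cell ?c T 1) (x, y) * beam_density N 1 x y) = (\<lambda>x. indicator {T * (?c + y)<..} x * beam_density N 1 x y)"
        using 2 b_iff[of y] by (auto simp: cell_def indicator_def fun_eq_iff)
      then show ?thesis
        using 2 c T has_bochner_integral_beam_tail[of "T * (?c + y)" N 1 y] by simp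
    next
      case 3
      then have "T * (?c + y) < y" using b_iff[of y] by simp
      then have "(\<lambda>x. indicator (cell ?c T 1) (x, y) * beam_density N 1 x y) = (\<lambda>x. indicator {y<..} x * beam_density N 1 x y)"
        using 3 b by (auto simp: cell_def indicator_def fun_eq_iff)
      then show ?thesis
        using 3 b has_bochner_integral_beam_tail[of y N 1 y] by simp
    qed
  qed
  have W: "?W = P_first N \<rho> T"
  proof -
    \<comment> \<open>For the tail starting at 0 only the term \<open>u = 0\<close> survives, which
      explains the leading 1 in the bracket of \<open>C1\<close>.\<close>
    have z: "(\<Sum>u = 0..n. q ^ u * (0 ^ u / fact u)) = (1 :: real)" for n and q :: real
    proof -
      have "(\<Sum>u = 0..n. q ^ u * (0 ^ u / fact u)) = (\<Sum>u = 0..n. if u = 0 then 1 else 0 :: real)"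
        by (intro sum.cong refl) (auto simp: power_0_left)
      then show ?thesis by simp
    qed
    have n1: "N - 2 + 1 = N - 1" using N by simp
    have C1: "C1 N \<rho> T = gamma_tail (N - 2) (T + 1) 0 - gamma_tail (N - 2) (T + 1) ?b"
      unfolding C1_def gamma_tail_def z n1 by (simp add: right_diff_distrib)
    have C2: "C2 N \<rho> T = gamma_tail (N - 2) 2 ?b"
      unfolding C2_def gamma_tail_def n1 by simp
    have t: "threshold_tail N ?c T 0 0 b = gamma_tail (N - 2) (T + 1) b" for b
      by (simp add: threshold_tail_def)
    show ?thesis
      unfolding xi_1[OF N] P_first_def C1 C2 t by (simp add: right_diff_distrib distrib_left)
  qed
  show "cell_mass N ?c T 1 = ennreal (P_first N \<rho> T)" "0 \<le> P_first N \<rho> T"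
    using cell_mass_eq[OF N _ inner outer] unfolding W by simp_all
qed

text \<open>For \<open>k \<ge> 2\<close> every slice has the upper end \<open>y / (k - 1)\<close>,
  and \<open>\<alpha>\<close> stands for whichever of the two lower ends, line or ray, dominates at
  the height \<open>y\<close>.\<close>

lemma has_bochner_integral_cell_strip:
  assumes k: "k \<ge> 2" and \<alpha>: "0 \<le> \<alpha>" "\<alpha> < y / (real k - 1)"
    and cell: "\<And>x. x > 0 \<Longrightarrow> x \<le> y / (real k - 1) \<Longrightarrow> T * (real N / \<rho> + y) < x \<and> y / real k < x \<longleftrightarrow> \<alpha> < x"
  shows "has_bochner_integral lborel (\<lambda>x. indicator (cell (real N / \<rho>) T k) (x, y) * beam_density N k x y)
    (beam_tail N k y \<alpha> - beam_tail N k y (y / (real k - 1)))"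
proof -
  have "indicator (cell (real N / \<rho>) T k) (x, y) = (indicator {\<alpha><..y / (real k - 1)} x :: real)" for x
  proof (cases "x > 0")
    case True
    have "(x, y) \<in> cell (real N / \<rho>) T k \<longleftrightarrow> T * (real N / \<rho> + y) < x \<and> x \<le> y / (real k - 1) \<and> y / real k < x"
      using True k by (auto simp: cell_def field_simps)
    also have "\<dots> \<longleftrightarrow> \<alpha> < x \<and> x \<le> y / (real k - 1)"
      using cell[OF True] by auto
    finally show ?thesis by (simp add: indicator_def)
  next
    case False
    then show ?thesis using \<alpha> by (auto simp: cell_def indicator_def)
  qed
  then show ?thesis
    using \<alpha> by (simp add: has_bochner_integral_beam_strip)
qed

text \<open>Up to the crossing height of the ray that bounds the slice from above, the line lies at
  or beyond that ray, so the two constraints on \<open>x\<close> contradict each other.\<close>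

lemma cell_slice_empty:
  assumes \<rho>: "\<rho> > 0" and k: "k \<ge> 2" and y: "y \<le> bk N \<rho> T (k - 1)"
    and kT: "real (k - 1) * T < 1"
  shows "(x, y) \<notin> cell (real N / \<rho>) T k"
proof
  assume "(x, y) \<in> cell (real N / \<rho>) T k"
  then have x: "T * (real N / \<rho> + y) < x" "(real k - 1) * x \<le> y" by (auto simp: cell_def)
  have "real (k - 1) = real k - 1" using k by simp
  then have "y / (real k - 1) \<le> T * (real N / \<rho> + y)"
    using le_bk_iff[of \<rho> "k - 1" T y N] \<rho> k y kT by simp
  moreover have "x \<le> y / (real k - 1)" using x k by (simp add: field_simps)
  ultimately show False using x by simp
qed

lemma less_ray:
  assumes \<rho>: "\<rho> > 0" and k: "k \<ge> 2" and y: "bk N \<rho> T (k - 1) < y" and kT: "real (k - 1) * T < 1"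
  shows "T * (real N / \<rho> + y) < y / (real k - 1)"
proof -
  have "real (k - 1) = real k - 1" using k by simp
  then show ?thesis
    using le_bk_iff[of \<rho> "k - 1" T y N] \<rho> k y kT by (simp add: not_le[symmetric])
qed

lemma cell_mass_middle:
  assumes N: "N \<ge> 2" and \<rho>: "\<rho> > 0" and T: "T > 0" and k: "k \<ge> 2" and kT: "real k * T < 1"
  shows "cell_mass N (real N / \<rho>) T k = ennreal (P_middle N \<rho> T k)" "0 \<le> P_middle N \<rho> T k"
proof -
  let ?c = "real N / \<rho>"
  let ?a = "bk N \<rho> T (k - 1)" and ?b = "bk N \<rho> T k"
  have c: "?c > 0" using N \<rho> by simp
  have k1: "real (k - 1) = real k - 1" using k by simp
  have kT': "real (k - 1) * T < 1" using kT T k1 by (simp add: algebra_simps)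
  have a: "?a > 0" using N \<rho> T k kT' by (intro bk_pos) auto
  have b: "?b > 0" using N \<rho> T k kT by (intro bk_pos) auto
  have b_iff: "y \<le> ?b \<longleftrightarrow> y / real k \<le> T * (?c + y)" for y
    using le_bk_iff[of \<rho> k T y N] \<rho> k kT by simp
  have a_iff: "y \<le> ?a \<longleftrightarrow> y / (real k - 1) \<le> T * (?c + y)" for y
    using le_bk_iff[of \<rho> "k - 1" T y N] \<rho> k kT' k1 by simp
  have ab: "?a \<le> ?b"
  proof -
    have "?a / real k \<le> ?a / (real k - 1)" using a k by (intro divide_left_mono) auto
    also have "\<dots> \<le> T * (?c + ?a)" using a_iff[of ?a] by simp
    finally show ?thesis using b_iff[of ?a] by simp
  qed
  \<comment> \<open>Three regimes: nothing up to \<open>?a\<close>, the strip from the line to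
    \<open>y / (k - 1)\<close> between \<open>?a\<close> and \<open>?b\<close>, and the strip
    between the two rays above \<open>?b\<close>. The three brackets integrate to the contributions
    of \<open>D1\<close>, of \<open>D2\<close>, and of \<open>E1\<close> with \<open>E2\<close>; the
    first two vanish above \<open>?b\<close>.\<close>
  let ?F = "\<lambda>y. (indicator {?a<..} y * beam_tail N k y (T * (?c + y)) - indicator {?b<..} y * beam_tail N k y (T * (?c + y)))
     - (indicator {?a<..} y * beam_tail N k y (y / (real k - 1)) - indicator {?b<..} y * beam_tail N k y (y / (real k - 1)))
     + (indicator {?b<..} y * beam_tail N k y (y / real k) - indicator {?b<..} y * beam_tail N k y (y / (real k - 1)))"
  let ?U = "\<lambda>b. xi N k (\<lambda>i l. exp (- T * ?c) * (T ^ l / fact l) * threshold_tail N ?c T i l b)"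
  let ?V = "\<lambda>j b. xi N k (\<lambda>i l. 1 / (j ^ l * fact l) * gamma_tail (N - i + l - 2) ((j + 1) / j) b)"
  let ?W = "(?U ?a - ?U ?b) - (?V (real k - 1) ?a - ?V (real k - 1) ?b) + (?V (real k) ?b - ?V (real k - 1) ?b)"
  have outer: "has_bochner_integral lborel ?F ?W"
    using a b k by (intro has_bochner_integral_add has_bochner_integral_diff has_bochner_integral_threshold_tail
        has_bochner_integral_ray_tail N T) auto
  have inner: "has_bochner_integral lborel (\<lambda>x. indicator (cell ?c T k) (x, y) * beam_density N k x y) (?F y)" for y
  proof -
    consider "y \<le> ?a" | "?a < y" "y \<le> ?b" | "?b < y" by linarith
    then show ?thesis
    proof cases
      case 1
      then show ?thesis
        using ab cell_slice_empty[OF \<rho> k 1 kT'] by (auto intro!: has_bochner_integral_zero)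
    next
      case 2
      have "has_bochner_integral lborel (\<lambda>x. indicator (cell ?c T k) (x, y) * beam_density N k x y)
         (beam_tail N k y (T * (?c + y)) - beam_tail N k y (y / (real k - 1)))"
        using less_ray[OF \<rho> k 2(1) kT'] b_iff[of y] 2 a c T
        by (intro has_bochner_integral_cell_strip k) auto
      then show ?thesis using 2 by simp
    next
      case 3
      then have y: "T * (?c + y) < y / real k" "0 < y" using b_iff[of y] b by auto
      have "has_bochner_integral lborel (\<lambda>x. indicator (cell ?c T k) (x, y) * beam_density N k x y)
         (beam_tail N k y (y / real k) - beam_tail N k y (y / (real k - 1)))"
        using y 3 ab k by (intro has_bochner_integral_cell_strip k) (auto intro!: divide_strict_left_mono)
      then show ?thesis using 3 ab by simp
    qed
  qed
  have W: "?W = P_middle N \<rho> T k"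
  proof -
    have Nv: "N - i + v - 2 + 1 = N - i + v - 1" if "i \<le> N - 2" for i v
      using that N by auto
    have D1: "D1 N \<rho> T k i l = threshold_tail N ?c T i l ?a - threshold_tail N ?c T i l ?b" if "i \<le> N - 2" for i l
      unfolding D1_def threshold_tail_def gamma_tail_def Nv[OF that] sum_subtractf[symmetric]
    proof (intro sum.cong refl)
      fix v
      have "(\<Sum>u = 0..n. p ^ u / fact u * (ea * ?a ^ u - eb * ?b ^ u))
        = ea * (\<Sum>u = 0..n. p ^ u * (?a ^ u / fact u)) - eb * (\<Sum>u = 0..n. p ^ u * (?b ^ u / fact u))" for p ea eb n
        by (simp add: right_diff_distrib sum_subtractf sum_distrib_left mult_ac)
      then show "real (l choose v) * ?c ^ (l - v) * (fact (N - i + v - 2) / (T + 1) ^ (N - i + v - 1)) *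
          (\<Sum>u = 0..N - i + v - 2. (T + 1) ^ u / fact u * (exp (- (T + 1) * ?a) * ?a ^ u - exp (- (T + 1) * ?b) * ?b ^ u))
        = real (l choose v) * ?c ^ (l - v) * (fact (N - i + v - 2) / (T + 1) ^ (N - i + v - 1) * exp (- (T + 1) * ?a) *
            (\<Sum>u = 0..N - i + v - 2. (T + 1) ^ u * (?a ^ u / fact u)))
        - real (l choose v) * ?c ^ (l - v) * (fact (N - i + v - 2) / (T + 1) ^ (N - i + v - 1) * exp (- (T + 1) * ?b) *
            (\<Sum>u = 0..N - i + v - 2. (T + 1) ^ u * (?b ^ u / fact u)))"
        by (simp only: right_diff_distrib mult.assoc)
    qed
    have q: "(real k - 1 + 1) / (real k - 1) = real k / (real k - 1)" by simp
    have D2: "D2 N \<rho> T k i l = gamma_tail (N - i + l - 2) ((real k - 1 + 1) / (real k - 1)) ?a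
        - gamma_tail (N - i + l - 2) ((real k - 1 + 1) / (real k - 1)) ?b" if "i \<le> N - 2" for i l
      unfolding D2_def gamma_tail_def Nv[OF that] q Let_def by (simp add: right_diff_distrib mult.assoc)
    have E1: "E1 N \<rho> T k i l = gamma_tail (N - i + l - 2) ((real k + 1) / real k) ?b" if "i \<le> N - 2" for i l
      unfolding E1_def gamma_tail_def Nv[OF that] Let_def ..
    have E2: "E2 N \<rho> T k i l = gamma_tail (N - i + l - 2) ((real k - 1 + 1) / (real k - 1)) ?b" if "i \<le> N - 2" for i l
      unfolding E2_def gamma_tail_def Nv[OF that] q Let_def ..
    have Tc: "- T * real N / \<rho> = - T * ?c" by simp
    have "P_middle N \<rho> T k =
      xi N k (\<lambda>i l. (exp (- T * ?c) * (T ^ l / fact l) * threshold_tail N ?c T i l ?a - exp (- T * ?c) * (T ^ l / fact l) * threshold_tail N ?c T i l ?b)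
        - (1 / ((real k - 1) ^ l * fact l) * gamma_tail (N - i + l - 2) ((real k - 1 + 1) / (real k - 1)) ?a
          - 1 / ((real k - 1) ^ l * fact l) * gamma_tail (N - i + l - 2) ((real k - 1 + 1) / (real k - 1)) ?b))
      + xi N k (\<lambda>i l. 1 / (real k ^ l * fact l) * gamma_tail (N - i + l - 2) ((real k + 1) / real k) ?b
        - 1 / ((real k - 1) ^ l * fact l) * gamma_tail (N - i + l - 2) ((real k - 1 + 1) / (real k - 1)) ?b)"
      unfolding P_middle_def Tc
      by (intro arg_cong2[where f="(+)"] xi_cong) (simp_all only: D1 D2 E1 E2 right_diff_distrib)
    then show ?thesis by (simp only: xi_diff)
  qed
  show "cell_mass N ?c T k = ennreal (P_middle N \<rho> T k)" "0 \<le> P_middle N \<rho> T k"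
    using cell_mass_eq[OF N _ AE_I2 outer, OF _ inner] k unfolding W by simp_all
qed

lemma cell_mass_last:
  assumes N: "N \<ge> 2" and \<rho>: "\<rho> > 0" and T: "T > 0" and m: "m \<ge> 2" "1 / T \<le> real m" and mT: "real (m - 1) * T < 1"
  shows "cell_mass N (real N / \<rho>) T m = ennreal (P_last N \<rho> T m)" "0 \<le> P_last N \<rho> T m"
proof -
  let ?c = "real N / \<rho>"
  let ?a = "bk N \<rho> T (m - 1)"
  have c: "?c > 0" using N \<rho> by simp
  have a: "?a > 0" using N \<rho> T m mT by (intro bk_pos) auto
  let ?F = "\<lambda>y. indicator {?a<..} y * beam_tail N m y (T * (?c + y)) - indicator {?a<..} y * beam_tail N m y (y / (real m - 1))"
  let ?U = "\<lambda>b. xi N m (\<lambda>i l. exp (- T * ?c) * (T ^ l / fact l) * threshold_tail N ?c T i l b)"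
  let ?V = "\<lambda>j b. xi N m (\<lambda>i l. 1 / (j ^ l * fact l) * gamma_tail (N - i + l - 2) ((j + 1) / j) b)"
  let ?W = "?U ?a - ?V (real m - 1) ?a"
  have outer: "has_bochner_integral lborel ?F ?W"
    using a m by (intro has_bochner_integral_diff has_bochner_integral_threshold_tail
        has_bochner_integral_ray_tail N T) auto
  have inner: "has_bochner_integral lborel (\<lambda>x. indicator (cell ?c T m) (x, y) * beam_density N m x y) (?F y)" for y
  proof (cases "y \<le> ?a")
    case True
    then show ?thesis
      using cell_slice_empty[OF \<rho> m(1) True mT] by (auto intro!: has_bochner_integral_zero)
  next
    case False
    then have y: "?a < y" "0 < y" using a by auto
    \<comment> \<open>Because \<open>1 / T \<le> m\<close>, the ray \<open>y = m * x\<close> never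
      passes the line at positive height. The line is the lower end throughout, and no second
      crossing height occurs.\<close>
    have "y / real m \<le> T * (?c + y)"
    proof -
      have "y * 1 \<le> y * (T * real m)" using m T y by (intro mult_left_mono) (auto simp: field_simps)
      then have "y / real m \<le> T * y" using m by (simp add: field_simps)
      also have "\<dots> \<le> T * (?c + y)" using T c by (intro mult_left_mono) auto
      finally show ?thesis .
    qed
    then have "has_bochner_integral lborel (\<lambda>x. indicator (cell ?c T m) (x, y) * beam_density N m x y)
       (beam_tail N m y (T * (?c + y)) - beam_tail N m y (y / (real m - 1)))"
      using less_ray[OF \<rho> m(1) y(1) mT] y c T
      by (intro has_bochner_integral_cell_strip m) auto
    then show ?thesis using y by simp
  qed
  have W: "?W = P_last N \<rho> T m"
  proof -
    have Nv: "N - i + v - 2 + 1 = N - i + v - 1" if "i \<le> N - 2" for i v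
      using that N by auto
    have F1: "F1 N \<rho> T m i l = threshold_tail N ?c T i l ?a" if "i \<le> N - 2" for i l
      unfolding F1_def threshold_tail_def gamma_tail_def Nv[OF that]
      by (intro sum.cong refl) (simp add: mult.assoc)
    have q: "(real m - 1 + 1) / (real m - 1) = real m / (real m - 1)" by simp
    have F2: "F2 N \<rho> T m i l = gamma_tail (N - i + l - 2) ((real m - 1 + 1) / (real m - 1)) ?a" if "i \<le> N - 2" for i l
      unfolding F2_def gamma_tail_def Nv[OF that] q Let_def ..
    have Tc: "- T * real N / \<rho> = - T * ?c" by simp
    have "P_last N \<rho> T m =
      xi N m (\<lambda>i l. exp (- T * ?c) * (T ^ l / fact l) * threshold_tail N ?c T i l ?a
        - 1 / ((real m - 1) ^ l * fact l) * gamma_tail (N - i + l - 2) ((real m - 1 + 1) / (real m - 1)) ?a)"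
      unfolding P_last_def Tc by (intro xi_cong) (simp only: F1 F2)
    then show ?thesis by (simp only: xi_diff)
  qed
  show "cell_mass N ?c T m = ennreal (P_last N \<rho> T m)" "0 \<le> P_last N \<rho> T m"
    using cell_mass_eq[OF N _ AE_I2 outer, OF _ inner] m unfolding W by simp_all
qed

section \<open>Coverage probabilities\<close>

lemma outage_eq:
  assumes W: "0 \<le> W"
    and eq: "emeasure (PiM {1..N} (\<lambda>_. std_exponential)) {x \<in> space (PiM {1..N} (\<lambda>_. borel)). covered N c T x} = ennreal W"
  shows "outage N c T = 1 - W"
proof -
  let ?\<mu> = "PiM {1..N} (\<lambda>_. std_exponential)"
  interpret \<mu>: prob_space ?\<mu> by (intro prob_space_PiM prob_space_std_exponential)
  let ?A = "{x \<in> space (PiM {1..N} (\<lambda>_. borel)). covered N c T x}"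
  have "?A \<in> sets (PiM {1..N} (\<lambda>_. borel))" by measurable
  then have A: "?A \<in> sets ?\<mu>" by (simp cong: sets_PiM_cong)
  have "{x \<in> space (PiM {1..N} (\<lambda>_. borel)). \<not> covered N c T x} = space ?\<mu> - ?A"
    by (auto simp: space_PiM)
  then have "outage N c T = 1 - measure ?\<mu> ?A"
    unfolding outage_def by (simp only: \<mu>.prob_compl[OF A])
  moreover have "measure ?\<mu> ?A = W"
    using eq W by (simp add: measure_def)
  ultimately show ?thesis by simp
qed

lemma outage_high_threshold:
  assumes N: "N \<ge> 1" and \<rho>: "\<rho> > 0" and T: "T \<ge> 1"
  shows "outage N (real N / \<rho>) T = 1 - real N / (T + 1) ^ (N - 1) * exp (- T * real N / \<rho>)"
proof (rule outage_eq)
  have c: "real N / \<rho> > 0" using N \<rho> by simp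
  have "emeasure (PiM {1..N} (\<lambda>_. std_exponential)) {x \<in> space (PiM {1..N} (\<lambda>_. borel)). covered N (real N / \<rho>) T x}
    = (\<Sum>n\<in>{1..N}. ennreal (exp (- T * (real N / \<rho>)) / (T + 1) ^ (N - 1)))"
    using T by (subst emeasure_covered) (auto intro!: sum.cong simp: nn_integral_strongest_high_threshold[OF _ T c] simp del: One_nat_def)
  also have "\<dots> = ennreal (real N * (exp (- T * (real N / \<rho>)) / (T + 1) ^ (N - 1)))"
    using T by (simp add: ennreal_of_nat_eq_real_of_nat flip: ennreal_mult)
  also have "real N * (exp (- T * (real N / \<rho>)) / (T + 1) ^ (N - 1)) = real N / (T + 1) ^ (N - 1) * exp (- T * real N / \<rho>)"
    by simp
  finally show "emeasure (PiM {1..N} (\<lambda>_. std_exponential)) {x \<in> space (PiM {1..N} (\<lambda>_. borel)). covered N (real N / \<rho>) T x}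
    = ennreal (real N / (T + 1) ^ (N - 1) * exp (- T * real N / \<rho>))" .
qed (use T in auto)

lemma outage_low_threshold:
  assumes N: "N \<ge> 2" and \<rho>: "\<rho> > 0" and T: "0 < T" "T < 1" and m: "m = nat \<lceil>1 / T\<rceil>"
  shows "outage N (real N / \<rho>) T = 1 - (P_first N \<rho> T + (\<Sum>k = 2..m - 1. P_middle N \<rho> T k) + P_last N \<rho> T m)"
proof (rule outage_eq)
  let ?c = "real N / \<rho>"
  have c: "?c > 0" using N \<rho> by simp
  have T1: "1 < 1 / T" using T by simp
  have mT: "1 / T \<le> real m" "real m < 1 / T + 1"
    using T1 ceiling_correct[of "1 / T"] unfolding m by auto
  have m2: "m \<ge> 2" using T1 mT by linarith
  \<comment> \<open>The choice of \<open>m\<close> as a ceiling is used on both sides: every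
    \<open>k < m\<close> satisfies \<open>k < 1 / T\<close>, so the crossing heights with
    \<open>1 \<le> k < m\<close> are positive, while \<open>m\<close> itself reaches
    \<open>1 / T\<close>.\<close>
  have kT: "real k * T < 1" if "k \<le> m - 1" for k
  proof -
    have "real k < 1 / T" using that mT m2 by linarith
    then show ?thesis using T by (simp add: field_simps)
  qed
  have mid: "cell_mass N ?c T k = ennreal (P_middle N \<rho> T k)" "0 \<le> P_middle N \<rho> T k" if "k \<in> {2..m - 1}" for k
    using that kT by (auto intro!: cell_mass_middle[OF N \<rho> T(1)])
  note first = cell_mass_first[OF N \<rho> T]
  note last = cell_mass_last[OF N \<rho> T(1) m2 mT(1) kT[OF order_refl]]
  have nn: "0 \<le> (\<Sum>k = 2..m - 1. P_middle N \<rho> T k)" by (intro sum_nonneg mid)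
  show "0 \<le> P_first N \<rho> T + (\<Sum>k = 2..m - 1. P_middle N \<rho> T k) + P_last N \<rho> T m"
    using first last nn by simp
  \<comment> \<open>\<open>T < 1\<close> forces \<open>m \<ge> 2\<close>, so the first and the last
    cell are distinct.\<close>
  have "{1..m} = insert 1 (insert m {2..m - 1})" using m2 by auto
  then have "(\<Sum>k\<in>{1..m}. cell_mass N ?c T k) = cell_mass N ?c T 1 + (cell_mass N ?c T m + (\<Sum>k = 2..m - 1. cell_mass N ?c T k))"
    using m2 by simp
  also have "\<dots> = ennreal (P_first N \<rho> T) + (ennreal (P_last N \<rho> T m) + ennreal (\<Sum>k = 2..m - 1. P_middle N \<rho> T k))"
  proof -
    have "(\<Sum>k = 2..m - 1. cell_mass N ?c T k) = ennreal (\<Sum>k = 2..m - 1. P_middle N \<rho> T k)"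
      by (subst sum_ennreal[symmetric]) (use mid in \<open>auto intro!: sum.cong simp del: sum_ennreal\<close>)
    then show ?thesis by (simp only: first last)
  qed
  also have "\<dots> = ennreal (P_first N \<rho> T + (\<Sum>k = 2..m - 1. P_middle N \<rho> T k) + P_last N \<rho> T m)"
    using first last nn by (simp add: add_ac flip: ennreal_plus)
  finally show "emeasure (PiM {1..N} (\<lambda>_. std_exponential)) {x \<in> space (PiM {1..N} (\<lambda>_. borel)). covered N ?c T x}
    = ennreal (P_first N \<rho> T + (\<Sum>k = 2..m - 1. P_middle N \<rho> T k) + P_last N \<rho> T m)"
    by (simp only: emeasure_covered_low_threshold[OF N T(1) c mT(1)])
qed

theorem theorem3:
  fixes M :: "'w measure"
    and N D Nr m :: nat
    and \<rho> T :: real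
    and H :: "nat \<Rightarrow> 'w \<Rightarrow> complex ^ 'nt"
    and \<phi> :: "nat \<Rightarrow> nat \<Rightarrow> 'w \<Rightarrow> complex ^ 'nt"
  assumes "prob_space M"
    and "N \<ge> 1" and "D \<ge> 1" and "Nr \<ge> 1"
    and "N * D \<le> CARD('nt)"
    and "\<rho> > 0" and "T > 0"
    and "T < 1 \<Longrightarrow> N \<ge> 2"
    and H_distributed: "\<And>r j. r \<in> {1..Nr} \<Longrightarrow>
      distributed M lborel (\<lambda>\<omega>. H r \<omega> $ j) (\<lambda>z. ennreal (complex_normal_density z))"
    and H_indep:
      "prob_space.indep_vars M (\<lambda>_. borel) (\<lambda>(r, j) \<omega>. H r \<omega> $ j) ({1..Nr} \<times> UNIV)"
    and \<phi>_orthonormal: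
      "AE \<omega> in M. corthonormal_family ({1..N} \<times> {1..D}) (\<lambda>(n, d). \<phi> n d \<omega>)"
    and H_\<phi>_indep:
      "indep_rvs M
         (PiM {1..Nr} (\<lambda>_. borel)) (\<lambda>\<omega>. \<lambda>r\<in>{1..Nr}. H r \<omega>)
         (PiM ({1..N} \<times> {1..D}) (\<lambda>_. borel)) (\<lambda>\<omega>. \<lambda>(n, d)\<in>{1..N} \<times> {1..D}. \<phi> n d \<omega>)"
    and m_def: "m = nat \<lceil>1 / T\<rceil>"
  shows "P_MPG M N D \<rho> H \<phi> T =
      (if T \<ge> 1
       then 1 - (1 - real N / (T + 1) ^ (N - 1) * exp (- T * real N / \<rho>)) ^ D
       else 1 - (1 - (P_first N \<rho> T + (\<Sum>k = 2..m - 1. P_middle N \<rho> T k) + P_last N \<rho> T m)) ^ D)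
    \<and> P_AS_MPG M N D Nr \<rho> H \<phi> T =
      (if T \<ge> 1
       then 1 - (1 - real N / (T + 1) ^ (N - 1) * exp (- T * real N / \<rho>)) ^ (Nr * D)
       else 1 - (1 - (P_first N \<rho> T + (\<Sum>k = 2..m - 1. P_middle N \<rho> T k) + P_last N \<rho> T m))
                  ^ (Nr * D))"
proof -
  interpret prob_space M by fact
  interpret orthogonal_precoding M N D Nr H \<phi>
    by unfold_locales (use assms in auto)
  define q where "q = outage N (real N / \<rho>) T"
  have q: "q = (if T \<ge> 1 then 1 - real N / (T + 1) ^ (N - 1) * exp (- T * real N / \<rho>)
       else 1 - (P_first N \<rho> T + (\<Sum>k = 2..m - 1. P_middle N \<rho> T k) + P_last N \<rho> T m))"
    unfolding q_def using assms
    by (auto simp: outage_high_threshold outage_low_threshold not_le simp del: One_nat_def)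
  have "P_MPG M N D \<rho> H \<phi> T = 1 - q ^ D"
  proof -
    have "T < (MAX (n, d)\<in>{1..N} \<times> {1..D}. sinr N \<rho> (H 1 \<omega>) (\<lambda>i. \<phi> i d \<omega>) n) \<longleftrightarrow>
        (\<exists>r\<in>{1}. \<exists>d\<in>{1..D}. \<exists>n\<in>{1..N}. T < sinr N \<rho> (H r \<omega>) (\<lambda>i. \<phi> i d \<omega>) n)" for \<omega>
      using \<open>N \<ge> 1\<close> \<open>D \<ge> 1\<close> by (subst Max_gr_iff) auto
    then show ?thesis
      using prob_max_sinr[of "{1}" \<rho> T] \<open>Nr \<ge> 1\<close> \<open>\<rho> > 0\<close> by (simp add: P_MPG_def q_def)
  qed
  moreover have "P_AS_MPG M N D Nr \<rho> H \<phi> T = 1 - q ^ (Nr * D)"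
  proof -
    have "T < (MAX (n, d, r)\<in>{1..N} \<times> {1..D} \<times> {1..Nr}. sinr N \<rho> (H r \<omega>) (\<lambda>i. \<phi> i d \<omega>) n) \<longleftrightarrow>
        (\<exists>r\<in>{1..Nr}. \<exists>d\<in>{1..D}. \<exists>n\<in>{1..N}. T < sinr N \<rho> (H r \<omega>) (\<lambda>i. \<phi> i d \<omega>) n)" for \<omega>
      using \<open>N \<ge> 1\<close> \<open>D \<ge> 1\<close> \<open>Nr \<ge> 1\<close> by (subst Max_gr_iff) auto
    then show ?thesis
      using prob_max_sinr[of "{1..Nr}" \<rho> T] \<open>Nr \<ge> 1\<close> \<open>\<rho> > 0\<close> by (simp add: P_AS_MPG_def q_def)
  qed
  ultimately show ?thesis
    unfolding q by simp
qed

end
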